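(* Let $a,b,z>0$ be real numbers, let $F(a,b,z)$ be the free energy of the monopole-dimer model on the square grid with edge weights $a,b$ and vertex weights $z$, and let $\rho_a=a\,\frac{\partial}{\partial a}F(a,b,z)$ be the density of $a$-type dimers. Then $$\rho_a=1-\Lambda_0(\theta_a,k),\qquad \theta_a=\tan^{-1}\left(\sqrt{\frac{4b^2+z^2}{4a^2}}\right),\qquad k=\frac{4ab}{\sqrt{(4a^2+z^2)(4b^2+z^2)}},$$ where $\Lambda_0$ is the Heuman Lambda function.
   Context: Heuman Lambda function with amplitude $\theta$ and modulus $k\in(0,1)$: with $k'=\sqrt{1-k^2}$, $$\Lambda_0(\theta,k)=\frac2\pi\left[E(k)\,F(\theta,k')+K(k)\,E(\theta,k')-K(k)\,F(\theta,k')\right],$$ where $F(\theta,\kappa)=\int_0^\theta\frac{dt}{\sqrt{1-\kappa^2\sin^2t}}$, $E(\theta,\kappa)=\int_0^\theta\sqrt{1-\kappa^2\sin^2t}\,dt$ are the incomplete elliptic integrals and $K(\kappa)=F(\pi/2,\kappa)$, $E(\kappa)=E(\pi/2,\kappa)$ the complete ones. (The two-argument elliptic integral $F(\theta,\kappa)$ is distinct from the free energy $F(a,b,z)$.) The free energy is $$F(a,b,z)=\lim_{\substack{m,n\to\infty\\ m,n\text{ even}}}\frac1{mn}\ln Z_{m,n},$$ where $Z_{m,n}$ is the partition function of the monopole-dimer model on the grid graph $Q_{m,n}$, defined as follows. Grid graph: $Q_{m,n}$ has vertex set $\{(i,j): 1\le i\le m,\ 1\le j\le n\}$ with its standard planar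 embedding as points of $\mathbb{Z}^2$. Edges $\{(i,j),(i,j+1)\}$ have weight $a$, edges $\{(i,j),(i+1,j)\}$ have weight $b$, and every vertex has weight $z$. Monopole-dimer configuration on a plane graph $G=[V,E]$: a collection $C$ of pairwise vertex-disjoint directed loops of even length in $G$, where a loop of length $2$ is a doubled edge (exactly one such loop for each edge) and a loop of length $2k\ge4$ is a directed simple cycle (so each undirected cycle gives two distinct directed loops). Every vertex is either isolated (a monopole) or belongs to exactly one loop. Weights: the weight of a loop $\ell$ is $w(\ell)=(-1)^{N(\ell)}$ times the product of the weights of the edges traversed by $\ell$ (for a doubled edge, the square of the edge weight), where $N(\ell)$ is the number of vertices of $V$ strictly enclosed by $\ell$. The weight $w(C)$ is the product of $w(\ell)$ over the loops $\ell$ of $C$ and of the vertex weights over the isolated vertices of $C$. The partition function is $Z=\sum_C w(C)$, summed over all monopole-dimer configurations. *)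

theory Defs
  imports "HOL-Analysis.Analysis"
begin

definition elliptic_F :: "real \<Rightarrow> real \<Rightarrow> real" where
  "elliptic_F \<theta> \<kappa> = (LBINT t=0..\<theta>. 1 / sqrt (1 - \<kappa>\<^sup>2 * (sin t)\<^sup>2))"

definition elliptic_E :: "real \<Rightarrow> real \<Rightarrow> real" where
  "elliptic_E \<theta> \<kappa> = (LBINT t=0..\<theta>. sqrt (1 - \<kappa>\<^sup>2 * (sin t)\<^sup>2))"

definition complete_K :: "real \<Rightarrow> real" where
  "complete_K \<kappa> = elliptic_F (pi / 2) \<kappa>"

definition complete_E :: "real \<Rightarrow> real" where
  "complete_E \<kappa> = elliptic_E (pi / 2) \<kappa>"

definition heuman_Lambda :: "real \<Rightarrow> real \<Rightarrow> real" where
  "heuman_Lambda \<theta> k =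
     (let k' = sqrt (1 - k\<^sup>2) in
      2 / pi * (complete_E k * elliptic_F \<theta> k' + complete_K k * elliptic_E \<theta> k'
                - complete_K k * elliptic_F \<theta> k'))"

text \<open>
  A plane graph is given by a vertex set \<open>V\<close>, a set \<open>E\<close> of two-element subsets of \<open>V\<close> and a
  position \<open>pos v\<close> in the plane for each vertex; edges are drawn as straight segments.
  A directed loop is represented by its set of arcs. In this way the starting point of the
  cycle is forgotten, a cycle of length at least 4 yields two loops (one per direction), and an
  edge \<open>{u, v}\<close> yields the single loop \<open>{(u, v), (v, u)}\<close> of length 2.
\<close>

definition cycle_arcs :: "'v list \<Rightarrow> ('v \<times> 'v) set" where
  "cycle_arcs vs = {(vs ! i, vs ! (Suc i mod length vs)) | i. i < length vs}"

definition directed_loops :: "'v set \<Rightarrow> 'v set set \<Rightarrow> ('v \<times> 'v) set set" where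
  "directed_loops V E =
     {cycle_arcs vs | vs. distinct vs \<and> set vs \<subseteq> V \<and> even (length vs) \<and> 2 \<le> length vs \<and>
                          (\<forall>(u, v) \<in> cycle_arcs vs. {u, v} \<in> E)}"

definition loop_verts :: "('v \<times> 'v) set \<Rightarrow> 'v set" where
  "loop_verts l = Field l"

definition loop_curve :: "('v \<Rightarrow> real \<times> real) \<Rightarrow> ('v \<times> 'v) set \<Rightarrow> (real \<times> real) set" where
  "loop_curve pos l = (\<Union>(u, v)\<in>l. closed_segment (pos u) (pos v))"

definition enclosed_count ::
  "'v set \<Rightarrow> ('v \<Rightarrow> real \<times> real) \<Rightarrow> ('v \<times> 'v) set \<Rightarrow> nat" where
  "enclosed_count V pos l = card {v \<in> V. pos v \<in> inside (loop_curve pos l)}"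

definition loop_weight ::
  "'v set \<Rightarrow> ('v \<Rightarrow> real \<times> real) \<Rightarrow> ('v set \<Rightarrow> real) \<Rightarrow> ('v \<times> 'v) set \<Rightarrow> real" where
  "loop_weight V pos ew l = (- 1) ^ enclosed_count V pos l * (\<Prod>(u, v)\<in>l. ew {u, v})"

definition monopole_dimer_configs :: "'v set \<Rightarrow> 'v set set \<Rightarrow> ('v \<times> 'v) set set set" where
  "monopole_dimer_configs V E =
     {C. C \<subseteq> directed_loops V E \<and> pairwise (\<lambda>l l'. disjnt (loop_verts l) (loop_verts l')) C}"

definition config_weight ::
  "'v set \<Rightarrow> ('v \<Rightarrow> real \<times> real) \<Rightarrow> ('v set \<Rightarrow> real) \<Rightarrow> ('v \<Rightarrow> real) \<Rightarrow>
   ('v \<times> 'v) set set \<Rightarrow> real" where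
  "config_weight V pos ew vw C =
     (\<Prod>l\<in>C. loop_weight V pos ew l) * (\<Prod>v \<in> V - (\<Union>l\<in>C. loop_verts l). vw v)"

definition partition_function ::
  "'v set \<Rightarrow> 'v set set \<Rightarrow> ('v \<Rightarrow> real \<times> real) \<Rightarrow> ('v set \<Rightarrow> real) \<Rightarrow> ('v \<Rightarrow> real) \<Rightarrow> real" where
  "partition_function V E pos ew vw =
     (\<Sum>C \<in> monopole_dimer_configs V E. config_weight V pos ew vw C)"

lemma finite_directed_loops:
  assumes "finite V"
  shows "finite (directed_loops V E)"
proof (rule finite_subset)
  show "directed_loops V E \<subseteq> Pow (V \<times> V)"
  proof
    fix l assume "l \<in> directed_loops V E"
    then obtain vs where l: "l = cycle_arcs vs" and sub: "set vs \<subseteq> V"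
      by (auto simp: directed_loops_def)
    have "vs ! (Suc i mod length vs) \<in> V" "vs ! i \<in> V" if "i < length vs" for i
    proof -
      have "Suc i mod length vs < length vs"
        using that by (intro mod_less_divisor) linarith
      with that sub show "vs ! (Suc i mod length vs) \<in> V" "vs ! i \<in> V"
        by (meson nth_mem subsetD)+
    qed
    then show "l \<in> Pow (V \<times> V)"
      unfolding l cycle_arcs_def by auto
  qed
  show "finite (Pow (V \<times> V))" using assms by simp
qed

lemma finite_monopole_dimer_configs:
  assumes "finite V"
  shows "finite (monopole_dimer_configs V E)"
  by (rule finite_subset[of _ "Pow (directed_loops V E)"])
    (use finite_directed_loops[OF assms] in \<open>auto simp: monopole_dimer_configs_def\<close>)

definition grid_verts :: "nat \<Rightarrow> nat \<Rightarrow> (nat \<times> nat) set" where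
  "grid_verts m n = {1..m} \<times> {1..n}"

definition grid_edges :: "nat \<Rightarrow> nat \<Rightarrow> (nat \<times> nat) set set" where
  "grid_edges m n =
     {{(i, j), (i, j + 1)} | i j. i \<in> {1..m} \<and> j \<in> {1..<n}} \<union>
     {{(i, j), (i + 1, j)} | i j. i \<in> {1..<m} \<and> j \<in> {1..n}}"

definition grid_pos :: "nat \<times> nat \<Rightarrow> real \<times> real" where
  "grid_pos v = (real (fst v), real (snd v))"

definition grid_edge_weight :: "real \<Rightarrow> real \<Rightarrow> (nat \<times> nat) set \<Rightarrow> real" where
  "grid_edge_weight a b e = (if \<exists>i j. e = {(i, j), (i, j + 1)} then a else b)"

definition grid_Z :: "nat \<Rightarrow> nat \<Rightarrow> real \<Rightarrow> real \<Rightarrow> real \<Rightarrow> real" where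
  "grid_Z m n a b z =
     partition_function (grid_verts m n) (grid_edges m n) grid_pos
       (grid_edge_weight a b) (\<lambda>_. z)"

text \<open>The joint limit \<open>m, n \<rightarrow> \<infinity>\<close> along pairs of even numbers.\<close>

definition even_pairs_at_top :: "(nat \<times> nat) filter" where
  "even_pairs_at_top =
     inf (sequentially \<times>\<^sub>F sequentially) (principal {(m, n). even m \<and> even n})"

definition finite_free_energy :: "real \<Rightarrow> real \<Rightarrow> real \<Rightarrow> nat \<times> nat \<Rightarrow> real" where
  "finite_free_energy a b z = (\<lambda>(m, n). 1 / (real m * real n) * ln (grid_Z m n a b z))"

definition free_energy :: "real \<Rightarrow> real \<Rightarrow> real \<Rightarrow> real" where
  "free_energy a b z = Lim even_pairs_at_top (finite_free_energy a b z)"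

definition density_a :: "real \<Rightarrow> real \<Rightarrow> real \<Rightarrow> real" where
  "density_a a b z = a * deriv (\<lambda>x. free_energy x b z) a"

end

(*
Kasteleyn's method for the monopole-dimer model. Give the edges of the grid purely imaginary
symmetric weights, those in the second direction carrying the extra sign (-1)^i. Around a simple
lattice cycle the product of the phases is -(-1)^N, where N is the number of lattice points inside;
hence Z is the determinant of z I + i B with B a real symmetric matrix. The two directions
anticommute in B, so Z^2 = det (z^2 I + B^2) is diagonalised by products of sines, and
ln Z is half the sum of ln (z^2 + 4 b^2 cos^2 s + 4 a^2 cos^2 t) over the points
(s, t) = (pi j / (m + 1), pi l / (n + 1)). The free energy is therefore a double integral, and
a times its a-derivative is 1 - (2 / pi) J with J a complete elliptic integral of the third kind.
As a function of the amplitude at fixed modulus, (2 / pi) J has the derivative of Heuman's Lambda: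
the two integrands differ by an exact derivative in the variable of integration.
*)

theory Submission
  imports Defs "HOL-Combinatorics.Cycles" "Jordan_Normal_Form.Determinant"
begin

section \<open>Phases of lattice cycles\<close>

text \<open>\<open>inside\<close> is a topological notion, so the sign rule for cycles is not read
  off from a face count but proved by induction, one unit cell at a time. At the lexicographically
  largest vertex of a cycle the cell to the lower left is inside; either the corner is pushed across
  this cell, or a side of the cell cuts the cycle into two shorter ones. Only the Jordan curve
  theorem and the splitting of a loop by a chord enter. The real symmetric part B is not diagonal in
  the products of sines, only its square is: B maps each such product into its span with the copy
  staggered by (-1)^i. Since Z is real, it is also the determinant of the conjugate matrix, and the
  product of the two determinants involves B only through its square. For z > 0 the symbol stays
  away from 0, so its logarithm is Lipschitz and the Riemann sums converge with an explicit error,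
  which gives the joint limit. In the last comparison amplitude and modulus are independent
  variables. Both sides vanish at amplitude 0, so equal derivatives in the amplitude suffice; the
  values belonging to a, b, z are inserted afterwards.\<close>

definition cpt :: "nat \<times> nat \<Rightarrow> complex" where
  "cpt v = Complex (real (fst v)) (real (snd v))"

lemma Re_cpt [simp]: "Re (cpt v) = real (fst v)" and Im_cpt [simp]: "Im (cpt v) = real (snd v)"
  by (simp_all add: cpt_def)

lemma inj_cpt: "inj cpt"
  by (rule injI) (auto simp: complex_eq_iff prod_eq_iff)

lemma cpt_eq_iff [simp]: "cpt u = cpt v \<longleftrightarrow> u = v"
  using inj_cpt by (auto dest: injD)

section \<open>Unit edges of the square lattice and their intersections\<close>

definition nbr :: "nat \<times> nat \<Rightarrow> nat \<times> nat \<Rightarrow> bool" where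
  "nbr u v \<longleftrightarrow> (fst u = fst v \<and> (snd v = Suc (snd u) \<or> snd u = Suc (snd v))) \<or>
                (snd u = snd v \<and> (fst v = Suc (fst u) \<or> fst u = Suc (fst v)))"

lemma nbr_sym: "nbr u v \<Longrightarrow> nbr v u"
  by (auto simp: nbr_def)

lemma nbr_irrefl [simp]: "\<not> nbr u u"
  by (auto simp: nbr_def)

lemma nbr_cases:
  assumes "nbr u v"
  obtains i j where "{u, v} = {(i, j), (Suc i, j)}" | i j where "{u, v} = {(i, j), (i, Suc j)}"
  using assms unfolding nbr_def
  by (cases u; cases v) (auto simp: insert_commute)

lemma closed_segment_doubleton_cong:
  "{a, b} = {c, d} \<Longrightarrow> closed_segment a b = closed_segment c d"
  by (metis closed_segment_commute doubleton_eq_iff)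

lemma mem_segment_horizontal:
  "x \<in> closed_segment (cpt (i, j)) (cpt (Suc i, j)) \<longleftrightarrow>
     real i \<le> Re x \<and> Re x \<le> real i + 1 \<and> Im x = real j"
  by (subst closed_segment_same_Im) (auto simp: closed_segment_eq_real_ivl add.commute)

lemma mem_segment_vertical:
  "x \<in> closed_segment (cpt (i, j)) (cpt (i, Suc j)) \<longleftrightarrow>
     Re x = real i \<and> real j \<le> Im x \<and> Im x \<le> real j + 1"
  by (subst closed_segment_same_Re) (auto simp: closed_segment_eq_real_ivl add.commute)

lemma segment_cases:
  assumes "nbr u v" "x \<in> closed_segment (cpt u) (cpt v)"
  obtains i j where "{u, v} = {(i, j), (Suc i, j)}" "real i \<le> Re x" "Re x \<le> real i + 1" "Im x = real j"
  | i j where "{u, v} = {(i, j), (i, Suc j)}" "Re x = real i" "real j \<le> Im x" "Im x \<le> real j + 1"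
proof -
  have img: "{cpt u, cpt v} = cpt ` {u, v}" by simp
  from assms(1) show ?thesis
  proof (cases rule: nbr_cases)
    case (1 i j)
    then have "closed_segment (cpt u) (cpt v) = closed_segment (cpt (i, j)) (cpt (Suc i, j))"
      by (intro closed_segment_doubleton_cong) (simp only: img 1, simp)
    with assms(2) have "real i \<le> Re x" "Re x \<le> real i + 1" "Im x = real j"
      by (simp_all add: mem_segment_horizontal)
    with 1 that(1) show ?thesis by blast
  next
    case (2 i j)
    then have "closed_segment (cpt u) (cpt v) = closed_segment (cpt (i, j)) (cpt (i, Suc j))"
      by (intro closed_segment_doubleton_cong) (simp only: img 2, simp)
    with assms(2) have "Re x = real i" "real j \<le> Im x" "Im x \<le> real j + 1"
      by (simp_all add: mem_segment_vertical)
    with 2 that(2) show ?thesis by blast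
  qed
qed

lemma nat_between: "real i \<le> real k \<Longrightarrow> real k \<le> real i + 1 \<Longrightarrow> k = i \<or> k = Suc i"
  by linarith

lemma cpt_in_segment:
  assumes "nbr u v" "cpt w \<in> closed_segment (cpt u) (cpt v)"
  shows "w = u \<or> w = v"
proof -
  have "w \<in> {u, v}"
    using assms
  proof (cases rule: segment_cases)
    case (1 i j)
    then have "fst w = i \<or> fst w = Suc i" "snd w = j" using nat_between by auto
    then show ?thesis unfolding 1 by (auto simp: prod_eq_iff)
  next
    case (2 i j)
    then have "snd w = j \<or> snd w = Suc j" "fst w = i" using nat_between by auto
    then show ?thesis unfolding 2 by (auto simp: prod_eq_iff)
  qed
  then show ?thesis by simp
qed

lemma real_overlap:
  assumes "real i \<le> x" "x \<le> real i + 1" "real k \<le> x" "x \<le> real k + 1" "i \<noteq> k"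
  shows "(k = Suc i \<and> x = real k) \<or> (i = Suc k \<and> x = real i)"
  using assms by linarith

text \<open>Two parallel unit edges on one line overlap at most in an integral point, and a
  horizontal and a vertical edge meet in a point with both coordinates integral. So a common point
  is always a lattice point, and a unit edge contains no lattice points except its ends.\<close>

lemma segments_meet:
  assumes uv: "nbr u v" "x \<in> closed_segment (cpt u) (cpt v)"
    and pq: "nbr p q" "x \<in> closed_segment (cpt p) (cpt q)" and ne: "{u, v} \<noteq> {p, q}"
  shows "x \<in> cpt ` ({u, v} \<inter> {p, q})"
  using uv
proof (cases rule: segment_cases)
  case h: (1 i j)
  from pq show ?thesis
  proof (cases rule: segment_cases)
    case (1 k l)
    have "j = l" using h 1 by simp
    with ne h(1) 1(1) have "i \<noteq> k" by auto
    from real_overlap[OF h(2,3) 1(2,3) this]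
    have "x = cpt (k, j) \<and> k = Suc i \<or> x = cpt (i, j) \<and> i = Suc k"
      using h 1 by (auto simp: complex_eq_iff)
    then show ?thesis unfolding h 1 using \<open>j = l\<close> by auto
  next
    case (2 k l)
    have "x = cpt (k, j)" using h 2 by (auto simp: complex_eq_iff)
    moreover have "k = i \<or> k = Suc i" using h 2 nat_between by auto
    moreover have "j = l \<or> j = Suc l" using h 2 nat_between by auto
    ultimately show ?thesis unfolding h 2 by auto
  qed
next
  case v: (2 i j)
  from pq show ?thesis
  proof (cases rule: segment_cases)
    case (1 k l)
    have "x = cpt (i, l)" using v 1 by (auto simp: complex_eq_iff)
    moreover have "i = k \<or> i = Suc k" using v 1 nat_between by auto
    moreover have "l = j \<or> l = Suc j" using v 1 nat_between by auto
    ultimately show ?thesis unfolding v 1 by auto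
  next
    case (2 k l)
    have "i = k" using v 2 by simp
    with ne v(1) 2(1) have "j \<noteq> l" by auto
    from real_overlap[OF v(3,4) 2(3,4) this]
    have "x = cpt (i, l) \<and> l = Suc j \<or> x = cpt (i, j) \<and> j = Suc l"
      using v 2 by (auto simp: complex_eq_iff)
    then show ?thesis unfolding v 2 using \<open>i = k\<close> by auto
  qed
qed

section \<open>Lattice paths as arcs in the plane\<close>

fun path_trace :: "(nat \<times> nat) list \<Rightarrow> complex set" where
  "path_trace (x # y # xs) = closed_segment (cpt x) (cpt y) \<union> path_trace (y # xs)"
| "path_trace [x] = {cpt x}"
| "path_trace [] = {}"

fun edges :: "'a list \<Rightarrow> 'a set set" where
  "edges (x # y # xs) = insert {x, y} (edges (y # xs))"
| "edges _ = {}"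

abbreviation nbrs :: "(nat \<times> nat) list \<Rightarrow> bool" where
  "nbrs \<equiv> successively nbr"

lemma edges_subset: "e \<in> edges xs \<Longrightarrow> e \<subseteq> set xs"
  by (induction xs rule: edges.induct) auto

lemma edges_append: "edges (xs @ y # ys) = edges (xs @ [y]) \<union> edges (y # ys)"
proof (induction xs rule: edges.induct)
  case (1 x z xs) then show ?case by (cases xs) auto
next
  case ("2_2" v) then show ?case by (cases ys) auto
qed auto

lemma edges_rev: "edges (rev xs) = edges xs"
proof (induction xs rule: edges.induct)
  case (1 x y xs)
  have "edges (rev (x # y # xs)) = edges (rev xs @ [y]) \<union> {{y, x}}"
    using edges_append[of "rev xs" y "[x]"] by simp
  then show ?case using 1 by (auto simp: insert_commute)
qed auto

text \<open>This form depends only on the vertex set and the edge set, so statements about appending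
  and reversing reduce to those about \<open>edges\<close>.\<close>

lemma trace_eq: "path_trace xs = cpt ` set xs \<union> (\<Union>e \<in> edges xs. convex hull (cpt ` e))"
proof (induction xs rule: path_trace.induct)
  case (1 x y xs)
  have "cpt x \<in> convex hull {cpt x, cpt y}" by (simp add: hull_inc)
  with 1 show ?case by (auto simp: segment_convex_hull)
qed auto

lemma edge_nbr: "nbrs xs \<Longrightarrow> e \<in> edges xs \<Longrightarrow> \<exists>u v. e = {u, v} \<and> nbr u v"
  by (induction xs rule: edges.induct) auto

lemma trace_cases:
  assumes "nbrs xs" "x \<in> path_trace xs"
  obtains v where "v \<in> set xs" "x = cpt v"
  | u v where "{u, v} \<in> edges xs" "nbr u v" "x \<in> closed_segment (cpt u) (cpt v)"
proof (cases "x \<in> cpt ` set xs")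
  case True then show ?thesis using that by auto
next
  case False
  then obtain e where e: "e \<in> edges xs" "x \<in> convex hull (cpt ` e)"
    using assms by (auto simp: trace_eq)
  then obtain u v where "e = {u, v}" "nbr u v" using edge_nbr assms by blast
  then show ?thesis using that(2) e by (simp add: segment_convex_hull)
qed

lemma cpt_in_trace [simp]: "nbrs xs \<Longrightarrow> cpt v \<in> path_trace xs \<longleftrightarrow> v \<in> set xs"
proof
  assume "nbrs xs" "cpt v \<in> path_trace xs"
  then show "v \<in> set xs"
    by (cases rule: trace_cases) (use cpt_in_segment edges_subset in \<open>auto, blast\<close>)
qed (auto simp: trace_eq)

text \<open>By \<open>segments_meet\<close> a point common to two different edges is a lattice
  point. With disjoint edge sets every common point of the traces is therefore one, which turns
  topological disjointness into a question about vertex lists.\<close>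

lemma traces_meet:
  assumes "nbrs xs" "nbrs ys" "edges xs \<inter> edges ys = {}"
  shows "path_trace xs \<inter> path_trace ys \<subseteq> cpt ` (set xs \<inter> set ys)"
proof
  fix x assume x: "x \<in> path_trace xs \<inter> path_trace ys"
  then have xx: "x \<in> path_trace xs" "x \<in> path_trace ys" by auto
  have "\<exists>v. x = cpt v"
    using assms(1) xx(1)
  proof (cases rule: trace_cases)
    case (2 u v)
    note uv = 2
    show ?thesis using assms(2) xx(2)
    proof (cases rule: trace_cases)
      case (2 p q)
      then have "{u, v} \<noteq> {p, q}" using uv assms(3) by auto
      from segments_meet[OF uv(2,3) 2(2,3) this] show ?thesis by auto
    qed auto
  qed auto
  then show "x \<in> cpt ` (set xs \<inter> set ys)"
    using xx assms by auto
qed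

text \<open>A new first edge shares with the remaining trace only its end \<open>y\<close>, because
  \<open>x\<close> does not occur again; so arcs can be joined one edge at a time.\<close>

lemma trace_arc:
  assumes "nbrs xs" "distinct xs" "length xs \<ge> 2"
  shows "\<exists>g. arc g \<and> path_image g = path_trace xs \<and> pathstart g = cpt (hd xs) \<and> pathfinish g = cpt (last xs)"
  using assms
proof (induction xs rule: path_trace.induct)
  case (1 x y xs)
  have seg: "arc (linepath (cpt x) (cpt y))" using 1 by (intro arc_linepath) auto
  show ?case
  proof (cases xs)
    case Nil
    then show ?thesis using seg by (intro exI[of _ "linepath (cpt x) (cpt y)"]) auto
  next
    case (Cons z zs)
    then obtain g where g: "arc g" "path_image g = path_trace (y # xs)" "pathstart g = cpt y"
      "pathfinish g = cpt (last (y # xs))" using 1 by auto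
    have "path_trace [x, y] \<inter> path_trace (y # xs) \<subseteq> cpt ` (set [x, y] \<inter> set (y # xs))"
      using 1 edges_subset[of "{x, y}" "y # xs"] by (intro traces_meet) auto
    also have "\<dots> \<subseteq> {cpt y}" using 1 by auto
    finally have "closed_segment (cpt x) (cpt y) \<inter> path_trace (y # xs) \<subseteq> {cpt y}" by auto
    then have "arc (linepath (cpt x) (cpt y) +++ g)"
      using g seg by (intro arc_join) auto
    moreover have "path_image (linepath (cpt x) (cpt y) +++ g) = path_trace (x # y # xs)"
      using g by (subst path_image_join) auto
    ultimately show ?thesis using g by (intro exI[of _ "linepath (cpt x) (cpt y) +++ g"]) auto
  qed
qed auto

section \<open>Counting enclosed lattice points; cutting a loop along a chord\<close>

definition n_inside :: "complex set \<Rightarrow> nat" where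
  "n_inside S = card {v. cpt v \<in> inside S}"

definition lpath :: "nat \<times> nat \<Rightarrow> nat \<times> nat \<Rightarrow> (nat \<times> nat) list \<Rightarrow> bool" where
  "lpath a b P \<longleftrightarrow> nbrs P \<and> distinct P \<and> 2 \<le> length P \<and> hd P = a \<and> last P = b"

lemma finite_lattice_points:
  assumes "bounded S"
  shows "finite {v. cpt v \<in> S}"
proof -
  obtain B where B: "\<And>x. x \<in> S \<Longrightarrow> norm x \<le> B" using assms by (auto simp: bounded_iff)
  have "{v. cpt v \<in> S} \<subseteq> {..nat \<lceil>B\<rceil>} \<times> {..nat \<lceil>B\<rceil>}"
  proof
    fix v assume "v \<in> {v. cpt v \<in> S}"
    then have "real (fst v) \<le> B" "real (snd v) \<le> B"
      using B[of "cpt v"] abs_Re_le_cmod[of "cpt v"] abs_Im_le_cmod[of "cpt v"] by auto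
    then show "v \<in> {..nat \<lceil>B\<rceil>} \<times> {..nat \<lceil>B\<rceil>}"
      by (cases v) (auto simp: le_nat_iff ceiling_mono, linarith+)
  qed
  then show ?thesis by (rule finite_subset) auto
qed

lemma hd_last_edge:
  assumes "distinct P" "3 \<le> length P"
  shows "{hd P, last P} \<notin> edges P"
proof -
  obtain x y zs where P: "P = x # y # zs" "zs \<noteq> []"
    using assms(2) by (cases P; cases "tl P"; cases "tl (tl P)") auto
  then have "x \<notin> set (y # zs)" "last zs \<in> set zs" "y \<notin> set zs" using assms by auto
  then show ?thesis
    using P edges_subset[of "{x, last zs}" "y # zs"] by (auto simp: doubleton_eq_iff)
qed

text \<open>A common edge would have to be \<open>{a, b}\<close>, and a simple path with at least
  three vertices does not contain the edge joining its ends. The length is bounded for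
  \<open>P\<close> only, so that \<open>Q\<close> may be the single edge
  \<open>[a, b]\<close>.\<close>

lemma lpath_edges_disjoint:
  assumes "lpath a b P" "3 \<le> length P" "lpath a b Q" "set P \<inter> set Q = {a, b}"
  shows "edges P \<inter> edges Q = {}"
proof (rule ccontr)
  assume "edges P \<inter> edges Q \<noteq> {}"
  then obtain e where e: "e \<in> edges P" "e \<in> edges Q" by auto
  then have "e \<subseteq> {a, b}" using edges_subset assms(4) by blast
  moreover obtain u v where "e = {u, v}" "nbr u v"
    using e edge_nbr assms by (metis lpath_def)
  ultimately have "e = {a, b}" using nbr_irrefl by auto
  then show False using e hd_last_edge[of P] assms by (auto simp: lpath_def)
qed

lemma lpath_arc:
  assumes "lpath a b P"
  obtains g where "arc g" "path_image g = path_trace P" "pathstart g = cpt a" "pathfinish g = cpt b"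
  using trace_arc[of P] assms by (auto simp: lpath_def)

lemma lpath_ends: "lpath a b P \<Longrightarrow> a \<in> set P \<and> b \<in> set P \<and> a \<noteq> b"
  unfolding lpath_def by (cases P) (auto simp: Suc_le_eq)

lemma lpath_traces_meet:
  assumes "lpath a b P" "3 \<le> length P" "lpath a b Q" "set P \<inter> set Q = {a, b}"
  shows "path_trace P \<inter> path_trace Q = {cpt a, cpt b}"
proof
  have nb: "nbrs P" "nbrs Q" using assms unfolding lpath_def by blast+
  show "path_trace P \<inter> path_trace Q \<subseteq> {cpt a, cpt b}"
    using traces_meet[OF nb lpath_edges_disjoint[OF assms]] assms(4) by simp
  show "{cpt a, cpt b} \<subseteq> path_trace P \<inter> path_trace Q"
    using nb assms(4) by auto
qed

lemma lpath_simple_loop: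
  assumes "lpath a b P" "3 \<le> length P" "lpath a b Q" "set P \<inter> set Q = {a, b}"
  obtains c where "simple_path c" "pathfinish c = pathstart c" "path_image c = path_trace P \<union> path_trace Q"
proof -
  obtain g where g: "arc g" "path_image g = path_trace P" "pathstart g = cpt a" "pathfinish g = cpt b"
    using lpath_arc assms(1) .
  obtain h where h: "arc h" "path_image h = path_trace Q" "pathstart h = cpt a" "pathfinish h = cpt b"
    using lpath_arc assms(3) .
  have "simple_path (g +++ reversepath h)"
    using g h lpath_traces_meet[OF assms]
    by (intro simple_path_join_loop) (auto simp: arc_reversepath)
  moreover have "path_image (g +++ reversepath h) = path_trace P \<union> path_trace Q"
    using g h by (subst path_image_join) auto
  ultimately show thesis using that g h by fastforce
qed

text \<open>A theta curve: the chord \<open>P\<close> runs through the inside of the loop formed by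
  \<open>P1\<close> and \<open>P2\<close> and divides it in two. The lattice points of the old
  inside lie in one of the two parts or are among the \<open>length P - 2\<close> inner vertices of
  the chord.\<close>

lemma enc_chord_split:
  assumes P1: "lpath a b P1" "3 \<le> length P1" and P2: "lpath a b P2" "3 \<le> length P2"
    and P: "lpath a b P"
    and meet: "set P1 \<inter> set P2 = {a, b}" "set P1 \<inter> set P = {a, b}" "set P2 \<inter> set P = {a, b}"
    and ne: "path_trace P \<inter> inside (path_trace P1 \<union> path_trace P2) \<noteq> {}"
  shows "n_inside (path_trace P1 \<union> path_trace P2) =
           n_inside (path_trace P1 \<union> path_trace P) + n_inside (path_trace P2 \<union> path_trace P) + (length P - 2)"
proof -
  obtain c1 where c1: "arc c1" "path_image c1 = path_trace P1" "pathstart c1 = cpt a" "pathfinish c1 = cpt b"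
    using lpath_arc P1(1) .
  obtain c2 where c2: "arc c2" "path_image c2 = path_trace P2" "pathstart c2 = cpt a" "pathfinish c2 = cpt b"
    using lpath_arc P2(1) .
  obtain c where c: "arc c" "path_image c = path_trace P" "pathstart c = cpt a" "pathfinish c = cpt b"
    using lpath_arc P .
  have ab: "cpt a \<noteq> cpt b" using lpath_ends[OF P] by simp
  note m = lpath_traces_meet[OF P1 P2(1) meet(1)] lpath_traces_meet[OF P1 P meet(2)]
    lpath_traces_meet[OF P2 P meet(3)]
  have split: "inside (path_trace P1 \<union> path_trace P) \<inter> inside (path_trace P2 \<union> path_trace P) = {}"
    "inside (path_trace P1 \<union> path_trace P) \<union> inside (path_trace P2 \<union> path_trace P) \<union> (path_trace P - {cpt a, cpt b})
       = inside (path_trace P1 \<union> path_trace P2)"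
    using split_inside_simple_closed_curve[of c1 "cpt a" "cpt b" c2 c] c1 c2 c ab m ne
    by (auto simp: arc_imp_simple_path)
  let ?L = "\<lambda>S. {v. cpt v \<in> S}"
  \<comment> \<open>Boundedness makes the sets of lattice points finite, without which
    \<open>card\<close> would not be additive.\<close>
  have bdd: "bounded (inside (path_trace P1 \<union> path_trace P2))"
  proof -
    obtain g where "simple_path g" "pathfinish g = pathstart g" "path_image g = path_trace P1 \<union> path_trace P2"
      using lpath_simple_loop[OF P1 P2(1) meet(1)] .
    then show ?thesis using Jordan_inside_outside[of g] by auto
  qed
  have fin: "finite (?L (inside (path_trace P1 \<union> path_trace P)))" "finite (?L (inside (path_trace P2 \<union> path_trace P)))"
    "finite (?L (path_trace P - {cpt a, cpt b}))"
    by (rule finite_lattice_points, rule bounded_subset[OF bdd], use split in blast)+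
  have nP: "nbrs P" "distinct P" using P by (auto simp: lpath_def)
  have "?L (inside (path_trace P1 \<union> path_trace P2)) =
     (?L (inside (path_trace P1 \<union> path_trace P)) \<union> ?L (inside (path_trace P2 \<union> path_trace P))) \<union> ?L (path_trace P - {cpt a, cpt b})"
    using split(2) by blast
  also have "card \<dots> = card (?L (inside (path_trace P1 \<union> path_trace P)) \<union> ?L (inside (path_trace P2 \<union> path_trace P)))
      + card (?L (path_trace P - {cpt a, cpt b}))"
  proof (rule card_Un_disjoint)
    have "inside (path_trace P1 \<union> path_trace P) \<inter> path_trace P = {}" "inside (path_trace P2 \<union> path_trace P) \<inter> path_trace P = {}"
      using inside_no_overlap by blast+
    then show "(?L (inside (path_trace P1 \<union> path_trace P)) \<union> ?L (inside (path_trace P2 \<union> path_trace P))) \<inter>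
        ?L (path_trace P - {cpt a, cpt b}) = {}" by auto
  qed (use fin in auto)
  also have "card (?L (inside (path_trace P1 \<union> path_trace P)) \<union> ?L (inside (path_trace P2 \<union> path_trace P))) =
      card (?L (inside (path_trace P1 \<union> path_trace P))) + card (?L (inside (path_trace P2 \<union> path_trace P)))"
    using split(1) by (intro card_Un_disjoint fin) auto
  also have "?L (path_trace P - {cpt a, cpt b}) = set P - {a, b}"
    using nP by auto
  also have "card \<dots> = length P - 2"
    using lpath_ends[OF P] nP by (simp add: distinct_card)
  finally show ?thesis by (simp add: n_inside_def)
qed

section \<open>Unit cells and the inside of a lattice curve\<close>

lemma mem_cell_segment:
  assumes "y \<in> closed_segment x (Complex (i + 1/2) (j + 1/2))"
    and "i \<le> Re x" "Re x \<le> i + 1" "j \<le> Im x" "Im x \<le> j + 1"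
  shows "y = x \<or> (i < Re y \<and> Re y < i + 1 \<and> j < Im y \<and> Im y < j + 1)"
proof -
  obtain t where t: "0 \<le> t" "t \<le> 1" and y: "y = (1 - t) *\<^sub>R x + t *\<^sub>R Complex (i + 1/2) (j + 1/2)"
    using assms(1) by (auto simp: in_segment)
  show ?thesis
  proof (cases "t = 0")
    case False
    have "0 \<le> (1 - t) * (Re x - i)" "0 \<le> (1 - t) * (i + 1 - Re x)"
      "0 \<le> (1 - t) * (Im x - j)" "0 \<le> (1 - t) * (j + 1 - Im x)"
      using t assms by auto
    moreover have "t > 0" using False t by auto
    ultimately show ?thesis unfolding y by (auto simp: algebra_simps)
  qed (use y in simp)
qed

text \<open>Apart from \<open>x\<close>, the segment from \<open>x\<close> to the centre runs in the
  open cell, so it avoids the curve, and points joined in the complement are inside together.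
  Questions about a closed cell thus reduce to its centre.\<close>

lemma cell_inside_iff:
  assumes "\<And>y. i < Re y \<Longrightarrow> Re y < i + 1 \<Longrightarrow> j < Im y \<Longrightarrow> Im y < j + 1 \<Longrightarrow> y \<notin> T"
    and "i \<le> Re x" "Re x \<le> i + 1" "j \<le> Im x" "Im x \<le> j + 1" "x \<notin> T"
  shows "x \<in> inside T \<longleftrightarrow> Complex (i + 1/2) (j + 1/2) \<in> inside T"
proof -
  let ?c = "Complex (i + 1/2) (j + 1/2)"
  have "closed_segment x ?c \<subseteq> - T"
    using mem_cell_segment[OF _ assms(2-5)] assms(1,6) by blast
  then have "connected_component (- T) x ?c"
    unfolding connected_component_def
    by (intro exI[of _ "closed_segment x ?c"]) auto
  then show ?thesis
    using inside_same_component connected_component_sym by metis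
qed

text \<open>Every point of a trace has an integral coordinate; a point of an open unit cell has
  none.\<close>

lemma trace_avoids_cell:
  assumes "nbrs xs" "real i < Re y" "Re y < real i + 1" "real j < Im y" "Im y < real j + 1"
  shows "y \<notin> path_trace xs"
proof
  have *: False if "real i < real k" "real k < real i + 1" for i k
  proof -
    have "real k < real (i + 1)" unfolding of_nat_add of_nat_1 by (rule that(2))
    then have "k < i + 1" unfolding of_nat_less_iff .
    moreover have "i < k" using that(1) unfolding of_nat_less_iff .
    ultimately show False by simp
  qed
  assume "y \<in> path_trace xs"
  with assms(1) show False
  proof (cases rule: trace_cases)
    case (1 v)
    show ?thesis using assms(2,3) unfolding 1(2) Re_cpt by (rule *)
  next
    case (2 u v)
    from 2(2,3) show ?thesis
    proof (cases rule: segment_cases)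
      case (1 k l)
      show ?thesis using assms(4,5) unfolding 1(4) by (rule *)
    next
      case (2 k l)
      show ?thesis using assms(2,3) unfolding 2(2) by (rule *)
    qed
  qed
qed

lemma edge_midpoint_not_in_trace:
  assumes "nbrs xs" "nbr u w" "{u, w} \<notin> edges xs"
  shows "midpoint (cpt u) (cpt w) \<notin> path_trace xs"
proof
  assume "midpoint (cpt u) (cpt w) \<in> path_trace xs"
  moreover have "midpoint (cpt u) (cpt w) \<in> path_trace [u, w]"
    by simp
  moreover have "path_trace xs \<inter> path_trace [u, w] \<subseteq> cpt ` (set xs \<inter> set [u, w])"
    using assms by (intro traces_meet) auto
  ultimately have "midpoint (cpt u) (cpt w) \<in> cpt ` (set xs \<inter> set [u, w])" by blast
  then obtain x where "x \<in> set [u, w]" and m: "midpoint (cpt u) (cpt w) = cpt x" by blast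
  then consider "x = u" | "x = w" by auto
  then have "u = w"
  proof cases
    case 1
    with m show ?thesis by simp
  next
    case 2
    with m show ?thesis by simp
  qed
  with assms(2) show False by simp
qed

text \<open>Near a lexicographically maximal vertex, the inside can only be in the adjacent cell to the
  lower left: the half plane to the right and the rest of the vertical line above are free of the curve.\<close>
lemma corner_cell_inside:
  assumes loop: "simple_path c" "pathfinish c = pathstart c" "path_image c = path_trace xs"
    and nb: "nbrs xs" and v: "(Suc i, Suc j) \<in> set xs"
    and e: "{(Suc i, Suc j), (i, Suc j)} \<in> edges xs"
    and max: "\<And>p. p \<in> set xs \<Longrightarrow> fst p \<le> Suc i"
      "\<And>p. p \<in> set xs \<Longrightarrow> fst p = Suc i \<Longrightarrow> snd p \<le> Suc j"
  shows "Complex (real i + 1/2) (real j + 1/2) \<in> inside (path_trace xs)"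
proof -
  let ?T = "path_trace xs"
  have J: "open (inside ?T)" "frontier (inside ?T) = ?T"
    using Jordan_inside_outside[OF loop(1,2)] loop(3) by auto
  have cell: "y \<notin> ?T" if "real k < Re y" "Re y < real k + 1" "real l < Im y" "Im y < real l + 1" for k l y
    using trace_avoids_cell[OF nb that] .
  have "Re x \<le> real i + 1" if "x \<in> ?T" for x
    using nb that
  proof (cases rule: trace_cases)
    case (1 w) then show ?thesis using max(1)[of w] by simp
  next
    case (2 u w)
    then have m: "fst p \<le> Suc i" if "p \<in> {u, w}" for p
      using max(1) edges_subset[of "{u, w}" xs] that by blast
    from 2(2,3) show ?thesis
    proof (cases rule: segment_cases)
      case (1 k l) then show ?thesis using m[of "(Suc k, l)"] by simp
    next
      case (2 k l) then show ?thesis using m[of "(k, l)"] by simp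
    qed
  qed
  then have "?T \<subseteq> {x. Re x \<le> real i + 1}" by auto
  then have "- {x. Re x \<le> real i + 1} \<subseteq> outside ?T"
    by (intro outside_subset_convex convex_halfspace_Re_le)
  then have le: "Re x \<le> real i + 1" if "x \<in> inside ?T" for x
    using that inside_Int_outside[of ?T] by (cases "Re x \<le> real i + 1") blast+
  \<comment> \<open>The inside is open, so a point of it on the vertical line through the corner
    would have inside neighbours to the right of that line.\<close>
  have less: "Re x < real i + 1" if x: "x \<in> inside ?T" for x
  proof -
    obtain d where d: "d > 0" "ball x d \<subseteq> inside ?T" using J(1) x by (auto simp: open_contains_ball)
    have "x + of_real (d/2) \<in> ball x d" using d by (simp add: dist_norm)
    then have "Re (x + of_real (d/2)) \<le> real i + 1" using d le by blast
    then show ?thesis using d by simp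
  qed
  \<comment> \<open>By the Jordan curve theorem the corner belongs to the frontier of the inside, so
    inside points come within \<open>1/2\<close> of it. They can only lie in one of the two cells to
    its left or on the edge between these.\<close>
  have "cpt (Suc i, Suc j) \<in> frontier (inside ?T)" using J nb v by simp
  then have "cpt (Suc i, Suc j) \<in> closure (inside ?T)" by (simp add: frontier_def)
  then obtain y where y: "y \<in> inside ?T" "dist y (cpt (Suc i, Suc j)) < 1/2"
    unfolding closure_approachable by (elim allE[of _ "1/2"]) auto
  have "\<bar>Re y - real (Suc i)\<bar> < 1/2" "\<bar>Im y - real (Suc j)\<bar> < 1/2"
    using abs_Re_le_cmod[of "y - cpt (Suc i, Suc j)"] abs_Im_le_cmod[of "y - cpt (Suc i, Suc j)"] y
    by (auto simp: dist_norm)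
  then have yb: "real i < Re y" "real j < Im y" "Im y < real j + 2" "Re y < real i + 1"
    using less[OF y(1)] by (simp_all add: abs_if split: if_splits)
  have yT: "y \<notin> ?T" using y inside_no_overlap by blast
  consider "Im y < real j + 1" | "Im y = real j + 1" | "Im y > real j + 1" by linarith
  then show ?thesis
  proof cases
    case 1
    show ?thesis
      by (rule cell_inside_iff[THEN iffD1, OF cell[where k = i and l = j] _ _ _ _ _ y(1)])
        (use 1 yb yT in simp_all)
  next
    case 2
    have "y \<in> closed_segment (cpt (i, Suc j)) (cpt (Suc i, Suc j))"
      using 2 yb by (subst mem_segment_horizontal) auto
    then have "y \<in> convex hull (cpt ` {(Suc i, Suc j), (i, Suc j)})"
      by (simp add: segment_convex_hull insert_commute)
    then have "y \<in> ?T" using e by (auto simp only: trace_eq)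
    then show ?thesis using yT by blast
  next
    case 3
    \<comment> \<open>If the upper cell were inside, so would be the midpoint of the vertical edge
      above the corner, which is not an edge of the curve. This midpoint has real part
      \<open>real i + 1\<close>, against \<open>less\<close>.\<close>
    let ?m = "midpoint (cpt (Suc i, Suc j)) (cpt (Suc i, Suc (Suc j)))"
    have Re_m: "Re ?m = real i + 1" and Im_m: "Im ?m = real (Suc j) + 1/2"
      by (simp_all add: midpoint_def)
    have "(Suc i, Suc (Suc j)) \<notin> set xs" using max(2)[of "(Suc i, Suc (Suc j))"] by auto
    then have mT: "?m \<notin> ?T"
      using edges_subset[of "{(Suc i, Suc j), (Suc i, Suc (Suc j))}" xs]
      by (intro edge_midpoint_not_in_trace nb) (auto simp: nbr_def)
    let ?c = "Complex (real i + 1/2) (real (Suc j) + 1/2)"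
    have cin: "?c \<in> inside ?T"
      by (rule cell_inside_iff[THEN iffD1, OF cell[where k = i and l = "Suc j"] _ _ _ _ _ y(1)])
        (use yb yT 3 in simp_all)
    have "?m \<in> inside ?T"
      by (rule cell_inside_iff[THEN iffD2, OF cell[where k = i and l = "Suc j"] _ _ _ _ mT cin])
        (simp_all add: Re_m Im_m)
    then have "Re ?m < real i + 1" by (rule less)
    then show ?thesis using Re_m by simp
  qed
qed

text \<open>The phase is symmetric in its two arguments along an edge; the sign \<open>(- 1) ^ fst u\<close> on the edges in
  the second direction makes the product of the four phases around each unit square equal to \<open>- 1\<close>.\<close>
definition phase :: "nat \<times> nat \<Rightarrow> nat \<times> nat \<Rightarrow> complex" where
  "phase u v = (if snd u = snd v then \<i> else \<i> * (- 1) ^ fst u)"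

section \<open>Phases along paths and around cycles\<close>

fun path_phase :: "(nat \<times> nat) list \<Rightarrow> complex" where
  "path_phase (x # y # xs) = phase x y * path_phase (y # xs)"
| "path_phase _ = 1"

definition lattice_cycle :: "(nat \<times> nat) list \<Rightarrow> bool" where
  "lattice_cycle vs \<longleftrightarrow> distinct vs \<and> 3 \<le> length vs \<and> nbrs (vs @ [hd vs])"

lemma phase_commute: "nbr u v \<Longrightarrow> phase u v = phase v u"
  by (auto simp: phase_def nbr_def)

lemma phase_square: "nbr u v \<Longrightarrow> phase u v * phase u v = - 1"
proof -
  have "\<i> * (- 1) ^ n * (\<i> * (- 1) ^ n) = (\<i> * \<i>) * ((- 1) ^ n * (- 1) ^ n :: complex)" for n
    by (simp only: mult_ac)
  then have "\<i> * (- 1) ^ n * (\<i> * (- 1) ^ n) = (- 1 :: complex)" for n by simp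
  then show ?thesis by (simp add: phase_def)
qed

lemma path_phase_append:
  "path_phase (xs @ y # ys) = path_phase (xs @ [y]) * path_phase (y # ys)"
proof (induction xs rule: path_phase.induct)
  case (1 x z xs) then show ?case by (cases xs) (auto simp: mult.assoc)
next
  case ("2_2" v) then show ?case by (cases ys) auto
qed auto

lemma path_phase_rev: "nbrs xs \<Longrightarrow> path_phase (rev xs) = path_phase xs"
proof (induction xs rule: path_phase.induct)
  case (1 x y xs)
  have "path_phase (rev (x # y # xs)) = path_phase (rev xs @ [y]) * phase y x"
    using path_phase_append[of "rev xs" y "[x]"] by simp
  moreover have "phase y x = phase x y" using 1 phase_commute[of x y] by simp
  ultimately show ?case using 1 by (simp add: mult.commute)
qed auto

lemma trace_append: "path_trace (xs @ y # ys) = path_trace (xs @ [y]) \<union> path_trace (y # ys)"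
  by (auto simp: trace_eq edges_append[of xs y ys])

lemma trace_rev: "path_trace (rev xs) = path_trace xs"
  by (auto simp: trace_eq edges_rev)

lemma nbrs_rev: "nbrs (rev xs) \<longleftrightarrow> nbrs xs"
  unfolding successively_rev by (auto elim: successively_mono dest: nbr_sym)

lemma nbrs_append: "nbrs (xs @ y # ys) \<longleftrightarrow> nbrs (xs @ [y]) \<and> nbrs (y # ys)"
  by (induction xs rule: path_phase.induct) (auto simp: successively_append_iff)

definition curve :: "(nat \<times> nat) list \<Rightarrow> complex set" where
  "curve vs = path_trace (vs @ [hd vs])"

definition loop_phase :: "(nat \<times> nat) list \<Rightarrow> complex" where
  "loop_phase vs = path_phase (vs @ [hd vs])"

lemma cyc_rotate:
  assumes "lattice_cycle (A @ v # B)"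
  shows "lattice_cycle (v # B @ A)" "curve (v # B @ A) = curve (A @ v # B)"
    "loop_phase (v # B @ A) = loop_phase (A @ v # B)"
proof -
  have "nbrs ((v # B @ A) @ [v]) \<and> path_trace ((v # B @ A) @ [v]) = path_trace ((A @ v # B) @ [hd (A @ v # B)]) \<and>
     path_phase ((v # B @ A) @ [v]) = path_phase ((A @ v # B) @ [hd (A @ v # B)])"
  proof (cases A)
    case Nil
    then show ?thesis using assms by (simp add: lattice_cycle_def)
  next
    case (Cons a A')
    have "nbrs (A @ v # B @ [a])" using assms Cons by (simp add: lattice_cycle_def)
    then have "nbrs (a # A' @ [v])" "nbrs (v # B @ [a])"
      using nbrs_append[of A v "B @ [a]"] Cons by auto
    then show ?thesis
      using nbrs_append[of "v # B" a "A' @ [v]"] trace_append[of "v # B" a "A' @ [v]"]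
        trace_append[of "a # A'" v "B @ [a]"] path_phase_append[of "v # B" a "A' @ [v]"]
        path_phase_append[of "a # A'" v "B @ [a]"] Cons
      by (simp add: Un_commute mult.commute)
  qed
  then show "lattice_cycle (v # B @ A)" "curve (v # B @ A) = curve (A @ v # B)"
    "loop_phase (v # B @ A) = loop_phase (A @ v # B)"
    using assms by (auto simp: lattice_cycle_def curve_def loop_phase_def)
qed

text \<open>In contrast to antisymmetric Kasteleyn weights, the phase of an edge is the same in both
  directions, so a cycle and its reversal carry the same sign.\<close>

lemma cyc_reverse:
  assumes "lattice_cycle (v # xs)"
  shows "lattice_cycle (v # rev xs)" "curve (v # rev xs) = curve (v # xs)"
    "loop_phase (v # rev xs) = loop_phase (v # xs)"
proof -
  have eq: "(v # rev xs) @ [v] = rev ((v # xs) @ [v])" by simp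
  have nb: "nbrs ((v # xs) @ [v])" using assms by (simp add: lattice_cycle_def)
  show "lattice_cycle (v # rev xs)"
    using assms nb unfolding lattice_cycle_def by (simp only: list.sel eq nbrs_rev) auto
  show "curve (v # rev xs) = curve (v # xs)"
    unfolding curve_def list.sel eq trace_rev ..
  show "loop_phase (v # rev xs) = loop_phase (v # xs)"
    unfolding loop_phase_def list.sel eq using path_phase_rev[OF nb] .
qed

lemma cyc_Cons:
  assumes "lattice_cycle (v # xs)"
  shows "nbrs xs" "nbr v (hd xs)" "nbr (last xs) v" "distinct xs" "v \<notin> set xs" "2 \<le> length xs"
    "hd xs \<noteq> last xs" "curve (v # xs) = path_trace [hd xs, v, last xs] \<union> path_trace xs"
    "loop_phase (v # xs) = phase v (hd xs) * path_phase xs * phase (last xs) v"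
proof -
  obtain u ys where xs: "xs = u # ys" "ys \<noteq> []"
    using assms by (cases xs; cases "tl xs") (auto simp: lattice_cycle_def)
  obtain zs u' where ys: "ys = zs @ [u']" using xs(2) by (cases ys rule: rev_cases) auto
  have nb: "nbrs ((v # u # zs) @ u' # [v])" using assms xs ys by (simp add: lattice_cycle_def)
  then show "nbrs xs" "nbr v (hd xs)" "nbr (last xs) v"
    using nbrs_append[of "v # u # zs" u' "[v]"] xs ys by auto
  show "distinct xs" "v \<notin> set xs" "2 \<le> length xs" "hd xs \<noteq> last xs"
    using assms xs ys by (auto simp: lattice_cycle_def)
  have "curve (v # xs) = path_trace ((v # u # zs) @ u' # [v])" using xs ys by (simp add: curve_def)
  then show "curve (v # xs) = path_trace [hd xs, v, last xs] \<union> path_trace xs"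
    using trace_append[of "v # u # zs" u' "[v]"] xs ys
    by (auto simp: closed_segment_commute)
  have "loop_phase (v # xs) = path_phase ((v # u # zs) @ u' # [v])" using xs ys by (simp add: loop_phase_def)
  then show "loop_phase (v # xs) = phase v (hd xs) * path_phase xs * phase (last xs) v"
    using path_phase_append[of "v # u # zs" u' "[v]"] xs ys by auto
qed

lemma cyc_ConsI:
  assumes "nbrs xs" "nbr v (hd xs)" "nbr (last xs) v" "distinct xs" "v \<notin> set xs" "2 \<le> length xs"
  shows "lattice_cycle (v # xs)"
proof -
  obtain u ys where xs: "xs = u # ys" "ys \<noteq> []" using assms by (cases xs; cases "tl xs") auto
  obtain zs u' where ys: "ys = zs @ [u']" using xs(2) by (cases ys rule: rev_cases) auto
  have "nbrs ((v # u # zs) @ u' # [v])"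
    using nbrs_append[of "v # u # zs" u' "[v]"] assms xs ys by simp
  then show ?thesis using assms xs ys by (simp add: lattice_cycle_def)
qed

lemma trace_subset_convex:
  assumes "convex C" "cpt ` set xs \<subseteq> C"
  shows "path_trace xs \<subseteq> C"
  using assms(2)
proof (induction xs rule: path_trace.induct)
  case (1 x y xs)
  then show ?case using closed_segment_subset[OF _ _ assms(1)] by simp
qed auto

text \<open>The inside of a curve stays in every convex set containing the curve, here the closed
  unit square, whose only lattice points are the four corners on the curve.\<close>

lemma enc_unit_square:
  assumes "nbrs P" "nbrs Q" "set P \<union> set Q = {i, Suc i} \<times> {j, Suc j}"
  shows "n_inside (path_trace P \<union> path_trace Q) = 0"
proof -
  let ?S = "path_trace P \<union> path_trace Q"
  let ?B = "{x. real i \<le> Re x \<and> Re x \<le> real i + 1 \<and> real j \<le> Im x \<and> Im x \<le> real j + 1}"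
  have "?B = {x. Re x \<ge> real i} \<inter> {x. Re x \<le> real i + 1} \<inter> {x. Im x \<ge> real j} \<inter> {x. Im x \<le> real j + 1}"
    by blast
  also have "convex \<dots>"
    by (intro convex_Int convex_halfspace_Re_ge convex_halfspace_Re_le
        convex_halfspace_Im_ge convex_halfspace_Im_le)
  finally have conv: "convex ?B" .
  have "cpt ` set P \<subseteq> ?B" "cpt ` set Q \<subseteq> ?B" using equalityD1[OF assms(3)] by auto
  then have "?S \<subseteq> ?B" using trace_subset_convex[OF conv] by simp
  then have "- ?B \<subseteq> outside ?S" using conv by (intro outside_subset_convex)
  then have in_B: "inside ?S \<subseteq> ?B" using inside_Int_outside[of ?S] by blast
  have "cpt v \<notin> inside ?S" for v
  proof
    assume v: "cpt v \<in> inside ?S"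
    then have "cpt v \<in> ?B" using in_B by blast
    then have "real i \<le> real (fst v)" "real (fst v) \<le> real i + 1"
      "real j \<le> real (snd v)" "real (snd v) \<le> real j + 1" by simp_all
    then have "fst v \<in> {i, Suc i}" "snd v \<in> {j, Suc j}"
      using nat_between by blast+
    then have "v \<in> set P \<union> set Q" unfolding assms(3) mem_Times_iff by simp
    then have "cpt v \<in> ?S" using assms(1,2) by auto
    then show False using v inside_no_overlap by blast
  qed
  then show ?thesis by (simp add: n_inside_def)
qed

lemma closing_edge:
  assumes "xs \<noteq> []"
  shows "curve xs = path_trace xs \<union> path_trace [last xs, hd xs]"
    "loop_phase xs = path_phase xs * phase (last xs) (hd xs)"
    "lattice_cycle xs \<longleftrightarrow> distinct xs \<and> 3 \<le> length xs \<and> nbrs xs \<and> nbr (last xs) (hd xs)"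
proof -
  obtain zs y where xs: "xs = zs @ [y]" using assms by (cases xs rule: rev_cases) auto
  define h where "h = hd xs"
  have e: "xs @ [h] = zs @ y # [h]" and l: "last xs = y" by (simp_all add: xs)
  show "curve xs = path_trace xs \<union> path_trace [last xs, hd xs]"
    unfolding curve_def h_def[symmetric] e trace_append[of zs y "[h]"] l using xs by simp
  show "loop_phase xs = path_phase xs * phase (last xs) (hd xs)"
    unfolding loop_phase_def h_def[symmetric] e path_phase_append[of zs y "[h]"] l using xs by simp
  show "lattice_cycle xs \<longleftrightarrow> distinct xs \<and> 3 \<le> length xs \<and> nbrs xs \<and> nbr (last xs) (hd xs)"
    unfolding lattice_cycle_def h_def[symmetric] e nbrs_append[of zs y "[h]"] l using xs by auto
qed

text \<open>The chord is the single edge from \<open>a\<close> to \<open>b\<close>; it has no inner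
  vertices, so the enclosed counts add. Closing both paths by it contributes
  \<open>phase b a\<close> twice, that is \<open>- 1\<close>, which turns the product of two signs
  \<open>- ((- 1) ^ n)\<close> into one of the same shape. The premise \<open>mid\<close> is an
  implication because callers can place the midpoint inside only when it is known to be off the
  curve.\<close>

lemma unit_chord_phase:
  assumes P1: "lpath a b P1" "3 \<le> length P1" and P2: "lpath a b P2" "3 \<le> length P2"
    and ab: "nbr a b" and meet: "set P1 \<inter> set P2 = {a, b}"
    and mid: "midpoint (cpt a) (cpt b) \<notin> path_trace P1 \<union> path_trace P2 \<Longrightarrow>
      midpoint (cpt a) (cpt b) \<in> inside (path_trace P1 \<union> path_trace P2)"
    and IH: "\<And>P. lattice_cycle P \<Longrightarrow> P \<in> {P1, P2} \<Longrightarrow>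
      n_inside (curve P) \<le> n_inside (path_trace P1 \<union> path_trace P2) \<Longrightarrow> loop_phase P = - ((- 1) ^ n_inside (curve P))"
  shows "path_phase P1 * path_phase P2 = - ((- 1) ^ n_inside (path_trace P1 \<union> path_trace P2))"
proof -
  have P: "lpath a b [a, b]" using ab by (auto simp: lpath_def)
  have ends: "P1 \<noteq> []" "P2 \<noteq> []" "hd P1 = a" "last P1 = b" "hd P2 = a" "last P2 = b"
    using P1 P2 by (auto simp: lpath_def)
  have nb: "nbrs P1" "nbrs P2" and d: "distinct P1" "distinct P2" using P1 P2 by (auto simp: lpath_def)
  have "{a, b} \<notin> edges P1" "{a, b} \<notin> edges P2"
    using hd_last_edge[OF d(1) P1(2)] hd_last_edge[OF d(2) P2(2)] ends by auto
  then have "midpoint (cpt a) (cpt b) \<notin> path_trace P1 \<union> path_trace P2"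
    using edge_midpoint_not_in_trace nb ab by blast
  then have "midpoint (cpt a) (cpt b) \<in> inside (path_trace P1 \<union> path_trace P2)" by (rule mid)
  moreover have "midpoint (cpt a) (cpt b) \<in> path_trace [a, b]" by simp
  ultimately have "path_trace [a, b] \<inter> inside (path_trace P1 \<union> path_trace P2) \<noteq> {}" by blast
  moreover have "set P1 \<inter> set [a, b] = {a, b}" "set P2 \<inter> set [a, b] = {a, b}"
    using meet by auto
  moreover have t: "path_trace [b, a] = path_trace [a, b]"
    using trace_rev[of "[a, b]"] by (simp only: rev.simps append.simps)
  ultimately have "n_inside (path_trace P1 \<union> path_trace P2) =
      n_inside (path_trace P1 \<union> path_trace [a, b]) + n_inside (path_trace P2 \<union> path_trace [a, b]) + (length [a, b] - 2)"
    by (intro enc_chord_split[OF P1 P2 P meet])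
  moreover have "curve P1 = path_trace P1 \<union> path_trace [a, b]" "curve P2 = path_trace P2 \<union> path_trace [a, b]"
    using closing_edge(1)[OF ends(1)] closing_edge(1)[OF ends(2)] unfolding ends t by blast+
  ultimately have sum: "n_inside (path_trace P1 \<union> path_trace P2) = n_inside (curve P1) + n_inside (curve P2)" by simp
  have "lattice_cycle P1" "lattice_cycle P2"
    using closing_edge(3)[OF ends(1)] closing_edge(3)[OF ends(2)] ends nb d P1(2) P2(2) nbr_sym[OF ab]
    by simp_all
  then have "loop_phase P1 = - ((- 1) ^ n_inside (curve P1))" "loop_phase P2 = - ((- 1) ^ n_inside (curve P2))"
    using IH sum by auto
  then have "(path_phase P1 * phase b a) * (path_phase P2 * phase b a) =
      (- 1) ^ n_inside (curve P1) * (- 1) ^ n_inside (curve P2)"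
    using closing_edge(2)[OF ends(1)] closing_edge(2)[OF ends(2)] ends by simp
  then have "(path_phase P1 * path_phase P2) * (phase b a * phase b a) = (- 1) ^ n_inside (path_trace P1 \<union> path_trace P2)"
    by (simp only: sum power_add mult_ac)
  then show ?thesis unfolding phase_square[OF nbr_sym[OF ab]]
    by (metis minus_minus mult_minus1_right)
qed

text \<open>The induction step at a corner \<open>v\<close> with neighbours \<open>u\<close> to the
  left and \<open>u'\<close> below; \<open>w\<close> completes the unit cell. If the cycle avoids
  \<open>w\<close>, replacing \<open>v\<close> by \<open>w\<close> keeps the length, moves
  \<open>w\<close> from the inside onto the curve and changes the sign of the phase. If the cycle
  passes through \<open>w\<close>, the edge \<open>{u, w}\<close> or \<open>{w, u'}\<close> is a
  chord giving two shorter cycles, unless the cycle is the unit square itself.\<close>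

lemma loop_phase_corner:
  fixes i j :: nat and xs :: "(nat \<times> nat) list"
  defines "v \<equiv> (Suc i, Suc j)" and "u \<equiv> (i, Suc j)" and "u' \<equiv> (Suc i, j)" and "w \<equiv> (i, j)"
  assumes lattice_cycle: "lattice_cycle (v # xs)" and hd: "hd xs = u" and last: "last xs = u'"
    and max: "\<And>p. p \<in> set xs \<Longrightarrow> fst p \<le> Suc i"
      "\<And>p. p \<in> set xs \<Longrightarrow> fst p = Suc i \<Longrightarrow> snd p \<le> Suc j"
    and IH: "\<And>vs. lattice_cycle vs \<Longrightarrow> n_inside (curve vs) + length vs < n_inside (curve (v # xs)) + length (v # xs) \<Longrightarrow>
      loop_phase vs = - ((- 1) ^ n_inside (curve vs))"
  shows "loop_phase (v # xs) = - ((- 1) ^ n_inside (curve (v # xs)))"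
proof -
  note c = cyc_Cons[OF lattice_cycle, unfolded hd last]
  have adj: "nbr v u" "nbr u v" "nbr v u'" "nbr u' v" "nbr w u" "nbr u w" "nbr w u'" "nbr u' w"
    and dist: "v \<noteq> u" "v \<noteq> u'" "v \<noteq> w" "u \<noteq> u'" "u \<noteq> w" "u' \<noteq> w"
    by (auto simp: v_def u_def u'_def w_def nbr_def)
  note dist = dist dist[symmetric]
  have xs0: "xs \<noteq> []" using c by auto
  have uin: "u \<in> set xs" "u' \<in> set xs" using hd last xs0 by (metis list.set_sel(1), metis last_in_set)
  have lxs: "lpath u u' xs" using c hd last by (auto simp: lpath_def)
  have lv: "lpath u u' [u, v, u']" using adj dist by (auto simp: lpath_def)
  have meet_v: "set [u, v, u'] \<inter> set xs = {u, u'}" using uin c by auto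
  define T where "T = curve (v # xs)"
  have T: "T = path_trace [u, v, u'] \<union> path_trace xs" unfolding T_def by (rule c)
  have T': "T = path_trace (v # xs @ [v])" by (simp add: T_def curve_def)
  have nbL: "nbrs (v # xs @ [v])" using lattice_cycle by (simp add: lattice_cycle_def)
  obtain g where g: "simple_path g" "pathfinish g = pathstart g" "path_image g = path_trace (v # xs @ [v])"
    using lpath_simple_loop[OF lv _ lxs meet_v] T T' by auto
  obtain ys where ys: "xs = u # ys" using xs0 hd by (cases xs) auto
  have centre: "Complex (real i + 1/2) (real j + 1/2) \<in> inside T"
    unfolding T'
  proof (rule corner_cell_inside[OF g nbL])
    show "{(Suc i, Suc j), (i, Suc j)} \<in> edges (v # xs @ [v])"
      by (simp add: ys v_def u_def)
  qed (use max in \<open>auto simp: v_def\<close>)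
  \<comment> \<open>Since the centre is inside, so is all of the closed cell off the curve. This is
    applied to \<open>w\<close> and to the midpoints of the two sides at \<open>w\<close>.\<close>
  have cell: "x \<in> inside T"
    if "x \<notin> T" "real i \<le> Re x" "Re x \<le> real i + 1" "real j \<le> Im x" "Im x \<le> real j + 1" for x
  proof (rule cell_inside_iff[THEN iffD2, OF _ that(2-5) that(1) centre])
    show "y \<notin> T" if "real i < Re y" "Re y < real i + 1" "real j < Im y" "Im y < real j + 1" for y
      unfolding T' by (rule trace_avoids_cell[OF nbL that])
  qed
  show ?thesis
  proof (cases "w \<in> set xs")
    case False
    have lw: "lpath u u' [u, w, u']" using adj dist by (auto simp: lpath_def)
    \<comment> \<open>If \<open>xs\<close> had only two vertices, the diagonal points
      \<open>u\<close> and \<open>u'\<close> would be neighbours.\<close>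
    have len3: "3 \<le> length xs"
    proof (rule ccontr)
      assume "\<not> 3 \<le> length xs"
      then have "length xs = 2" using c(6) by linarith
      then obtain p q where "xs = [p, q]" by (auto simp: length_Suc_conv numeral_2_eq_2)
      then show False using c(1) hd last by (auto simp: nbr_def u_def u'_def)
    qed
    have "cpt w \<notin> T" using False dist nbL unfolding T' by simp
    then have "cpt w \<in> inside T" by (rule cell) (simp_all add: w_def)
    moreover have "cpt w \<in> path_trace [u, w, u']" by simp
    ultimately have "path_trace [u, w, u'] \<inter> inside (path_trace [u, v, u'] \<union> path_trace xs) \<noteq> {}"
      using T by blast
    then have "n_inside T = n_inside (path_trace [u, v, u'] \<union> path_trace [u, w, u']) + n_inside (path_trace xs \<union> path_trace [u, w, u'])
        + (length [u, w, u'] - 2)"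
      unfolding T using uin False c(5) dist
      by (intro enc_chord_split[OF lv _ lxs len3 lw meet_v]) auto
    moreover have "n_inside (path_trace [u, v, u'] \<union> path_trace [u, w, u']) = 0"
      using adj by (intro enc_unit_square) (auto simp: v_def u_def u'_def w_def)
    moreover have cw: "lattice_cycle (w # xs)"
      using c adj False hd last by (intro cyc_ConsI) auto
    moreover have "curve (w # xs) = path_trace [u, w, u'] \<union> path_trace xs"
      using cyc_Cons(8)[OF cw] hd last by simp
    ultimately have n_inside: "n_inside T = Suc (n_inside (curve (w # xs)))" by (simp add: Un_commute)
    have "loop_phase (w # xs) = - ((- 1) ^ n_inside (curve (w # xs)))"
      using n_inside by (intro IH cw) (simp add: T_def)
    \<comment> \<open>The four phases around the cell multiply to \<open>- 1\<close>, so the ways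
      from \<open>u'\<close> to \<open>u\<close> over \<open>v\<close> and over \<open>w\<close>
      differ in sign.\<close>
    moreover have "loop_phase (v # xs) = - loop_phase (w # xs)"
      using cyc_Cons(9)[OF cw] c(9) hd last
      by (simp add: phase_def v_def u_def u'_def w_def)
    ultimately show ?thesis using n_inside by (simp add: T_def)
  next
    case True
    then obtain A B where AB: "xs = A @ w # B" by (meson split_list)
    obtain ys1 where A: "A = u # ys1" using AB hd dist by (cases A) auto
    obtain ys2 where B: "B = ys2 @ [u']" using AB last dist by (cases B rule: rev_cases) auto
    have nbAB: "nbrs (A @ [w])" "nbrs (w # B)" using c(1) nbrs_append[of A w B] AB by auto
    have trAB: "path_trace xs = path_trace (A @ [w]) \<union> path_trace (w # B)" using trace_append[of A w B] AB by simp
    have phAB: "path_phase xs = path_phase (A @ [w]) * path_phase (w # B)"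
      using path_phase_append[of A w B] AB by simp
    show ?thesis
    proof (cases "ys1 = []")
      case False
      \<comment> \<open>Both paths run from \<open>u\<close> to \<open>w\<close>: \<open>?P1\<close>
        is the stretch of the cycle that avoids \<open>v\<close>, and \<open>?P2\<close> is the rest
        of the cycle, traversed backwards.\<close>
      let ?P1 = "A @ [w]" and ?P2 = "u # v # rev (w # B)"
      have rB: "rev (w # B) = u' # rev ys2 @ [w]" by (simp add: B)
      have P1: "lpath u w ?P1" "3 \<le> length ?P1"
        using False A c(4) AB nbAB by (auto simp: lpath_def Suc_le_eq numeral_3_eq_3)
      have nbP2: "nbrs ?P2"
        using nbAB(2) adj unfolding nbrs_rev[of "w # B", symmetric] rB by simp
      have P2: "lpath u w ?P2" "3 \<le> length ?P2"
        using nbP2 c(4,5) AB A B dist by (auto simp: lpath_def)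
      have trP2: "path_trace ?P2 = path_trace [u, v, u'] \<union> path_trace (w # B)"
        unfolding trace_rev[of "w # B", symmetric] rB by auto
      have phP2: "path_phase ?P2 = phase u v * phase v u' * path_phase (w # B)"
        using path_phase_rev[OF nbAB(2)] unfolding rB by simp
      have TP: "T = path_trace ?P1 \<union> path_trace ?P2" unfolding T trAB trP2 by blast
      have "path_phase ?P1 * path_phase ?P2 = - ((- 1) ^ n_inside (path_trace ?P1 \<union> path_trace ?P2))"
      proof (rule unit_chord_phase[OF P1 P2 adj(6)])
        show "set ?P1 \<inter> set ?P2 = {u, w}" using c(4,5) AB A by auto
        assume "midpoint (cpt u) (cpt w) \<notin> path_trace ?P1 \<union> path_trace ?P2"
        then show "midpoint (cpt u) (cpt w) \<in> inside (path_trace ?P1 \<union> path_trace ?P2)"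
          unfolding TP[symmetric] by (rule cell) (simp_all add: midpoint_def u_def w_def)
      next
        fix P assume P: "lattice_cycle P" "P \<in> {?P1, ?P2}" "n_inside (curve P) \<le> n_inside (path_trace ?P1 \<union> path_trace ?P2)"
        have "length P < length (v # xs)" using P(2) AB A B False by auto
        then show "loop_phase P = - ((- 1) ^ n_inside (curve P))"
          using P TP by (intro IH) (auto simp: T_def)
      qed
      moreover have "loop_phase (v # xs) = path_phase ?P1 * path_phase ?P2"
        unfolding c(9) phAB phP2 phase_commute[OF adj(1)] phase_commute[OF adj(3)]
        by (simp only: mult_ac)
      ultimately show ?thesis using TP T_def by simp
    next
      case ys1: True
      show ?thesis
      proof (cases "ys2 = []")
        case True
        then have xs: "xs = [u, w, u']" using AB A B ys1 by simp
        have "n_inside T = 0"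
          unfolding T xs using adj by (intro enc_unit_square) (auto simp: v_def u_def u'_def w_def)
        moreover have "loop_phase (v # xs) = - 1"
          unfolding c(9) unfolding xs by (simp add: phase_def v_def u_def u'_def w_def mult_ac)
        ultimately show ?thesis by (simp add: T_def)
      next
        case False
        let ?P1 = "w # B" and ?P2 = "[w, u, v, u']"
        have P1: "lpath w u' ?P1" "3 \<le> length ?P1"
          using False B c(4) AB nbAB by (auto simp: lpath_def Suc_le_eq numeral_3_eq_3)
        have P2: "lpath w u' ?P2" "3 \<le> length ?P2" using adj dist by (auto simp: lpath_def)
        have TP: "T = path_trace ?P1 \<union> path_trace ?P2" unfolding T trAB A ys1
          by (auto simp: closed_segment_commute)
        have "path_phase ?P1 * path_phase ?P2 = - ((- 1) ^ n_inside (path_trace ?P1 \<union> path_trace ?P2))"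
        proof (rule unit_chord_phase[OF P1 P2 adj(7)])
          show "set ?P1 \<inter> set ?P2 = {w, u'}" using c(4,5) AB A B by auto
          assume "midpoint (cpt w) (cpt u') \<notin> path_trace ?P1 \<union> path_trace ?P2"
          then show "midpoint (cpt w) (cpt u') \<in> inside (path_trace ?P1 \<union> path_trace ?P2)"
            unfolding TP[symmetric] by (rule cell) (simp_all add: midpoint_def u'_def w_def)
        next
          fix P assume P: "lattice_cycle P" "P \<in> {?P1, ?P2}" "n_inside (curve P) \<le> n_inside (path_trace ?P1 \<union> path_trace ?P2)"
          have "length P < length (v # xs)" using P(2) AB A B False by auto
          then show "loop_phase P = - ((- 1) ^ n_inside (curve P))"
            using P TP by (intro IH) (auto simp: T_def)
        qed
        moreover have "loop_phase (v # xs) = path_phase ?P1 * path_phase ?P2"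
          using phase_commute[OF adj(1)] phase_commute[OF adj(3)] phase_commute[OF adj(5)]
          by (simp add: c(9) phAB A ys1 mult_ac)
        ultimately show ?thesis using TP T_def by simp
      qed
    qed
  qed
qed

text \<open>The measure adds the enclosed count and the length: pushing a corner lowers the first
  and keeps the second, cutting along a chord lowers the second and does not raise the
  first.\<close>

theorem loop_phase_eq:
  assumes "lattice_cycle vs"
  shows "loop_phase vs = - ((- 1) ^ n_inside (curve vs))"
  using assms
proof (induction "n_inside (curve vs) + length vs" arbitrary: vs rule: less_induct)
  case less
  let ?S = "set vs"
  have ne: "?S \<noteq> {}" using less.prems by (auto simp: lattice_cycle_def)
  define I where "I = Max (fst ` ?S)"
  have I: "p \<in> ?S \<Longrightarrow> fst p \<le> I" for p unfolding I_def by (intro Max_ge) auto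
  define R where "R = {p \<in> ?S. fst p = I}"
  have "I \<in> fst ` ?S" unfolding I_def using ne by (intro Max_in) auto
  then have R: "R \<noteq> {}" "finite R" by (auto simp: R_def)
  define J where "J = Max (snd ` R)"
  have J: "p \<in> R \<Longrightarrow> snd p \<le> J" for p unfolding J_def using R by (intro Max_ge) auto
  have "J \<in> snd ` R" unfolding J_def using R by (intro Max_in) auto
  then have v: "(I, J) \<in> ?S" by (auto simp: R_def)
  obtain A B where AB: "vs = A @ (I, J) # B" using v by (meson split_list)
  define xs where "xs = B @ A"
  have rot: "lattice_cycle ((I, J) # xs)" "curve ((I, J) # xs) = curve vs" "loop_phase ((I, J) # xs) = loop_phase vs"
    using cyc_rotate[of A "(I, J)" B] less.prems unfolding AB xs_def by auto
  have set_xs: "set xs \<subseteq> ?S" and len: "length vs = Suc (length xs)" by (auto simp: AB xs_def)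
  note c = cyc_Cons[OF rot(1)]
  have "xs \<noteq> []" using c by auto
  then have ends: "hd xs \<in> ?S" "last xs \<in> ?S" using set_xs by auto
  \<comment> \<open>Maximality excludes the neighbours to the right and above, so the two neighbours
    of \<open>(I, J)\<close> on the cycle are the left one and the lower one, in either order.
    Reversing the cycle reduces the second order to the first.\<close>
  have nb: "(\<exists>i. I = Suc i \<and> p = (i, J)) \<or> (\<exists>j. J = Suc j \<and> p = (I, j))"
    if "p \<in> ?S" "nbr (I, J) p" for p
    using that I[of p] J[of p] by (cases p) (auto simp: nbr_def R_def)
  consider i j where "I = Suc i" "J = Suc j" "hd xs = (i, Suc j)" "last xs = (Suc i, j)"
    | i j where "I = Suc i" "J = Suc j" "last xs = (i, Suc j)" "hd xs = (Suc i, j)"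
    using nb[OF ends(1) c(2)] nb[OF ends(2) nbr_sym[OF c(3)]] c(7) by auto
  then show ?case
  proof cases
    case (1 i j)
    have "loop_phase ((Suc i, Suc j) # xs) = - ((- 1) ^ n_inside (curve ((Suc i, Suc j) # xs)))"
    proof (rule loop_phase_corner)
      show "lattice_cycle ((Suc i, Suc j) # xs)" using rot 1 by simp
      fix ws assume "lattice_cycle ws" "n_inside (curve ws) + length ws <
        n_inside (curve ((Suc i, Suc j) # xs)) + length ((Suc i, Suc j) # xs)"
      then show "loop_phase ws = - ((- 1) ^ n_inside (curve ws))"
        using less.hyps[of ws] rot 1 len by simp
    qed (use 1 I J set_xs in \<open>auto simp: R_def\<close>)
    then show ?thesis using rot 1 by simp
  next
    case (2 i j)
    note r = cyc_reverse[OF rot(1)]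
    have "loop_phase ((Suc i, Suc j) # rev xs) = - ((- 1) ^ n_inside (curve ((Suc i, Suc j) # rev xs)))"
    proof (rule loop_phase_corner)
      show "lattice_cycle ((Suc i, Suc j) # rev xs)" using r 2 by simp
      fix ws assume "lattice_cycle ws" "n_inside (curve ws) + length ws <
        n_inside (curve ((Suc i, Suc j) # rev xs)) + length ((Suc i, Suc j) # rev xs)"
      then show "loop_phase ws = - ((- 1) ^ n_inside (curve ws))"
        using less.hyps[of ws] rot r 2 len by simp
    qed (use 2 I J set_xs \<open>xs \<noteq> []\<close> in \<open>auto simp: R_def hd_rev last_rev\<close>)
    then show ?thesis using rot r 2 by simp
  qed
qed

section \<open>Loop configurations as permutations\<close>

lemma cycle_arcs_eq:
  assumes "distinct vs"
  shows "cycle_arcs vs = (\<lambda>x. (x, cycle_of_list vs x)) ` set vs"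
proof -
  have "map (cycle_of_list vs) vs = rotate1 vs"
    using cyclic_rotation[OF assms, of 1] by (simp add: rotate1_def rotate_def)
  then have nth: "cycle_of_list vs (vs ! i) = vs ! (Suc i mod length vs)" if "i < length vs" for i
    using that nth_rotate1[OF that] by (metis nth_map)
  show ?thesis
    unfolding cycle_arcs_def by (auto simp: in_set_conv_nth nth image_iff) (use nth in metis)
qed

lemma Field_cycle_arcs:
  assumes "distinct vs"
  shows "Field (cycle_arcs vs) = set vs"
proof -
  have "cycle_of_list vs ` set vs = set vs"
    by (rule permutes_image[OF cycle_permutes])
  then show ?thesis unfolding cycle_arcs_eq[OF assms] Field_def by force
qed

lemma sign_cycle_of_list: "distinct vs \<Longrightarrow> vs \<noteq> [] \<Longrightarrow> sign (cycle_of_list vs) = (- 1) ^ (length vs - 1)"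
  by (induction vs rule: cycle_of_list.induct)
    (auto simp: sign_compose sign_swap_id permutation_of_cycle permutation_swap_id)

text \<open>The value \<open>v\<close> off the arcs turns monopoles into fixed points, so that a
  configuration yields a permutation of all of \<open>V\<close>.\<close>

definition succ_of :: "('v \<times> 'v) set \<Rightarrow> 'v \<Rightarrow> 'v" where
  "succ_of U v = (if \<exists>w. (v, w) \<in> U then THE w. (v, w) \<in> U else v)"

lemma succ_of_eq: "single_valued U \<Longrightarrow> (v, w) \<in> U \<Longrightarrow> succ_of U v = w"
  unfolding succ_of_def by (auto dest: single_valuedD)

lemma succ_of_outside: "v \<notin> Domain U \<Longrightarrow> succ_of U v = v"
  unfolding succ_of_def by auto

lemma directed_loopE:
  assumes "l \<in> directed_loops V E"
  obtains vs where "l = cycle_arcs vs" "distinct vs" "set vs \<subseteq> V" "even (length vs)" "2 \<le> length vs"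
    "\<And>u v. (u, v) \<in> l \<Longrightarrow> {u, v} \<in> E"
  using assms unfolding directed_loops_def by blast

lemma config_single_valued:
  assumes "C \<in> monopole_dimer_configs V E"
  shows "single_valued (\<Union>C)"
proof (rule single_valuedI)
  fix x y z assume "(x, y) \<in> \<Union>C" "(x, z) \<in> \<Union>C"
  then obtain l l' where l: "l \<in> C" "(x, y) \<in> l" "l' \<in> C" "(x, z) \<in> l'" by blast
  then have "x \<in> loop_verts l" "x \<in> loop_verts l'" by (auto simp: loop_verts_def Field_def)
  then have "l = l'"
    using assms l unfolding monopole_dimer_configs_def pairwise_def disjnt_def by blast
  moreover have "l \<in> directed_loops V E" using assms l by (auto simp: monopole_dimer_configs_def)
  then obtain vs where "l = cycle_arcs vs" "distinct vs" by (elim directed_loopE)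
  ultimately show "y = z" using l by (auto simp: cycle_arcs_eq)
qed

text \<open>Every loop is a cycle of even length and hence an odd permutation. Disjoint loops
  compose, so each of them contributes one factor \<open>- 1\<close> to the sign.\<close>

lemma config_permutation:
  assumes "finite V" "C \<in> monopole_dimer_configs V E"
  shows "succ_of (\<Union>C) permutes V \<and> sign (succ_of (\<Union>C)) = (- 1) ^ card C"
proof -
  have "finite C"
    using assms finite_directed_loops[of V E] finite_subset unfolding monopole_dimer_configs_def by blast
  then show ?thesis using assms(2)
  proof (induction C rule: finite_induct)
    case empty
    have "succ_of {} = (id :: 'a \<Rightarrow> 'a)" by (rule ext) (simp add: succ_of_def)
    then show ?case by (simp only: Union_empty permutes_id sign_id card.empty power_0 simp_thms)
  next
    case (insert l C)
    have C: "C \<in> monopole_dimer_configs V E"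
      using insert.prems by (auto simp: monopole_dimer_configs_def pairwise_insert)
    have "l \<in> directed_loops V E" using insert.prems by (auto simp: monopole_dimer_configs_def)
    then obtain vs where vs: "l = cycle_arcs vs" "distinct vs" "set vs \<subseteq> V" "even (length vs)" "2 \<le> length vs"
      by (elim directed_loopE)
    have Fl: "Field l = set vs" using Field_cycle_arcs vs by auto
    have disj: "set vs \<inter> Field (\<Union>C) = {}"
    proof -
      have "set vs \<inter> Field l' = {}" if "l' \<in> C" for l'
      proof -
        have "l \<noteq> l'" using insert.hyps that by auto
        moreover have "pairwise (\<lambda>l l'. disjnt (loop_verts l) (loop_verts l')) (insert l C)"
          using insert.prems by (simp add: monopole_dimer_configs_def)
        ultimately have "disjnt (loop_verts l) (loop_verts l')" using that by (auto dest: pairwiseD)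
        then show ?thesis by (simp add: disjnt_def loop_verts_def Fl)
      qed
      then show ?thesis by (auto simp: Field_Union)
    qed
    have comp: "succ_of (\<Union>(insert l C)) = cycle_of_list vs \<circ> succ_of (\<Union>C)"
    proof
      fix v
      show "succ_of (\<Union>(insert l C)) v = (cycle_of_list vs \<circ> succ_of (\<Union>C)) v"
      proof (cases "v \<in> set vs")
        case True
        then have "v \<notin> Domain (\<Union>C)" using disj by (auto simp: Field_def)
        moreover have "(v, cycle_of_list vs v) \<in> \<Union>(insert l C)" using True vs by (auto simp: cycle_arcs_eq)
        ultimately show ?thesis
          using succ_of_eq[OF config_single_valued[OF insert.prems]] succ_of_outside[of v "\<Union>C"] by simp
      next
        case False
        show ?thesis
        proof (cases "v \<in> Domain (\<Union>C)")
          case True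
          then obtain w where w: "(v, w) \<in> \<Union>C" by auto
          then have "w \<in> Field (\<Union>C)" by (rule FieldI2)
          then have "w \<notin> set vs" using disj by blast
          moreover have "succ_of (\<Union>C) v = w" "succ_of (\<Union>(insert l C)) v = w"
            using succ_of_eq[OF config_single_valued[OF C] w]
              succ_of_eq[OF config_single_valued[OF insert.prems], of v w] w by simp_all
          ultimately show ?thesis using id_outside_supp[of w vs] by simp
        next
          case F2: False
          have "v \<notin> Domain (\<Union>(insert l C))"
            using F2 False vs by (auto simp: cycle_arcs_eq)
          then show ?thesis
            using succ_of_outside[OF F2] succ_of_outside[of v "\<Union>(insert l C)"]
              id_outside_supp[OF False] by simp
        qed
      qed
    qed
    have IH: "succ_of (\<Union>C) permutes V" "sign (succ_of (\<Union>C)) = (- 1) ^ card C"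
      using insert.IH[OF C] by auto
    have "cycle_of_list vs permutes V" by (rule permutes_subset[OF cycle_permutes vs(3)])
    then have "succ_of (\<Union>(insert l C)) permutes V"
      unfolding comp by (rule permutes_compose[OF IH(1)])
    moreover have "sign (succ_of (\<Union>(insert l C))) = sign (cycle_of_list vs) * sign (succ_of (\<Union>C))"
      unfolding comp
      by (rule sign_compose[OF permutation_of_cycle permutes_imp_permutation[OF assms(1) IH(1)]])
    moreover have "sign (cycle_of_list vs) = - 1"
    proof -
      have "vs \<noteq> []" "odd (length vs - 1)" using vs(4,5) by auto
      then show ?thesis using sign_cycle_of_list[OF vs(2)] by simp
    qed
    ultimately show ?case using IH insert.hyps by simp
  qed
qed

text \<open>The arc of \<open>U\<close> leaving a vertex is unique, so a walk along \<open>l\<close>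
  from the common vertex never leaves \<open>l'\<close>, and this walk visits all of
  \<open>l\<close>. Applied in both directions, it recovers the loops of a configuration from their
  union.\<close>

lemma loop_eq_if_meet:
  assumes "single_valued U" "l \<in> directed_loops V E" "l' \<in> directed_loops V E" "l \<subseteq> U" "l' \<subseteq> U"
    and "x \<in> Field l" "x \<in> Field l'"
  shows "l \<subseteq> l'"
proof -
  obtain vs where vs: "l = cycle_arcs vs" "distinct vs" "2 \<le> length vs" using assms(2) by (elim directed_loopE)
  obtain ws where ws: "l' = cycle_arcs ws" "distinct ws" using assms(3) by (elim directed_loopE)
  let ?n = "length vs"
  have Fl: "Field l = set vs" "Field l' = set ws" using Field_cycle_arcs vs ws by auto
  have arc: "(vs ! i, vs ! (Suc i mod ?n)) \<in> l" if "i < ?n" for i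
    using that by (auto simp: vs cycle_arcs_def)
  have step: "(y, z) \<in> l' \<and> z \<in> Field l'" if "(y, z) \<in> l" "y \<in> Field l'" for y z
  proof -
    have "(y, cycle_of_list ws y) \<in> l'" using that Fl by (auto simp: ws(1) cycle_arcs_eq[OF ws(2)])
    moreover from this have "cycle_of_list ws y = z"
      using assms(1,4,5) that by (meson single_valuedD subsetD)
    ultimately show ?thesis by (auto simp: Field_def)
  qed
  obtain i where i: "i < ?n" "x = vs ! i" using assms(6) Fl by (metis in_set_conv_nth)
  have "vs ! ((i + k) mod ?n) \<in> Field l'" for k
  proof (induction k)
    case 0 then show ?case using i assms(7) by simp
  next
    case (Suc k)
    have "(i + k) mod ?n < ?n" using vs(3) by (intro mod_less_divisor) auto
    from step[OF arc[OF this] Suc] show ?case by (simp add: mod_Suc_eq)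
  qed
  then have all: "vs ! j \<in> Field l'" if "j < ?n" for j
  proof -
    \<comment> \<open>Adding \<open>?n\<close> keeps the subtraction from being truncated when
      \<open>j < i\<close>.\<close>
    have "(i + (?n + j - i)) mod ?n = j" using i that by simp
    then show ?thesis using \<open>\<And>k. vs ! ((i + k) mod ?n) \<in> Field l'\<close> by metis
  qed
  show ?thesis
  proof
    fix p assume p: "p \<in> l"
    then obtain y z where yz: "p = (y, z)" "(y, z) \<in> l" by (cases p) auto
    then have "y \<in> set vs" using Fl(1) by (auto simp: Field_def)
    then have "y \<in> Field l'" using all by (auto simp: in_set_conv_nth)
    then show "p \<in> l'" using step yz by auto
  qed
qed

lemma directed_loop_irrefl:
  assumes "l \<in> directed_loops V E"
  shows "(v, v) \<notin> l"
proof
  assume v: "(v, v) \<in> l"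
  obtain vs where vs: "l = cycle_arcs vs" "distinct vs" "2 \<le> length vs"
    using assms by (elim directed_loopE)
  obtain i where i: "i < length vs" "v = vs ! i" "v = vs ! (Suc i mod length vs)"
    using v unfolding vs(1) cycle_arcs_def by blast
  have "Suc i mod length vs < length vs" using vs(3) by (intro mod_less_divisor) linarith
  moreover have "vs ! i = vs ! (Suc i mod length vs)" using i(2,3) by (rule subst)
  ultimately have eq: "i = Suc i mod length vs"
    using nth_eq_iff_index_eq[OF vs(2) i(1)] by blast
  show False
  proof (cases "Suc i < length vs")
    case True
    then have "Suc i mod length vs = Suc i" by (rule mod_less)
    then have "i = Suc i" by (rule trans[OF eq])
    then show False by (rule n_not_Suc_n[THEN notE])
  next
    case False
    then have n: "Suc i = length vs" using i(1) by simp
    then have "Suc i mod length vs = 0" by simp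
    then have "i = 0" by (rule trans[OF eq])
    with n vs(3) show False by simp
  qed
qed

text \<open>An arc never joins a vertex to itself, so the points moved by the successor map are
  exactly the starting points of arcs. Together with \<open>config_subset\<close> this gives
  injectivity.\<close>

lemma config_arcs:
  assumes C: "C \<in> monopole_dimer_configs V E"
  shows "\<Union>C = {(v, succ_of (\<Union>C) v) | v. succ_of (\<Union>C) v \<noteq> v}"
proof (intro Set.set_eqI iffI)
  note sv = config_single_valued[OF C]
  fix p
  {
    assume "p \<in> \<Union>C"
    then obtain l where "p \<in> l" "l \<in> C" by (elim UnionE)
    then obtain v w where vw: "p = (v, w)" "(v, w) \<in> l" "l \<in> C" by (cases p) simp
    then have "l \<in> directed_loops V E" using C unfolding monopole_dimer_configs_def by blast
    then have "v \<noteq> w" using directed_loop_irrefl vw(2) by metis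
    moreover have "succ_of (\<Union>C) v = w" by (rule succ_of_eq[OF sv UnionI[OF vw(3,2)]])
    ultimately show "p \<in> {(v, succ_of (\<Union>C) v) | v. succ_of (\<Union>C) v \<noteq> v}"
      unfolding vw(1) by auto
  next
    assume "p \<in> {(v, succ_of (\<Union>C) v) | v. succ_of (\<Union>C) v \<noteq> v}"
    then obtain v where v: "p = (v, succ_of (\<Union>C) v)" "succ_of (\<Union>C) v \<noteq> v"
      unfolding mem_Collect_eq by (elim exE conjE)
    have "v \<in> Domain (\<Union>C)" by (rule ccontr) (use succ_of_outside[of v "\<Union>C"] v(2) in simp)
    then obtain w where w: "(v, w) \<in> \<Union>C" by (rule DomainE)
    then have "succ_of (\<Union>C) v = w" by (rule succ_of_eq[OF sv])
    then have "p = (v, w)" using v(1) by simp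
    with w show "p \<in> \<Union>C" by simp
  }
qed

lemma config_subset:
  assumes C: "C \<in> monopole_dimer_configs V E" and C': "C' \<in> monopole_dimer_configs V E"
    and U: "\<Union>C = \<Union>C'"
  shows "C \<subseteq> C'"
proof
  note sv = config_single_valued[OF C]
  fix l assume l: "l \<in> C"
  then have dl: "l \<in> directed_loops V E" using C unfolding monopole_dimer_configs_def by blast
  then obtain vs where vs: "l = cycle_arcs vs" "distinct vs" "2 \<le> length vs" by (elim directed_loopE)
  have "hd vs \<in> set vs" using vs(3) by (intro hd_in_set) auto
  then obtain x y where xy: "(x, y) \<in> l" unfolding vs(1) cycle_arcs_eq[OF vs(2)] by blast
  then have "(x, y) \<in> \<Union>C'" unfolding U[symmetric] using l by (intro UnionI)
  then obtain l' where l': "l' \<in> C'" "(x, y) \<in> l'" by (elim UnionE)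
  then have dl': "l' \<in> directed_loops V E" using C' unfolding monopole_dimer_configs_def by blast
  have sub: "l \<subseteq> \<Union>C" "l' \<subseteq> \<Union>C" unfolding U using l'(1) l U by (auto intro: Union_upper)
  have x: "x \<in> Field l" "x \<in> Field l'" using xy l' by (auto intro: FieldI1)
  have "l = l'"
    using loop_eq_if_meet[OF sv dl dl' sub x] loop_eq_if_meet[OF sv dl' dl sub(2,1) x(2,1)]
    by (rule subset_antisym)
  then show "l \<in> C'" using l'(1) by simp
qed

lemma inj_on_succ_of: "inj_on (\<lambda>C. succ_of (\<Union>C)) (monopole_dimer_configs V E)"
proof (rule inj_onI)
  fix C C' assume C: "C \<in> monopole_dimer_configs V E" "C' \<in> monopole_dimer_configs V E"
    and eq: "succ_of (\<Union>C) = succ_of (\<Union>C')"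
  have "\<Union>C = {(v, succ_of (\<Union>C) v) | v. succ_of (\<Union>C) v \<noteq> v}" by (rule config_arcs[OF C(1)])
  also have "\<dots> = {(v, succ_of (\<Union>C') v) | v. succ_of (\<Union>C') v \<noteq> v}" unfolding eq ..
  also have "\<dots> = \<Union>C'" by (rule config_arcs[OF C(2), symmetric])
  finally have U: "\<Union>C = \<Union>C'" .
  show "C = C'" using config_subset[OF C U] config_subset[OF C(2,1) U[symmetric]] by (rule subset_antisym)
qed

text \<open>\<open>support p v\<close> lists the orbit of \<open>v\<close> up to the least power
  that returns to \<open>v\<close>, and this return is the closing arc.\<close>

lemma cycle_arcs_support:
  assumes "permutation p"
  shows "cycle_arcs (support p v) = (\<lambda>x. (x, p x)) ` set (support p v)"
proof -
  let ?n = "least_power p v"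
  have n: "(p ^^ ?n) v = v" "?n > 0" using least_power_of_permutation[OF assms] by auto
  have "support p v ! (Suc i mod ?n) = p (support p v ! i)" if i: "i < ?n" for i
  proof -
    have "(p ^^ (Suc i mod ?n)) v = (p ^^ Suc i) v"
    proof (cases "Suc i = ?n")
      case True then show ?thesis using n by (metis funpow_0 mod_self)
    next
      case False then show ?thesis using i by simp
    qed
    moreover have "Suc i mod ?n < ?n" using n by simp
    ultimately show ?thesis using i by simp
  qed
  note step = this
  define s where "s = support p v"
  have len: "length s = ?n" by (simp add: s_def)
  have "cycle_arcs s = (\<lambda>i. (s ! i, s ! (Suc i mod length s))) ` {..<length s}"
    by (auto simp: cycle_arcs_def)
  also have "\<dots> = (\<lambda>i. (s ! i, p (s ! i))) ` {..<length s}"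
    using step unfolding s_def[symmetric] len by (intro image_cong) auto
  also have "\<dots> = (\<lambda>x. (x, p x)) ` ((!) s ` {..<length s})" by (simp only: image_image)
  also have "(!) s ` {..<length s} = set s" by (auto simp: set_conv_nth)
  finally show ?thesis unfolding s_def .
qed

text \<open>The loops are the nontrivial orbits of \<open>p\<close>. The premise \<open>ev\<close>,
  which expresses that the graph has no odd cycles, makes their lengths even.\<close>

lemma config_of_permutation:
  assumes V: "finite V" and p: "p permutes V" and pE: "\<And>v. p v \<noteq> v \<Longrightarrow> {v, p v} \<in> E"
    and ev: "\<And>vs. distinct vs \<Longrightarrow> set vs \<subseteq> V \<Longrightarrow> 2 \<le> length vs \<Longrightarrow>
      (\<forall>(u, v) \<in> cycle_arcs vs. {u, v} \<in> E) \<Longrightarrow> even (length vs)"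
  shows "\<exists>C \<in> monopole_dimer_configs V E. succ_of (\<Union>C) = p"
proof
  have perm: "permutation p" using p V by (auto simp: permutation_permutes)
  define l where "l v = cycle_arcs (support p v)" for v
  define C where "C = l ` {v. p v \<noteq> v}"
  have arcs: "l v = (\<lambda>x. (x, p x)) ` set (support p v)" for v
    unfolding l_def by (rule cycle_arcs_support[OF perm])
  have dist: "distinct (support p v)" for v by (rule cycle_of_permutation[OF perm])
  have orb: "set (support p v) = range (\<lambda>i. (p ^^ i) v)" for v by (rule support_set[OF perm])
  have v_in: "v \<in> set (support p v)" for v unfolding orb by (metis funpow_0 rangeI)
  \<comment> \<open>A fixed point in the orbit of \<open>v\<close> would force \<open>v\<close> to
    be fixed, because powers of \<open>p\<close> are injective.\<close>
  have moved: "p x \<noteq> x" if x: "x \<in> set (support p v)" and v: "p v \<noteq> v" for x v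
  proof
    assume "p x = x"
    obtain i where i: "x = (p ^^ i) v" using x unfolding orb by blast
    have "inj (p ^^ i)" using permutes_inj[OF permutes_funpow[OF p]] .
    moreover have "(p ^^ i) (p v) = (p ^^ i) v" using \<open>p x = x\<close> i by (metis funpow_swap1)
    ultimately show False using v by (auto dest: injD)
  qed
  have loop: "l v \<in> directed_loops V E" if v: "p v \<noteq> v" for v
  proof -
    have len: "2 \<le> length (support p v)" using least_power_gt_one[OF perm v] by simp
    have sub: "set (support p v) \<subseteq> V"
    proof
      fix x assume "x \<in> set (support p v)"
      then have "p x \<noteq> x" using moved v by blast
      then show "x \<in> V" using p by (auto simp: permutes_def)
    qed
    have E: "\<forall>(u, w) \<in> cycle_arcs (support p v). {u, w} \<in> E"
      using moved v pE arcs unfolding l_def by auto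
    show ?thesis unfolding directed_loops_def l_def
      using dist sub len E ev[OF dist sub len E] by blast
  qed
  have "pairwise (\<lambda>l l'. disjnt (loop_verts l) (loop_verts l')) C"
  proof (rule pairwiseI)
    fix a b assume "a \<in> C" "b \<in> C" "a \<noteq> b"
    then obtain v w where vw: "a = l v" "b = l w" by (auto simp: C_def)
    have "set (support p v) \<noteq> set (support p w)"
    proof
      assume eq: "set (support p v) = set (support p w)"
      have "a = b" unfolding vw arcs eq ..
      with \<open>a \<noteq> b\<close> show False by simp
    qed
    then have "set (support p v) \<inter> set (support p w) = {}"
      using disjoint_support[OF perm] unfolding disjoint_def by blast
    then show "disjnt (loop_verts a) (loop_verts b)"
      by (simp add: disjnt_def loop_verts_def vw l_def Field_cycle_arcs[OF dist])
  qed
  then show C: "C \<in> monopole_dimer_configs V E"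
    using loop by (auto simp: monopole_dimer_configs_def C_def)
  show "succ_of (\<Union>C) = p"
  proof
    fix v
    show "succ_of (\<Union>C) v = p v"
    proof (cases "p v = v")
      case True
      have "v \<notin> Domain (\<Union>C)"
      proof
        assume "v \<in> Domain (\<Union>C)"
        then obtain w where "p w \<noteq> w" "v \<in> set (support p w)" by (auto simp: C_def arcs)
        then show False using moved True by blast
      qed
      then show ?thesis using True succ_of_outside by metis
    next
      case False
      then have "(v, p v) \<in> \<Union>C" using v_in arcs by (auto simp: C_def)
      then show ?thesis using succ_of_eq[OF config_single_valued[OF C]] by auto
    qed
  qed
qed

text \<open>Configurations correspond to the permutations that move vertices along edges only; every
  other permutation meets a zero entry. In the Leibniz term the sign of the permutation is
  \<open>- 1\<close> to the number of loops, and the minus sign in the premise \<open>loop\<close>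
  absorbs it.\<close>

theorem partition_function_eq_det:
  fixes M :: "'v \<Rightarrow> 'v \<Rightarrow> complex"
  assumes V: "finite V"
    and ev: "\<And>vs. distinct vs \<Longrightarrow> set vs \<subseteq> V \<Longrightarrow> 2 \<le> length vs \<Longrightarrow>
      (\<forall>(u, v) \<in> cycle_arcs vs. {u, v} \<in> E) \<Longrightarrow> even (length vs)"
    and diag: "\<And>v. v \<in> V \<Longrightarrow> M v v = of_real (vw v)"
    and off: "\<And>u v. u \<in> V \<Longrightarrow> v \<in> V \<Longrightarrow> u \<noteq> v \<Longrightarrow> {u, v} \<notin> E \<Longrightarrow> M u v = 0"
    and loop: "\<And>l. l \<in> directed_loops V E \<Longrightarrow>
      of_real (loop_weight V pos ew l) = - (\<Prod>(u, v)\<in>l. M u v)"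
  shows "of_real (partition_function V E pos ew vw) =
    (\<Sum>p | p permutes V. of_int (sign p) * (\<Prod>v\<in>V. M v (p v)))"
proof -
  let ?S = "{p. p permutes V \<and> (\<forall>v. p v \<noteq> v \<longrightarrow> {v, p v} \<in> E)}"
  let ?f = "\<lambda>p. of_int (sign p) * (\<Prod>v\<in>V. M v (p v))"
  have edge: "{v, succ_of (\<Union>C) v} \<in> E"
    if C: "C \<in> monopole_dimer_configs V E" and "succ_of (\<Union>C) v \<noteq> v" for C v
  proof -
    have "v \<in> Domain (\<Union>C)" using that succ_of_outside by metis
    then obtain w l where w: "(v, w) \<in> l" "l \<in> C" by blast
    then have "succ_of (\<Union>C) v = w" using succ_of_eq[OF config_single_valued[OF C]] by blast
    moreover have "l \<in> directed_loops V E" using w C by (auto simp: monopole_dimer_configs_def)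
    ultimately show ?thesis using w by (auto elim: directed_loopE)
  qed
  have bij: "bij_betw (\<lambda>C. succ_of (\<Union>C)) (monopole_dimer_configs V E) ?S"
    unfolding bij_betw_def
  proof (intro conjI inj_on_succ_of subset_antisym subsetI)
    fix p assume "p \<in> (\<lambda>C. succ_of (\<Union>C)) ` monopole_dimer_configs V E"
    then show "p \<in> ?S" using config_permutation[OF V] edge by auto
  next
    fix p assume "p \<in> ?S"
    then show "p \<in> (\<lambda>C. succ_of (\<Union>C)) ` monopole_dimer_configs V E"
      using config_of_permutation[OF V _ _ ev, of p E] by blast
  qed
  have weight: "of_real (config_weight V pos ew vw C) = ?f (succ_of (\<Union>C))"
    if C: "C \<in> monopole_dimer_configs V E" for C
  proof -
    let ?p = "succ_of (\<Union>C)"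
    let ?U = "\<Union>l\<in>C. loop_verts l"
    have dl: "l \<in> directed_loops V E" if "l \<in> C" for l using C that by (auto simp: monopole_dimer_configs_def)
    have "finite C" using dl finite_directed_loops[OF V] by (meson finite_subset subsetI)
    have lv: "finite (loop_verts l) \<and> loop_verts l \<subseteq> V" if "l \<in> C" for l
      using dl[OF that] by (auto elim!: directed_loopE simp: loop_verts_def Field_cycle_arcs)
    have inner: "(\<Prod>v\<in>loop_verts l. M v (?p v)) = (\<Prod>(u, v)\<in>l. M u v)" if l: "l \<in> C" for l
    proof -
      obtain vs where vs: "l = cycle_arcs vs" "distinct vs" using dl[OF l] by (elim directed_loopE)
      have "loop_verts l = set vs" using vs by (simp add: loop_verts_def Field_cycle_arcs)
      moreover have "?p v = cycle_of_list vs v" if "v \<in> set vs" for v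
      proof -
        have "(v, cycle_of_list vs v) \<in> l" unfolding vs(1) cycle_arcs_eq[OF vs(2)] using that by simp
        then show ?thesis using l by (intro succ_of_eq[OF config_single_valued[OF C]]) blast
      qed
      ultimately have "(\<Prod>v\<in>loop_verts l. M v (?p v)) = (\<Prod>v\<in>set vs. M v (cycle_of_list vs v))"
        by simp
      also have "\<dots> = (\<Prod>(u, v)\<in>l. M u v)"
        unfolding vs(1) cycle_arcs_eq[OF vs(2)]
        by (subst prod.reindex) (auto simp: inj_on_def)
      finally show ?thesis .
    qed
    have "(\<Prod>v\<in>V. M v (?p v)) = (\<Prod>v\<in>V - ?U. M v (?p v)) * (\<Prod>v\<in>?U. M v (?p v))"
      using lv by (intro prod.subset_diff V) blast
    also have "(\<Prod>v\<in>?U. M v (?p v)) = (\<Prod>l\<in>C. \<Prod>v\<in>loop_verts l. M v (?p v))"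
      using lv \<open>finite C\<close> C
      by (intro prod.UNION_disjoint) (auto simp: monopole_dimer_configs_def pairwise_def disjnt_def)
    also have "\<dots> = (\<Prod>l\<in>C. \<Prod>(u, v)\<in>l. M u v)" using inner by (intro prod.cong) auto
    also have "(\<Prod>v\<in>V - ?U. M v (?p v)) = (\<Prod>v\<in>V - ?U. of_real (vw v))"
    proof (intro prod.cong refl)
      fix v assume v: "v \<in> V - ?U"
      then have "v \<notin> Domain (\<Union>C)" by (auto simp: loop_verts_def Field_def)
      then show "M v (?p v) = of_real (vw v)" using succ_of_outside diag v by (metis DiffD1)
    qed
    finally have "?f ?p = (- 1) ^ card C * ((\<Prod>v\<in>V - ?U. of_real (vw v)) * (\<Prod>l\<in>C. \<Prod>(u, v)\<in>l. M u v))"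
      using config_permutation[OF V C] by simp
    moreover have "(\<Prod>l\<in>C. of_real (loop_weight V pos ew l)) = (\<Prod>l\<in>C. - 1 * (\<Prod>(u, v)\<in>l. M u v))"
      using loop dl by (intro prod.cong) auto
    moreover have "\<dots> = (- 1) ^ card C * (\<Prod>l\<in>C. \<Prod>(u, v)\<in>l. M u v)"
      by (simp only: prod.distrib prod_constant)
    ultimately show ?thesis by (simp add: config_weight_def)
  qed
  have "of_real (partition_function V E pos ew vw) = (\<Sum>C \<in> monopole_dimer_configs V E. ?f (succ_of (\<Union>C)))"
    unfolding partition_function_def of_real_sum using weight by (intro sum.cong) auto
  also have "\<dots> = sum ?f ?S" by (rule sum.reindex_bij_betw[OF bij])
  also have "\<dots> = sum ?f {p. p permutes V}"
  proof (rule sum.mono_neutral_left)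
    show "finite {p. p permutes V}" using V by (rule finite_permutations)
    show "\<forall>p\<in>{p. p permutes V} - ?S. ?f p = 0"
    proof
      fix p assume "p \<in> {p. p permutes V} - ?S"
      then obtain v where p: "p permutes V" and v: "p v \<noteq> v" "{v, p v} \<notin> E" by auto
      then have "v \<in> V" "p v \<in> V" by (metis permutes_not_in, metis permutes_not_in permutes_in_image)
      then have "M v (p v) = 0" using off v by metis
      then show "?f p = 0" using \<open>v \<in> V\<close> V by (simp add: prod_zero_iff) blast
    qed
  qed auto
  finally show ?thesis .
qed

section \<open>Transfer of enclosed points to the complex plane\<close>

definition to_complex :: "real \<times> real \<Rightarrow> complex" where
  "to_complex p = Complex (fst p) (snd p)"

lemma linear_to_complex: "linear to_complex"
  by (rule linearI) (simp_all add: to_complex_def complex_eq_iff)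

lemma inj_to_complex: "inj to_complex"
  by (rule injI) (simp add: to_complex_def prod_eq_iff)

lemma norm_to_complex: "norm (to_complex p) = norm p"
  by (simp add: to_complex_def norm_prod_def cmod_def)

definition of_complex_pair :: "complex \<Rightarrow> real \<times> real" where
  "of_complex_pair z = (Re z, Im z)"

lemma of_complex_pair_inverse: "of_complex_pair (to_complex p) = p"
  "to_complex (of_complex_pair z) = z"
  by (simp_all add: of_complex_pair_def to_complex_def)

lemma connected_component_to_complex:
  "connected_component (- (to_complex ` S)) (to_complex x) (to_complex y) \<longleftrightarrow> connected_component (- S) x y"
proof
  assume "connected_component (- S) x y"
  then obtain T where T: "connected T" "T \<subseteq> - S" "x \<in> T" "y \<in> T" by (auto simp: connected_component_def)
  have "connected (to_complex ` T)"
    by (intro connected_continuous_image linear_continuous_on linear_conv_bounded_linear[THEN iffD1]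
        linear_to_complex T)
  moreover have "to_complex ` T \<subseteq> - (to_complex ` S)"
    using T(2) inj_to_complex by (auto dest: injD)
  ultimately show "connected_component (- (to_complex ` S)) (to_complex x) (to_complex y)"
    using T(3,4) unfolding connected_component_def by blast
next
  assume "connected_component (- (to_complex ` S)) (to_complex x) (to_complex y)"
  then obtain T where T: "connected T" "T \<subseteq> - (to_complex ` S)" "to_complex x \<in> T" "to_complex y \<in> T"
    by (auto simp: connected_component_def)
  have "connected (of_complex_pair ` T)"
    unfolding of_complex_pair_def
    by (intro connected_continuous_image continuous_intros T)
  moreover have "of_complex_pair ` T \<subseteq> - S"
  proof
    fix p assume "p \<in> of_complex_pair ` T"
    then have "to_complex p \<in> T" by (auto simp: of_complex_pair_inverse)
    then show "p \<in> - S" using T(2) by blast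
  qed
  moreover have "x \<in> of_complex_pair ` T" "y \<in> of_complex_pair ` T"
    using imageI[OF T(3), of of_complex_pair] imageI[OF T(4), of of_complex_pair]
    by (simp_all add: of_complex_pair_inverse)
  ultimately show "connected_component (- S) x y" unfolding connected_component_def by blast
qed

text \<open>\<open>inside\<close> refers to the bounded components of the complement.
  \<open>to_complex\<close> is a homeomorphism that preserves norms, so components and their
  boundedness correspond.\<close>

lemma inside_to_complex:
  "to_complex x \<in> inside (to_complex ` S) \<longleftrightarrow> x \<in> inside S"
proof -
  let ?A = "connected_component_set (- S) x"
  have "connected_component_set (- (to_complex ` S)) (to_complex x) = to_complex ` ?A"
  proof (intro Set.set_eqI iffI)
    fix z assume "z \<in> connected_component_set (- (to_complex ` S)) (to_complex x)"
    then have "connected_component (- (to_complex ` S)) (to_complex x) (to_complex (of_complex_pair z))"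
      by (simp add: of_complex_pair_inverse)
    then have "of_complex_pair z \<in> ?A" by (simp add: connected_component_to_complex)
    then have "to_complex (of_complex_pair z) \<in> to_complex ` ?A" by (rule imageI)
    then show "z \<in> to_complex ` ?A" by (simp add: of_complex_pair_inverse)
  next
    fix z assume "z \<in> to_complex ` ?A"
    then show "z \<in> connected_component_set (- (to_complex ` S)) (to_complex x)"
      by (auto simp: connected_component_to_complex)
  qed
  moreover have "bounded (to_complex ` ?A) \<longleftrightarrow> bounded ?A"
    by (simp add: bounded_iff norm_to_complex)
  moreover have "to_complex x \<in> to_complex ` S \<longleftrightarrow> x \<in> S"
    using inj_to_complex by (rule inj_image_mem_iff)
  ultimately show ?thesis by (simp add: inside_def)
qed

lemma to_complex_grid_pos: "to_complex (grid_pos v) = cpt v"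
  by (simp add: to_complex_def grid_pos_def cpt_def)

section \<open>Curves and phases expressed by sets of arcs\<close>

lemma trace_eq_UN:
  "2 \<le> length xs \<Longrightarrow> path_trace xs = (\<Union>i<length xs - 1. closed_segment (cpt (xs ! i)) (cpt (xs ! Suc i)))"
proof (induction xs rule: path_trace.induct)
  case (1 x y xs)
  show ?case
  proof (cases xs)
    case Nil then show ?thesis by auto
  next
    case (Cons z zs)
    then have IH: "path_trace (y # xs) = (\<Union>i<length xs. closed_segment (cpt ((y # xs) ! i)) (cpt ((y # xs) ! Suc i)))"
      using 1 by simp
    have *: "{..<length (x # y # xs) - 1} = insert 0 (Suc ` {..<length xs})"
      by (simp add: lessThan_Suc_eq_insert_0)
    show ?thesis unfolding * path_trace.simps IH by simp
  qed
qed auto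

lemma path_phase_eq_prod:
  "path_phase xs = (\<Prod>i<length xs - 1. phase (xs ! i) (xs ! Suc i))"
proof (induction xs rule: path_phase.induct)
  case (1 x y xs)
  then show ?case by (simp add: prod.lessThan_Suc_shift del: prod.lessThan_Suc)
qed auto

lemma nbrs_iff_nth: "nbrs xs \<longleftrightarrow> (\<forall>i. Suc i < length xs \<longrightarrow> nbr (xs ! i) (xs ! Suc i))"
  by (rule successively_conv_nth)

lemma nth_append_hd:
  assumes "i < length vs"
  shows "(vs @ [hd vs]) ! i = vs ! i" "(vs @ [hd vs]) ! Suc i = vs ! (Suc i mod length vs)"
proof -
  show "(vs @ [hd vs]) ! i = vs ! i" using assms by (simp add: nth_append)
  have "vs \<noteq> []" using assms by auto
  show "(vs @ [hd vs]) ! Suc i = vs ! (Suc i mod length vs)"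
  proof (cases "Suc i = length vs")
    case True
    with \<open>vs \<noteq> []\<close> show ?thesis by (simp add: nth_append hd_conv_nth)
  next
    case False
    with assms show ?thesis by (simp add: nth_append)
  qed
qed

lemma cycle_arcs_image:
  "cycle_arcs vs = (\<lambda>i. (vs ! i, vs ! (Suc i mod length vs))) ` {..<length vs}"
  by (auto simp: cycle_arcs_def)

lemma prod_cycle_arcs:
  assumes "distinct vs"
  shows "(\<Prod>(u, v)\<in>cycle_arcs vs. f u v) = (\<Prod>i<length vs. f (vs ! i) (vs ! (Suc i mod length vs)))"
  unfolding cycle_arcs_image
  by (subst prod.reindex) (use assms in \<open>auto simp: inj_on_def nth_eq_iff_index_eq\<close>)

lemma curve_eq_arcs:
  assumes "vs \<noteq> []"
  shows "curve vs = (\<Union>(u, v)\<in>cycle_arcs vs. closed_segment (cpt u) (cpt v))"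
proof -
  have "2 \<le> length (vs @ [hd vs])" using assms by (simp add: Suc_le_eq)
  then have "curve vs = (\<Union>i<length vs. closed_segment (cpt ((vs @ [hd vs]) ! i)) (cpt ((vs @ [hd vs]) ! Suc i)))"
    unfolding curve_def by (subst trace_eq_UN) simp_all
  also have "\<dots> = (\<Union>i<length vs. closed_segment (cpt (vs ! i)) (cpt (vs ! (Suc i mod length vs))))"
    by (intro SUP_cong refl) (simp add: nth_append_hd)
  finally show ?thesis unfolding cycle_arcs_image by simp
qed

lemma loop_phase_eq_prod:
  assumes "distinct vs"
  shows "loop_phase vs = (\<Prod>(u, v)\<in>cycle_arcs vs. phase u v)"
proof -
  have "loop_phase vs = (\<Prod>i<length vs. phase ((vs @ [hd vs]) ! i) ((vs @ [hd vs]) ! Suc i))"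
    unfolding loop_phase_def path_phase_eq_prod by simp
  also have "\<dots> = (\<Prod>i<length vs. phase (vs ! i) (vs ! (Suc i mod length vs)))"
    by (intro prod.cong refl) (simp add: nth_append_hd)
  finally show ?thesis unfolding prod_cycle_arcs[OF assms] .
qed

section \<open>The Kasteleyn matrix of the grid\<close>

lemma grid_edge_nbr: "{u, v} \<in> grid_edges m n \<Longrightarrow> nbr u v"
  unfolding grid_edges_def nbr_def by (auto simp: doubleton_eq_iff)

lemma nbr_grid_edge:
  assumes "nbr u v" "u \<in> grid_verts m n" "v \<in> grid_verts m n"
  shows "{u, v} \<in> grid_edges m n"
  using assms(1)
proof (cases rule: nbr_cases)
  case (1 i j)
  then have "(i, j) \<in> grid_verts m n" "(Suc i, j) \<in> grid_verts m n"
    using assms(2,3) by (auto simp: doubleton_eq_iff)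
  then show ?thesis unfolding 1 grid_edges_def grid_verts_def
    by (intro UnI2 CollectI exI[of _ i] exI[of _ j]) auto
next
  case (2 i j)
  then have "(i, j) \<in> grid_verts m n" "(i, Suc j) \<in> grid_verts m n"
    using assms(2,3) by (auto simp: doubleton_eq_iff)
  then show ?thesis unfolding 2 grid_edges_def grid_verts_def
    by (intro UnI1 CollectI exI[of _ i] exI[of _ j]) auto
qed

lemma grid_edge_weight_nbr:
  assumes "nbr u v"
  shows "grid_edge_weight a b {u, v} = (if fst u = fst v then a else b)"
  using assms
proof (cases rule: nbr_cases)
  case (1 i j)
  then have "fst u \<noteq> fst v" by (auto simp: doubleton_eq_iff)
  moreover have "\<nexists>k l. {u, v} = {(k, l), (k, l + 1)}" unfolding 1 by (auto simp: doubleton_eq_iff)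
  ultimately show ?thesis by (simp add: grid_edge_weight_def)
next
  case (2 i j)
  then have "fst u = fst v" by (auto simp: doubleton_eq_iff)
  moreover have "\<exists>k l. {u, v} = {(k, l), (k, l + 1)}" unfolding 2 by auto
  ultimately show ?thesis by (simp add: grid_edge_weight_def)
qed

text \<open>Chessboard colouring: every arc flips the parity of \<open>fst v + snd v\<close>, and
  after \<open>length vs\<close> arcs the cycle is back at its start.\<close>

lemma grid_cycle_even:
  assumes "vs \<noteq> []" "\<forall>(u, v) \<in> cycle_arcs vs. {u, v} \<in> grid_edges m n"
  shows "even (length vs)"
proof -
  let ?n = "length vs"
  define c :: "nat \<times> nat \<Rightarrow> nat" where "c v = fst v + snd v" for v
  have flip: "even (c (vs ! (Suc i mod ?n))) \<longleftrightarrow> odd (c (vs ! i))" if "i < ?n" for i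
  proof -
    have "nbr (vs ! i) (vs ! (Suc i mod ?n))"
      using assms(2) that grid_edge_nbr unfolding cycle_arcs_image by blast
    then show ?thesis by (auto simp: nbr_def c_def)
  qed
  have par: "even (c (vs ! i) + i) \<longleftrightarrow> even (c (vs ! 0))" if "i < ?n" for i
    using that
  proof (induction i)
    case (Suc i)
    then have "Suc i mod ?n = Suc i" by simp
    then show ?case using flip[of i] Suc by (cases "even i") auto
  qed simp
  obtain k where k: "?n = Suc k" using assms(1) by (cases vs) auto
  then show ?thesis using flip[of k] par[of k] by auto
qed

definition kast :: "real \<Rightarrow> real \<Rightarrow> real \<Rightarrow> nat \<times> nat \<Rightarrow> nat \<times> nat \<Rightarrow> complex" where
  "kast a b z u v = (if u = v then of_real z
     else if nbr u v then phase u v * of_real (if fst u = fst v then a else b) else 0)"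

lemma kast_nbr: "nbr u v \<Longrightarrow> kast a b z u v = phase u v * of_real (if fst u = fst v then a else b)"
  by (auto simp: kast_def)

text \<open>\<open>n_inside\<close> counts all lattice points, \<open>enclosed_count\<close> only
  those of the grid. They agree because the inside of a curve lies in every convex set containing
  the curve, in particular in the rectangle of the grid.\<close>

lemma enclosed_count_grid:
  assumes "vs \<noteq> []" "set vs \<subseteq> grid_verts m n"
  shows "enclosed_count (grid_verts m n) grid_pos (cycle_arcs vs) = n_inside (curve vs)"
proof -
  have "to_complex ` loop_curve grid_pos (cycle_arcs vs) = curve vs"
    unfolding loop_curve_def curve_eq_arcs[OF assms(1)] image_UN
    by (intro SUP_cong refl)
      (simp add: split_def closed_segment_linear_image[OF linear_to_complex, symmetric] to_complex_grid_pos)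
  then have in_iff: "grid_pos v \<in> inside (loop_curve grid_pos (cycle_arcs vs)) \<longleftrightarrow> cpt v \<in> inside (curve vs)" for v
    using inside_to_complex[of "grid_pos v" "loop_curve grid_pos (cycle_arcs vs)"]
    by (simp add: to_complex_grid_pos)
  let ?B = "{x. Re x \<ge> 1} \<inter> {x. Re x \<le> real m} \<inter> {x. Im x \<ge> 1} \<inter> {x. Im x \<le> real n}"
  have conv: "convex ?B"
    by (intro convex_Int convex_halfspace_Re_ge convex_halfspace_Re_le
        convex_halfspace_Im_ge convex_halfspace_Im_le)
  have "cpt ` set (vs @ [hd vs]) \<subseteq> ?B"
    using assms by (auto simp: grid_verts_def)
  then have "curve vs \<subseteq> ?B" unfolding curve_def by (rule trace_subset_convex[OF conv])
  then have "- ?B \<subseteq> outside (curve vs)" using conv by (intro outside_subset_convex)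
  then have sub: "inside (curve vs) \<subseteq> ?B" using inside_Int_outside[of "curve vs"] by blast
  have "v \<in> grid_verts m n" if "cpt v \<in> inside (curve vs)" for v
  proof -
    have "cpt v \<in> ?B" using that sub by blast
    then show ?thesis by (cases v) (simp add: grid_verts_def)
  qed
  then have "{v \<in> grid_verts m n. cpt v \<in> inside (curve vs)} = {v. cpt v \<in> inside (curve vs)}" by blast
  then show ?thesis unfolding enclosed_count_def n_inside_def in_iff by simp
qed

text \<open>The edge weights factor out of the product, and the phases of longer loops are given by
  \<open>loop_phase_eq\<close>. A doubled edge obeys the same rule: its curve is a segment, which
  encloses nothing, and its two equal phases multiply to \<open>- 1\<close>.\<close>

lemma kast_loop:
  assumes "l \<in> directed_loops (grid_verts m n) (grid_edges m n)"
  shows "of_real (loop_weight (grid_verts m n) grid_pos (grid_edge_weight a b) l) = - (\<Prod>(u, v)\<in>l. kast a b z u v)"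
proof -
  let ?w = "\<lambda>u v. if fst u = fst v then a else b"
  obtain vs where vs: "l = cycle_arcs vs" "distinct vs" "set vs \<subseteq> grid_verts m n" "even (length vs)"
    "2 \<le> length vs" and E: "\<And>u v. (u, v) \<in> l \<Longrightarrow> {u, v} \<in> grid_edges m n"
    using assms by (rule directed_loopE) blast
  have ne: "vs \<noteq> []" using vs(5) by auto
  have nb: "nbr u v" if "(u, v) \<in> l" for u v using E grid_edge_nbr that by blast
  have "(\<Prod>(u, v)\<in>l. kast a b z u v) = (\<Prod>(u, v)\<in>l. phase u v * of_real (?w u v))"
    by (intro prod.cong refl) (use nb in \<open>auto simp: kast_nbr\<close>)
  also have "\<dots> = (\<Prod>(u, v)\<in>l. phase u v) * (\<Prod>(u, v)\<in>l. of_real (?w u v))"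
    unfolding prod.distrib[symmetric] by (intro prod.cong refl) auto
  also have "(\<Prod>(u, v)\<in>l. phase u v) = loop_phase vs"
    unfolding vs(1) by (rule loop_phase_eq_prod[OF vs(2), symmetric])
  also have "(\<Prod>(u, v)\<in>l. complex_of_real (?w u v)) = of_real (\<Prod>(u, v)\<in>l. grid_edge_weight a b {u, v})"
    unfolding of_real_prod by (intro prod.cong refl) (use nb in \<open>auto simp: grid_edge_weight_nbr\<close>)
  finally have prod: "(\<Prod>(u, v)\<in>l. kast a b z u v) =
      loop_phase vs * of_real (\<Prod>(u, v)\<in>l. grid_edge_weight a b {u, v})" .
  have cnt: "enclosed_count (grid_verts m n) grid_pos l = n_inside (curve vs)"
    unfolding vs(1) by (rule enclosed_count_grid[OF ne vs(3)])
  have "loop_phase vs = - ((- 1) ^ n_inside (curve vs))"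
  proof (cases "length vs = 2")
    case True
    then obtain u v where uv: "vs = [u, v]" by (auto simp: length_Suc_conv numeral_2_eq_2)
    have "(u, v) \<in> l" unfolding vs(1) cycle_arcs_image uv by (auto simp: lessThan_Suc)
    then have "nbr u v" by (rule nb)
    then have "loop_phase vs = - 1"
      using phase_square[of u v] phase_commute[of u v] by (simp add: loop_phase_def uv)
    moreover have "curve vs = closed_segment (cpt u) (cpt v)"
      by (auto simp: curve_def uv closed_segment_commute)
    then have "n_inside (curve vs) = 0" by (simp add: n_inside_def inside_convex)
    ultimately show ?thesis by simp
  next
    case False
    then have "3 \<le> length vs" using vs(5) by simp
    moreover have "nbrs (vs @ [hd vs])"
      unfolding nbrs_iff_nth
    proof (intro allI impI)
      fix i assume "Suc i < length (vs @ [hd vs])"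
      then have i: "i < length vs" by simp
      have "(vs ! i, vs ! (Suc i mod length vs)) \<in> l" unfolding vs(1) cycle_arcs_image using i by blast
      then show "nbr ((vs @ [hd vs]) ! i) ((vs @ [hd vs]) ! Suc i)"
        unfolding nth_append_hd[OF i] by (rule nb)
    qed
    ultimately have "lattice_cycle vs" using vs(2) by (simp add: lattice_cycle_def)
    then show ?thesis by (rule loop_phase_eq)
  qed
  then show ?thesis unfolding prod loop_weight_def cnt by simp
qed

theorem grid_Z_eq_det:
  "of_real (grid_Z m n a b z) =
     (\<Sum>p | p permutes grid_verts m n. of_int (sign p) * (\<Prod>v\<in>grid_verts m n. kast a b z v (p v)))"
  unfolding grid_Z_def
proof (rule partition_function_eq_det)
  show "finite (grid_verts m n)" by (simp add: grid_verts_def)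
  show "even (length vs)" if "2 \<le> length vs" "\<forall>(u, v) \<in> cycle_arcs vs. {u, v} \<in> grid_edges m n" for vs
    using that by (intro grid_cycle_even) auto
  show "kast a b z u v = 0" if "u \<in> grid_verts m n" "v \<in> grid_verts m n" "u \<noteq> v" "{u, v} \<notin> grid_edges m n" for u v
    using that nbr_grid_edge[of u v m n] by (auto simp: kast_def)
qed (simp add: kast_def, rule kast_loop)

section \<open>Diagonalisation of the Kasteleyn matrix\<close>

definition set_det :: "'v set \<Rightarrow> ('v \<Rightarrow> 'v \<Rightarrow> complex) \<Rightarrow> complex" where
  "set_det V f = (\<Sum>p | p permutes V. of_int (sign p) * (\<Prod>v\<in>V. f v (p v)))"

text \<open>An enumeration of \<open>V\<close> reorders rows and columns alike: it conjugates the
  permutations and so preserves their signs. Multiplicativity is then inherited from ordinary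
  matrices.\<close>

lemma sdet_eq_det:
  assumes e: "bij_betw e {0..<N} V"
  shows "set_det V f = Determinant.det (mat N N (\<lambda>(s, t). f (e s) (e t)))"
proof -
  let ?A = "{0..<N}" and ?M = "mat N N (\<lambda>(s, t). f (e s) (e t))"
  let ?g = "\<lambda>\<pi> x. if x \<in> V then e (\<pi> (inv_into ?A e x)) else x"
  have bij: "bij_betw ?g {\<pi>. \<pi> permutes ?A} {\<pi>. \<pi> permutes V}"
    by (rule bij_betw_permutations[OF e])
  have inj: "inj_on e ?A" and img: "e ` ?A = V" using e by (auto simp: bij_betw_def)
  have term_eq: "of_int (sign (?g \<pi>)) * (\<Prod>v\<in>V. f v (?g \<pi> v)) = signof \<pi> * (\<Prod>i = 0..<N. ?M $$ (i, \<pi> i))"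
    if \<pi>: "\<pi> permutes ?A" for \<pi>
  proof -
    have "?g \<pi> = map_permutation ?A e \<pi>"
      by (rule ext) (simp add: map_permutation_def restrict_id_def img)
    then have "sign (?g \<pi>) = sign \<pi>" using sign_map_permutation[OF inj \<pi>] by simp
    moreover have "(\<Prod>v\<in>V. f v (?g \<pi> v)) = (\<Prod>i\<in>?A. f (e i) (?g \<pi> (e i)))"
      by (rule prod.reindex_bij_betw[OF e, symmetric])
    moreover have "\<dots> = (\<Prod>i\<in>?A. ?M $$ (i, \<pi> i))"
    proof (intro prod.cong refl)
      fix i assume i: "i \<in> ?A"
      then have "\<pi> i \<in> ?A" using \<pi> by (simp add: permutes_in_image)
      moreover have "?g \<pi> (e i) = e (\<pi> i)" using i inj img by (auto simp: inv_into_f_f)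
      ultimately show "f (e i) (?g \<pi> (e i)) = ?M $$ (i, \<pi> i)" using i by simp
    qed
    ultimately show ?thesis by simp
  qed
  have "set_det V f = (\<Sum>\<pi> | \<pi> permutes ?A. of_int (sign (?g \<pi>)) * (\<Prod>v\<in>V. f v (?g \<pi> v)))"
    unfolding set_det_def by (rule sum.reindex_bij_betw[OF bij, symmetric])
  also have "\<dots> = (\<Sum>\<pi> | \<pi> permutes ?A. signof \<pi> * (\<Prod>i = 0..<N. ?M $$ (i, \<pi> i)))"
    by (intro sum.cong refl) (use term_eq in simp)
  also have "\<dots> = Determinant.det ?M" by (subst det_def'[of _ N]) auto
  finally show ?thesis .
qed

lemma sdet_mult:
  assumes "finite V"
  shows "set_det V (\<lambda>u v. \<Sum>w\<in>V. f u w * g w v) = set_det V f * set_det V g"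
proof -
  obtain e where e: "bij_betw e {0..<card V} V" using ex_bij_betw_nat_finite[OF assms] by blast
  let ?N = "card V"
  let ?F = "mat ?N ?N (\<lambda>(s, t). f (e s) (e t))" and ?G = "mat ?N ?N (\<lambda>(s, t). g (e s) (e t))"
  have "mat ?N ?N (\<lambda>(s, t). \<Sum>w\<in>V. f (e s) w * g w (e t)) = ?F * ?G"
  proof (rule eq_matI)
    fix i j assume ij: "i < dim_row (?F * ?G)" "j < dim_col (?F * ?G)"
    have "(\<Sum>w\<in>V. f (e i) w * g w (e j)) = (\<Sum>k\<in>{0..<?N}. f (e i) (e k) * g (e k) (e j))"
      by (rule sum.reindex_bij_betw[OF e, symmetric])
    then show "mat ?N ?N (\<lambda>(s, t). \<Sum>w\<in>V. f (e s) w * g w (e t)) $$ (i, j) = (?F * ?G) $$ (i, j)"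
      using ij by (simp add: scalar_prod_def)
  qed auto
  then show ?thesis
    unfolding sdet_eq_det[OF e] by (simp add: Determinant.det_mult[of _ ?N])
qed

lemma sdet_cong: "(\<And>u v. u \<in> V \<Longrightarrow> v \<in> V \<Longrightarrow> f u v = g u v) \<Longrightarrow> set_det V f = set_det V g"
  unfolding set_det_def by (intro sum.cong refl arg_cong2[where f = "(*)"] prod.cong) (auto simp: permutes_in_image)

lemma sdet_diagonal:
  assumes "finite V" "\<And>u v. u \<in> V \<Longrightarrow> v \<in> V \<Longrightarrow> u \<noteq> v \<Longrightarrow> f u v = 0"
  shows "set_det V f = (\<Prod>v\<in>V. f v v)"
proof -
  have "set_det V f = (\<Sum>p\<in>{id}. of_int (sign p) * (\<Prod>v\<in>V. f v (p v)))"
    unfolding set_det_def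
  proof (rule sum.mono_neutral_right)
    show "finite {p. p permutes V}" using assms(1) by (rule finite_permutations)
    show "\<forall>p\<in>{p. p permutes V} - {id}. of_int (sign p) * (\<Prod>v\<in>V. f v (p v)) = 0"
    proof
      fix p assume "p \<in> {p. p permutes V} - {id}"
      then have p: "p permutes V" and "p \<noteq> id" by auto
      then obtain v where v: "p v \<noteq> v" by (metis eq_id_iff)
      then have "v \<in> V" using p by (metis permutes_not_in)
      moreover from this have "p v \<in> V" using p by (simp add: permutes_in_image)
      ultimately have "f v (p v) = 0" using assms(2) v by metis
      then have "(\<Prod>v\<in>V. f v (p v)) = 0" using \<open>v \<in> V\<close> assms(1) by (intro prod_zero) auto
      then show "of_int (sign p) * (\<Prod>v\<in>V. f v (p v)) = 0" by simp
    qed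
  qed (auto simp: permutes_id)
  then show ?thesis by simp
qed

section \<open>Sine modes on a path with vanishing boundary values\<close>

definition mode :: "nat \<Rightarrow> nat \<Rightarrow> nat \<Rightarrow> real" where
  "mode m j x = sin (pi * real j / real (m + 1) * real x)"

definition freq :: "nat \<Rightarrow> nat \<Rightarrow> real" where
  "freq m j = 2 * cos (pi * real j / real (m + 1))"

lemma mode_0 [simp]: "mode m j 0 = 0"
  by (simp add: mode_def)

lemma mode_end [simp]: "mode m j (Suc m) = 0"
proof -
  have "pi * real j / real (m + 1) * real (Suc m) = pi * real j" by simp
  then show ?thesis unfolding mode_def by (simp only: sin_npi2)
qed

text \<open>Together with \<open>mode_0\<close> and \<open>mode_end\<close> this says that
  \<open>mode m j\<close> is an eigenvector of the adjacency matrix of the path on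
  \<open>1..m\<close>, with eigenvalue \<open>freq m j\<close>.\<close>

lemma mode_step: "mode m j (Suc (Suc x)) + mode m j x = freq m j * mode m j (Suc x)"
proof -
  let ?t = "pi * real j / real (m + 1)"
  have "sin (s + ?t) + sin (s - ?t) = 2 * cos ?t * sin s" for s
    by (simp add: sin_add sin_diff)
  moreover have "?t * real (Suc x) + ?t = ?t * real (Suc (Suc x))"
    and "?t * real (Suc x) - ?t = ?t * real x"
    by (simp_all only: of_nat_Suc distrib_left mult_1_right)
  ultimately show ?thesis unfolding mode_def freq_def by metis
qed

lemma mode_angle:
  assumes "p \<in> {1..m}"
  shows "0 < pi * real p / real (m + 1)" "pi * real p / real (m + 1) < pi"
proof -
  show "0 < pi * real p / real (m + 1)" using assms by simp
  have "pi * real p < pi * real (m + 1)" using assms by (intro mult_strict_left_mono) auto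
  then show "pi * real p / real (m + 1) < pi" by (subst divide_less_eq) auto
qed

text \<open>The adjacency matrix of the path is symmetric, and the two eigenvalues differ because
  the cosine is injective on \<open>[0, pi]\<close>.\<close>

lemma mode_orthogonal:
  assumes "j \<in> {1..m}" "l \<in> {1..m}" "j \<noteq> l"
  shows "(\<Sum>x = 1..m. mode m j x * mode m l x) = 0"
proof -
  obtain r where m: "m = Suc r" using assms by (cases m) auto
  \<comment> \<open>Summation by parts: an index shift moves the neighbour step to the other factor,
    and the boundary terms vanish by \<open>mode_0\<close> and \<open>mode_end\<close>.\<close>
  have parts: "(\<Sum>x = 1..m. mode m p (Suc x) * mode m q x) = (\<Sum>x = 1..m. mode m p x * mode m q (x - 1))" for p q
  proof -
    have "(\<Sum>x = 1..m. mode m p (Suc x) * mode m q x) = (\<Sum>x = 0..m. mode m p (Suc x) * mode m q x)"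
      by (simp add: sum.atLeast_Suc_atMost)
    also have "\<dots> = (\<Sum>x = 0..r. mode m p (Suc x) * mode m q x)" using mode_end[of m p] by (simp add: m)
    also have "\<dots> = (\<Sum>x = 1..m. mode m p x * mode m q (x - 1))"
      unfolding m One_nat_def sum.shift_bounds_cl_Suc_ivl by simp
    finally show ?thesis .
  qed
  have eig: "freq m p * (\<Sum>x = 1..m. mode m p x * mode m q x) =
      (\<Sum>x = 1..m. mode m p (Suc x) * mode m q x) + (\<Sum>x = 1..m. mode m p (x - 1) * mode m q x)" for p q
  proof -
    have "freq m p * mode m p x = mode m p (Suc x) + mode m p (x - 1)" if "x \<in> {1..m}" for x
      using mode_step[of m p "x - 1"] that by simp
    then have "freq m p * (mode m p x * mode m q x) = mode m p (Suc x) * mode m q x + mode m p (x - 1) * mode m q x"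
      if "x \<in> {1..m}" for x using that by (metis mult.assoc distrib_right)
    then show ?thesis by (simp add: sum_distrib_left flip: sum.distrib)
  qed
  have "freq m j * (\<Sum>x = 1..m. mode m j x * mode m l x) = freq m l * (\<Sum>x = 1..m. mode m j x * mode m l x)"
    using eig[of j l] eig[of l j] parts[of j l] parts[of l j] by (simp add: mult.commute)
  moreover have "freq m j \<noteq> freq m l"
  proof
    assume "freq m j = freq m l"
    then have "cos (pi * real j / real (m + 1)) = cos (pi * real l / real (m + 1))" by (simp add: freq_def)
    moreover have "0 \<le> pi * real p / real (m + 1)" "pi * real p / real (m + 1) \<le> pi" if "p \<in> {1..m}" for p
      using mode_angle[OF that] by simp_all
    ultimately have "pi * real j / real (m + 1) = pi * real l / real (m + 1)"
      using cos_inj_pi assms by meson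
    then show False using assms(3) by simp
  qed
  ultimately show ?thesis by simp
qed

lemma mode_norm_pos:
  assumes "j \<in> {1..m}"
  shows "(\<Sum>x = 1..m. mode m j x * mode m j x) > 0"
proof (rule sum_pos2[of _ 1])
  have "sin (pi * real j / real (m + 1)) > 0"
    using mode_angle[OF assms] by (intro sin_gt_zero)
  then show "0 < mode m j 1 * mode m j 1" by (simp add: mode_def)
qed (use assms in auto)

section \<open>The off-diagonal part of the Kasteleyn matrix and its action on products of
  modes\<close>

definition hop :: "real \<Rightarrow> real \<Rightarrow> nat \<times> nat \<Rightarrow> nat \<times> nat \<Rightarrow> complex" where
  "hop a b u v = (if nbr u v then phase u v * of_real (if fst u = fst v then a else b) else 0)"

text \<open>Since \<open>f\<close> vanishes on the frame around the grid, a vertex on the border may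
  be treated as having four neighbours like any other. Writing the vertex with \<open>Suc\<close>
  keeps its left and lower neighbours within the natural numbers.\<close>

lemma hop_sum:
  fixes f :: "nat \<times> nat \<Rightarrow> complex"
  assumes "(Suc x, Suc y) \<in> grid_verts m n"
    and "\<And>y. f (0, y) = 0" "\<And>y. f (Suc m, y) = 0" "\<And>x. f (x, 0) = 0" "\<And>x. f (x, Suc n) = 0"
  shows "(\<Sum>w\<in>grid_verts m n. hop a b (Suc x, Suc y) w * f w) =
     \<i> * of_real b * (f (Suc (Suc x), Suc y) + f (x, Suc y))
     + \<i> * (- 1) ^ Suc x * of_real a * (f (Suc x, Suc (Suc y)) + f (Suc x, y))"
proof -
  let ?u = "(Suc x, Suc y)"
  let ?W = "{0..Suc m} \<times> {0..Suc n}"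
  let ?N = "{(Suc (Suc x), Suc y), (x, Suc y), (Suc x, Suc (Suc y)), (Suc x, y)}"
  have xy: "x < m" "y < n" using assms(1) by (auto simp: grid_verts_def)
  have "(\<Sum>w\<in>grid_verts m n. hop a b ?u w * f w) = (\<Sum>w\<in>?W. hop a b ?u w * f w)"
  proof (rule sum.mono_neutral_left)
    show "\<forall>w\<in>?W - grid_verts m n. hop a b ?u w * f w = 0"
    proof
      fix w assume "w \<in> ?W - grid_verts m n"
      then have "fst w = 0 \<or> fst w = Suc m \<or> snd w = 0 \<or> snd w = Suc n"
        by (cases w) (auto simp: grid_verts_def)
      then have "f w = 0" using assms(2-5) by (cases w) auto
      then show "hop a b ?u w * f w = 0" by simp
    qed
  qed (auto simp: grid_verts_def)
  also have "\<dots> = (\<Sum>w\<in>?N. hop a b ?u w * f w)"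
  proof (rule sum.mono_neutral_right)
    show "\<forall>w\<in>?W - ?N. hop a b ?u w * f w = 0"
      by (auto simp: hop_def nbr_def)
  qed (use xy in auto)
  also have "\<dots> = \<i> * of_real b * (f (Suc (Suc x), Suc y) + f (x, Suc y))
     + \<i> * (- 1) ^ Suc x * of_real a * (f (Suc x, Suc (Suc y)) + f (Suc x, y))"
    by (simp add: hop_def nbr_def phase_def algebra_simps)
  finally show ?thesis .
qed

definition eigvec :: "nat \<Rightarrow> nat \<Rightarrow> nat \<times> nat \<Rightarrow> nat \<times> nat \<Rightarrow> complex" where
  "eigvec m n q v = of_real (mode m (fst q) (fst v) * mode n (snd q) (snd v))"

text \<open>With \<open>B = b * freq m (fst q)\<close> and \<open>A = a * freq n (snd q)\<close>,
  \<open>hop\<close> acts on the span of the vector and its staggered copy as the imaginary unit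
  times the matrix with rows \<open>(B, A)\<close> and \<open>(A, - B)\<close>, whose square is the
  scalar \<open>A^2 + B^2\<close>. Staggering by \<open>(- 1) ^ fst v\<close> reverses the sign of
  steps in the first coordinate only, which is the anticommutation of the two directions.\<close>

lemma hop_eigvec:
  assumes "v \<in> grid_verts m n"
  shows "(\<Sum>w\<in>grid_verts m n. hop a b v w * eigvec m n q w) =
      \<i> * of_real (b * freq m (fst q)) * eigvec m n q v
      + \<i> * of_real (a * freq n (snd q)) * ((- 1) ^ fst v * eigvec m n q v)" (is ?A)
    and "(\<Sum>w\<in>grid_verts m n. hop a b v w * ((- 1) ^ fst w * eigvec m n q w)) =
      - \<i> * of_real (b * freq m (fst q)) * ((- 1) ^ fst v * eigvec m n q v)
      + \<i> * of_real (a * freq n (snd q)) * eigvec m n q v" (is ?B)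
proof -
  obtain x y where v: "v = (Suc x, Suc y)" using assms
    by (cases v; cases "fst v"; cases "snd v") (auto simp: grid_verts_def)
  obtain j k where q: "q = (j, k)" by (cases q)
  let ?s = "\<lambda>x. complex_of_real (mode m j x)" and ?t = "\<lambda>y. complex_of_real (mode n k y)"
  have sx: "?s (Suc (Suc x)) = of_real (freq m j) * ?s (Suc x) - ?s x"
    using arg_cong[OF mode_step[of m j x], of complex_of_real] by (simp add: algebra_simps)
  have ty: "?t (Suc (Suc y)) = of_real (freq n k) * ?t (Suc y) - ?t y"
    using arg_cong[OF mode_step[of n k y], of complex_of_real] by (simp add: algebra_simps)
  have sq: "(- 1) ^ x * ((- 1) ^ x * c) = (c :: complex)" for c
    by (simp add: mult.assoc[symmetric])
  show ?A
    unfolding v by (subst hop_sum)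
      (use assms v in \<open>simp_all add: eigvec_def q sx ty algebra_simps\<close>)
  show ?B
    unfolding v by (subst hop_sum)
      (use assms v in \<open>simp_all add: eigvec_def q sx ty sq algebra_simps\<close>)
qed

lemma kast_eq_hop:
  "kast a b z u v = (if u = v then of_real z else 0) + hop a b u v"
  "kast (- a) (- b) z u v = (if u = v then of_real z else 0) - hop a b u v"
  by (auto simp: kast_def hop_def)

text \<open>The entries of \<open>hop\<close> are imaginary, so conjugation amounts to negating both
  edge weights.\<close>

lemma cnj_kast: "cnj (kast a b z u v) = kast (- a) (- b) z u v"
  by (simp add: kast_def phase_def)

lemma sdet_cnj: "cnj (set_det V f) = set_det V (\<lambda>u v. cnj (f u v))"
  by (simp add: set_det_def)

lemma kast_sum:
  assumes "u \<in> grid_verts m n"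
  shows "(\<Sum>w\<in>grid_verts m n. kast a b z u w * f w) = of_real z * f u + (\<Sum>w\<in>grid_verts m n. hop a b u w * f w)"
    "(\<Sum>w\<in>grid_verts m n. kast (- a) (- b) z u w * f w) = of_real z * f u - (\<Sum>w\<in>grid_verts m n. hop a b u w * f w)"
proof -
  have fin: "finite (grid_verts m n)" by (simp add: grid_verts_def)
  have "(\<Sum>w\<in>grid_verts m n. (if u = w then of_real z else 0) * f w) = of_real z * f u"
    using assms fin by (simp add: if_distrib[of "\<lambda>c. c * _"] cong: if_cong)
  note diag = this
  show "(\<Sum>w\<in>grid_verts m n. kast a b z u w * f w) = of_real z * f u + (\<Sum>w\<in>grid_verts m n. hop a b u w * f w)"
    unfolding kast_eq_hop(1) distrib_right sum.distrib diag ..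
  show "(\<Sum>w\<in>grid_verts m n. kast (- a) (- b) z u w * f w) = of_real z * f u - (\<Sum>w\<in>grid_verts m n. hop a b u w * f w)"
    unfolding kast_eq_hop(2) left_diff_distrib sum_subtractf diag ..
qed

definition eigval :: "nat \<Rightarrow> nat \<Rightarrow> real \<Rightarrow> real \<Rightarrow> real \<Rightarrow> nat \<times> nat \<Rightarrow> real" where
  "eigval m n a b z q = z\<^sup>2 + (b * freq m (fst q))\<^sup>2 + (a * freq n (snd q))\<^sup>2"

text \<open>This is \<open>(z + hop) (z - hop) = z^2 - hop^2\<close>, where \<open>- hop^2\<close>
  acts as the scalar \<open>A^2 + B^2\<close>. The staggered component produced by the first
  application cancels in the second.\<close>

lemma kast_kast_eigvec:
  assumes "u \<in> grid_verts m n"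
  shows "(\<Sum>w\<in>grid_verts m n. kast a b z u w * (\<Sum>v\<in>grid_verts m n. kast (- a) (- b) z w v * eigvec m n q v))
     = eigvec m n q u * of_real (eigval m n a b z q)"
proof -
  let ?V = "grid_verts m n" and ?e = "eigvec m n q" and ?f = "\<lambda>w. (- 1) ^ fst w * eigvec m n q w"
  define B where "B = complex_of_real (b * freq m (fst q))"
  define A where "A = complex_of_real (a * freq n (snd q))"
  define Z where "Z = complex_of_real z"
  have inner: "(\<Sum>v\<in>?V. kast (- a) (- b) z w v * ?e v) = (Z - \<i> * B) * ?e w - \<i> * A * ?f w"
    if "w \<in> ?V" for w
    unfolding kast_sum(2)[OF that] hop_eigvec(1)[OF that] A_def B_def Z_def by (simp add: algebra_simps)
  have "(\<Sum>w\<in>?V. kast a b z u w * (\<Sum>v\<in>?V. kast (- a) (- b) z w v * ?e v))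
      = (\<Sum>w\<in>?V. kast a b z u w * ((Z - \<i> * B) * ?e w - \<i> * A * ?f w))"
    by (intro sum.cong refl) (simp only: inner)
  also have "\<dots> = (Z - \<i> * B) * (\<Sum>w\<in>?V. kast a b z u w * ?e w) - \<i> * A * (\<Sum>w\<in>?V. kast a b z u w * ?f w)"
    unfolding sum_distrib_left sum_subtractf[symmetric] by (intro sum.cong refl) (simp add: algebra_simps)
  also have "\<dots> = (Z - \<i> * B) * (Z * ?e u + (\<i> * B * ?e u + \<i> * A * ?f u))
       - \<i> * A * (Z * ?f u + (- \<i> * B * ?f u + \<i> * A * ?e u))"
    unfolding kast_sum(1)[OF assms] hop_eigvec[OF assms] A_def B_def Z_def ..
  also have "\<dots> = ?e u * (Z\<^sup>2 + B\<^sup>2 + A\<^sup>2)"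
    by (simp add: algebra_simps power2_eq_square)
  also have "\<dots> = ?e u * of_real (eigval m n a b z q)"
    by (simp add: eigval_def A_def B_def Z_def)
  finally show ?thesis .
qed

lemma eigvec_orthogonal:
  "(\<Sum>v\<in>grid_verts m n. eigvec m n q v * eigvec m n r v) =
     of_real ((\<Sum>x = 1..m. mode m (fst q) x * mode m (fst r) x) * (\<Sum>y = 1..n. mode n (snd q) y * mode n (snd r) y))"
proof -
  have "(\<Sum>x = 1..m. mode m (fst q) x * mode m (fst r) x) * (\<Sum>y = 1..n. mode n (snd q) y * mode n (snd r) y)
     = (\<Sum>v\<in>grid_verts m n. (mode m (fst q) (fst v) * mode n (snd q) (snd v)) * (mode m (fst r) (fst v) * mode n (snd r) (snd v)))"
    unfolding sum_product grid_verts_def sum.cartesian_product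
    by (intro sum.cong refl) (simp add: split_def mult_ac)
  then show ?thesis by (simp add: eigvec_def)
qed

text \<open>The Gram matrix of the vectors is diagonal with positive entries, and the determinant in
  question is a factor of its determinant.\<close>

lemma sdet_eigvec_nonzero: "set_det (grid_verts m n) (\<lambda>v q. eigvec m n q v) \<noteq> 0"
proof
  let ?V = "grid_verts m n"
  have fin: "finite ?V" by (simp add: grid_verts_def)
  let ?G = "\<lambda>q r. \<Sum>v\<in>?V. eigvec m n q v * eigvec m n r v"
  assume z: "set_det ?V (\<lambda>v q. eigvec m n q v) = 0"
  have "set_det ?V ?G = set_det ?V (\<lambda>q v. eigvec m n q v) * set_det ?V (\<lambda>v q. eigvec m n q v)"
    by (rule sdet_mult[OF fin])
  then have z0: "set_det ?V ?G = 0" unfolding z mult_zero_right .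
  have d: "set_det ?V ?G = (\<Prod>q\<in>?V. ?G q q)"
  proof (rule sdet_diagonal[OF fin])
    fix q r assume "q \<in> ?V" "r \<in> ?V" "q \<noteq> r"
    then have "(fst q \<noteq> fst r \<and> fst q \<in> {1..m} \<and> fst r \<in> {1..m}) \<or> (snd q \<noteq> snd r \<and> snd q \<in> {1..n} \<and> snd r \<in> {1..n})"
      by (auto simp: grid_verts_def)
    then show "?G q r = 0"
    proof (elim disjE conjE)
      assume "fst q \<noteq> fst r" "fst q \<in> {1..m}" "fst r \<in> {1..m}"
      then show ?thesis unfolding eigvec_orthogonal by (subst mode_orthogonal) simp_all
    next
      assume "snd q \<noteq> snd r" "snd q \<in> {1..n}" "snd r \<in> {1..n}"
      then show ?thesis unfolding eigvec_orthogonal by (subst (2) mode_orthogonal) simp_all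
    qed
  qed
  have "?G q q \<noteq> 0" if "q \<in> ?V" for q
  proof -
    have "fst q \<in> {1..m}" "snd q \<in> {1..n}" using that by (auto simp: grid_verts_def)
    then have "(\<Sum>x = 1..m. mode m (fst q) x * mode m (fst q) x) * (\<Sum>y = 1..n. mode n (snd q) y * mode n (snd q) y) > 0"
      by (intro mult_pos_pos mode_norm_pos)
    then show ?thesis unfolding eigvec_orthogonal of_real_eq_0_iff by (rule less_imp_neq[symmetric])
  qed
  moreover have "(\<Prod>q\<in>?V. ?G q q) = 0" using d z0 by (rule trans[OF sym])
  ultimately show False unfolding prod_zero_iff[OF fin] by blast
qed

text \<open>The partition function is real, so it equals the determinants of both
  \<open>kast a b z\<close> and its conjugate \<open>kast (- a) (- b) z\<close>. Applying the
  product of the two matrices to the matrix of eigenvectors scales its columns by the eigenvalues,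
  and the nonzero determinant of the eigenvectors cancels.\<close>

theorem grid_Z_square: "(grid_Z m n a b z)\<^sup>2 = (\<Prod>q\<in>grid_verts m n. eigval m n a b z q)"
proof -
  let ?V = "grid_verts m n" and ?U = "\<lambda>v q. eigvec m n q v"
  have fin: "finite ?V" by (simp add: grid_verts_def)
  have Z: "set_det ?V (kast a b z) = of_real (grid_Z m n a b z)"
    unfolding grid_Z_eq_det set_det_def ..
  have "set_det ?V (kast (- a) (- b) z) = cnj (set_det ?V (kast a b z))"
    unfolding sdet_cnj cnj_kast ..
  then have Z': "set_det ?V (kast (- a) (- b) z) = of_real (grid_Z m n a b z)"
    unfolding Z by simp
  let ?D = "\<lambda>w q. if w = q then complex_of_real (eigval m n a b z q) else 0"
  have "of_real (grid_Z m n a b z) * (of_real (grid_Z m n a b z) * set_det ?V ?U)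
      = set_det ?V (\<lambda>u q. \<Sum>w\<in>?V. kast a b z u w * (\<Sum>v\<in>?V. kast (- a) (- b) z w v * eigvec m n q v))"
    unfolding sdet_mult[OF fin] Z Z' ..
  also have "\<dots> = set_det ?V (\<lambda>u q. \<Sum>w\<in>?V. ?U u w * ?D w q)"
  proof (rule sdet_cong)
    fix u q assume u: "u \<in> ?V" and q: "q \<in> ?V"
    have "(\<Sum>w\<in>?V. ?U u w * ?D w q) = eigvec m n q u * of_real (eigval m n a b z q)"
      using q fin by (simp add: if_distrib[of "\<lambda>c. _ * c"] cong: if_cong)
    then show "(\<Sum>w\<in>?V. kast a b z u w * (\<Sum>v\<in>?V. kast (- a) (- b) z w v * eigvec m n q v)) = (\<Sum>w\<in>?V. ?U u w * ?D w q)"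
      unfolding kast_kast_eigvec[OF u] by simp
  qed
  also have "\<dots> = set_det ?V ?U * set_det ?V ?D" by (rule sdet_mult[OF fin])
  also have "set_det ?V ?D = (\<Prod>q\<in>?V. of_real (eigval m n a b z q))"
    by (subst sdet_diagonal[OF fin]) auto
  finally have "complex_of_real (grid_Z m n a b z) * of_real (grid_Z m n a b z) = of_real (\<Prod>q\<in>?V. eigval m n a b z q)"
    using sdet_eigvec_nonzero[of m n] by (simp add: mult_ac)
  then show ?thesis unfolding of_real_mult[symmetric] of_real_eq_iff by (simp add: power2_eq_square)
qed

text \<open>The sign of \<open>grid_Z\<close> is irrelevant because \<open>ln (- x) = ln x\<close> in HOL.\<close>
corollary ln_grid_Z:
  assumes "z \<noteq> 0"
  shows "ln (grid_Z m n a b z) = (\<Sum>x = 1..m. \<Sum>y = 1..n. ln (eigval m n a b z (x, y))) / 2"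
proof -
  have pos: "eigval m n a b z q > 0" for q
    using assms by (simp add: eigval_def add_pos_nonneg)
  have "(grid_Z m n a b z)\<^sup>2 > 0" unfolding grid_Z_square using pos by (intro prod_pos) auto
  then have "grid_Z m n a b z \<noteq> 0" by auto
  then have "ln ((grid_Z m n a b z)\<^sup>2) = 2 * ln (grid_Z m n a b z)"
    using ln_realpow[of "grid_Z m n a b z" 2] by simp
  moreover have "ln ((grid_Z m n a b z)\<^sup>2) = (\<Sum>q\<in>grid_verts m n. ln (eigval m n a b z q))"
    unfolding grid_Z_square
    by (rule ln_prod) (simp add: grid_verts_def, rule less_imp_neq[OF pos, symmetric])
  moreover have "\<dots> = (\<Sum>x = 1..m. \<Sum>y = 1..n. ln (eigval m n a b z (x, y)))"
    unfolding grid_verts_def sum.cartesian_product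
    by (intro sum.cong refl) (simp add: split_beta)
  ultimately show ?thesis by linarith
qed

section \<open>The thermodynamic limit\<close>

lemma lipschitz_abs_continuous_on:
  fixes h :: "real \<Rightarrow> real"
  assumes "\<And>s t. \<bar>h s - h t\<bar> \<le> L * \<bar>s - t\<bar>"
  shows "continuous_on S h"
proof -
  have "L * \<bar>1 - 0\<bar> \<ge> 0" using assms[of 1 0] by (meson abs_ge_zero order_trans)
  then have "L-lipschitz_on S h"
    using assms by (intro lipschitz_onI) (auto simp: dist_real_def)
  then show ?thesis by (rule lipschitz_on_continuous_on)
qed

lemma left_rectangle_error:
  fixes h :: "real \<Rightarrow> real"
  assumes lip: "\<And>s t. \<bar>h s - h t\<bar> \<le> L * \<bar>s - t\<bar>" and "\<delta> \<ge> 0"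
  shows "\<bar>integral {c..c + \<delta>} h - \<delta> * h c\<bar> \<le> L * \<delta> * \<delta>"
proof -
  have int: "h integrable_on {c..c + \<delta>}"
    by (intro integrable_continuous_real lipschitz_abs_continuous_on[OF lip])
  have "((\<lambda>s. h s - h c) has_integral (integral {c..c + \<delta>} h - \<delta> * h c)) {c..c + \<delta>}"
    using has_integral_diff[OF integrable_integral[OF int] has_integral_const_real[of "h c" c "c + \<delta>"]] assms(2)
    by simp
  moreover have "L * \<bar>1 - 0\<bar> \<ge> 0" using lip[of 1 0] by (meson abs_ge_zero order_trans)
  then have "0 \<le> L" by simp
  moreover have "\<bar>h s - h c\<bar> \<le> L * \<delta>" if "s \<in> {c..c + \<delta>}" for s
  proof -
    have "L * \<bar>s - c\<bar> \<le> L * \<delta>" using that \<open>0 \<le> L\<close> by (intro mult_left_mono) auto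
    then show ?thesis using lip[of s c] by linarith
  qed
  ultimately have "norm (integral {c..c + \<delta>} h - \<delta> * h c) \<le> (L * \<delta>) * measure lborel (cbox c (c + \<delta>))"
    using assms(2) by (intro has_integral_bound[where f = "\<lambda>s. h s - h c"]) auto
  then show ?thesis using assms(2) by simp
qed

lemma left_riemann_sum_error:
  fixes h :: "real \<Rightarrow> real"
  assumes lip: "\<And>s t. \<bar>h s - h t\<bar> \<le> L * \<bar>s - t\<bar>" and \<delta>: "\<delta> \<ge> 0"
  shows "\<bar>integral {0..real k * \<delta>} h - \<delta> * (\<Sum>x<k. h (real x * \<delta>))\<bar> \<le> real k * (L * \<delta> * \<delta>)"
proof (induction k)
  case (Suc k)
  have e: "real (Suc k) * \<delta> = real k * \<delta> + \<delta>" by (simp add: algebra_simps)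
  have "integral {0..real k * \<delta>} h + integral {real k * \<delta>..real k * \<delta> + \<delta>} h = integral {0..real k * \<delta> + \<delta>} h"
    using \<delta> by (intro Henstock_Kurzweil_Integration.integral_combine integrable_continuous_real
        lipschitz_abs_continuous_on[OF lip]) auto
  moreover have "\<delta> * (\<Sum>x<Suc k. h (real x * \<delta>)) = \<delta> * (\<Sum>x<k. h (real x * \<delta>)) + \<delta> * h (real k * \<delta>)"
    by (simp add: distrib_left)
  moreover have "real (Suc k) * (L * \<delta> * \<delta>) = real k * (L * \<delta> * \<delta>) + L * \<delta> * \<delta>"
    by (simp only: of_nat_Suc distrib_right mult_1)
  ultimately show ?case
    unfolding e using Suc left_rectangle_error[OF lip \<delta>, of "real k * \<delta>"] by linarith
qed simp

text \<open>Compared with the left Riemann sum of mesh \<open>pi / (m + 1)\<close>, the sum lacks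
  the endpoint \<open>0\<close> and is divided by \<open>m\<close> in place of \<open>m + 1\<close>.
  Each of these defects costs at most \<open>M / (m + 1)\<close>.\<close>

lemma interior_riemann_sum_error:
  fixes h :: "real \<Rightarrow> real"
  assumes lip: "\<And>s t. \<bar>h s - h t\<bar> \<le> L * \<bar>s - t\<bar>" and bd: "\<And>s. \<bar>h s\<bar> \<le> M" and m: "m > 0"
  shows "\<bar>(\<Sum>x = 1..m. h (pi * real x / real (m + 1))) / real m - integral {0..pi} h / pi\<bar>
     \<le> (L * pi + 2 * M) / real (m + 1)"
proof -
  define N where "N = real (m + 1)"
  define \<delta> where "\<delta> = pi / N"
  define S where "S = (\<Sum>x = 1..m. h (pi * real x / real (m + 1)))"
  have N: "N > 0" "N = real m + 1" by (simp_all add: N_def)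
  have M: "M \<ge> 0" using bd[of 0] by linarith
  have "{..<m + 1} = insert 0 {1..m}" by auto
  then have "(\<Sum>x<m + 1. h (real x * \<delta>)) = h 0 + S"
    by (simp add: S_def \<delta>_def N_def mult.commute)
  moreover have "real (m + 1) * \<delta> = pi" using N by (simp add: \<delta>_def N_def)
  moreover have "\<delta> \<ge> 0" using N by (simp add: \<delta>_def)
  ultimately have 1: "\<bar>integral {0..pi} h - \<delta> * (h 0 + S)\<bar> \<le> pi * (L * \<delta>)"
    using left_riemann_sum_error[OF lip, of \<delta> "m + 1"] by (simp add: mult_ac)
  have "\<bar>S\<bar> \<le> (\<Sum>x = 1..m. M)"
    unfolding S_def using bd by (intro order_trans[OF sum_abs] sum_mono)
  then have S: "\<bar>S\<bar> \<le> real m * M" by simp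
  have "S * N = S * real m + S" unfolding N(2) by (simp add: distrib_left)
  moreover have "S / real m = (S * N) / (real m * N)" using N(1) by simp
  ultimately have "S / real m = S / N + S / (real m * N)"
    using m by (simp add: add_divide_distrib)
  moreover have "(\<delta> * (h 0 + S) - integral {0..pi} h) / pi = h 0 / N + S / N - integral {0..pi} h / pi"
    by (simp add: \<delta>_def diff_divide_distrib add_divide_distrib)
  moreover have "\<bar>(\<delta> * (h 0 + S) - integral {0..pi} h) / pi\<bar> \<le> L * \<delta>"
    using 1 by (simp add: abs_minus_commute field_simps)
  moreover have "\<bar>h 0 / N\<bar> \<le> M / N" using bd[of 0] N by (simp add: divide_right_mono)
  moreover have "\<bar>S / (real m * N)\<bar> \<le> M / N"
  proof -
    have "\<bar>S / (real m * N)\<bar> = \<bar>S\<bar> / (real m * N)" using N by (simp add: abs_mult)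
    also have "\<dots> \<le> (real m * M) / (real m * N)" using S N by (intro divide_right_mono) auto
    finally show ?thesis using m by simp
  qed
  moreover have "\<bar>W - J\<bar> \<le> A + B + B"
    if "W = Q + R" "E = H + Q - J" "\<bar>E\<bar> \<le> A" "\<bar>H\<bar> \<le> B" "\<bar>R\<bar> \<le> B" for W J Q R E H A B :: real
    using that by linarith
  ultimately have "\<bar>S / real m - integral {0..pi} h / pi\<bar> \<le> L * \<delta> + M / N + M / N" by blast
  also have "\<dots> = (L * pi + 2 * M) / N" by (simp add: \<delta>_def add_divide_distrib)
  finally show ?thesis unfolding S_def N_def .
qed

text \<open>The inner mean \<open>G\<close> inherits the bound and the Lipschitz constant of
  \<open>g\<close>, so the one-dimensional estimate applies in each variable with the same
  constant.\<close>

lemma double_riemann_sum_error: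
  fixes g :: "real \<Rightarrow> real \<Rightarrow> real"
  assumes lip1: "\<And>s s' t. \<bar>g s t - g s' t\<bar> \<le> L * \<bar>s - s'\<bar>"
    and lip2: "\<And>s t t'. \<bar>g s t - g s t'\<bar> \<le> L * \<bar>t - t'\<bar>"
    and bd: "\<And>s t. \<bar>g s t\<bar> \<le> M" and mn: "m > 0" "n > 0"
  shows "\<bar>(\<Sum>x = 1..m. \<Sum>y = 1..n. g (pi * real x / real (m + 1)) (pi * real y / real (n + 1))) / (real m * real n)
      - integral {0..pi} (\<lambda>s. integral {0..pi} (g s)) / pi\<^sup>2\<bar>
    \<le> (L * pi + 2 * M) / real (m + 1) + (L * pi + 2 * M) / real (n + 1)"
proof -
  define G where "G s = integral {0..pi} (g s) / pi" for s
  let ?C = "L * pi + 2 * M"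
  let ?s = "\<lambda>x. pi * real x / real (m + 1)"
  let ?A = "\<lambda>s. (\<Sum>y = 1..n. g s (pi * real y / real (n + 1))) / real n"
  have int: "g s integrable_on {0..pi}" for s
    by (intro integrable_continuous_real lipschitz_abs_continuous_on[OF lip2])
  have "\<bar>G s - G s'\<bar> \<le> L * \<bar>s - s'\<bar>" for s s'
  proof -
    have "0 \<le> L * \<bar>s - s'\<bar>" using lip1[of s 0 s'] by linarith
    then have "norm (integral {0..pi} (g s) - integral {0..pi} (g s')) \<le> (L * \<bar>s - s'\<bar>) * measure lborel (cbox 0 pi)"
      using lip1 int by (intro has_integral_bound[where f = "\<lambda>t. g s t - g s' t"])
        (auto intro!: has_integral_diff integrable_integral)
    then show ?thesis by (simp add: G_def field_simps flip: diff_divide_distrib)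
  qed
  moreover have "\<bar>G s\<bar> \<le> M" for s
  proof -
    have "0 \<le> M" using bd[of 0 0] by linarith
    then have "norm (integral {0..pi} (g s)) \<le> M * measure lborel (cbox 0 pi)"
      using bd int by (intro has_integral_bound[where f = "g s"]) (auto intro: integrable_integral)
    then show ?thesis by (simp add: G_def field_simps)
  qed
  ultimately have 1: "\<bar>(\<Sum>x = 1..m. G (?s x)) / real m - integral {0..pi} G / pi\<bar> \<le> ?C / real (m + 1)"
    by (rule interior_riemann_sum_error) (rule mn)
  have A: "\<bar>?A s - G s\<bar> \<le> ?C / real (n + 1)" for s
    unfolding G_def by (rule interior_riemann_sum_error[OF lip2 bd mn(2)])
  have "\<bar>(\<Sum>x = 1..m. ?A (?s x)) - (\<Sum>x = 1..m. G (?s x))\<bar> \<le> (\<Sum>x = 1..m. ?C / real (n + 1))"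
    unfolding sum_subtractf[symmetric] by (intro order_trans[OF sum_abs] sum_mono A)
  then have "\<bar>(\<Sum>x = 1..m. ?A (?s x)) - (\<Sum>x = 1..m. G (?s x))\<bar> / real m \<le> (real m * (?C / real (n + 1))) / real m"
    by (intro divide_right_mono) simp_all
  then have 2: "\<bar>(\<Sum>x = 1..m. ?A (?s x)) / real m - (\<Sum>x = 1..m. G (?s x)) / real m\<bar> \<le> ?C / real (n + 1)"
    using mn by (simp flip: diff_divide_distrib)
  have 3: "integral {0..pi} G / pi = integral {0..pi} (\<lambda>s. integral {0..pi} (g s)) / pi\<^sup>2"
    unfolding G_def by (simp add: power2_eq_square)
  have 4: "(\<Sum>x = 1..m. \<Sum>y = 1..n. g (?s x) (pi * real y / real (n + 1))) / (real m * real n)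
      = (\<Sum>x = 1..m. ?A (?s x)) / real m"
    by (simp add: sum_divide_distrib mult.commute)
  show ?thesis unfolding 3[symmetric] 4 using 1 2 by linarith
qed

section \<open>Convergence of the finite free energies\<close>

lemma abs_cos_square_diff: "\<bar>(cos s)\<^sup>2 - (cos t)\<^sup>2\<bar> \<le> 2 * \<bar>s - t\<bar>" for s t :: real
proof -
  have "\<bar>cos s - cos t\<bar> = 2 * (\<bar>sin ((s + t) / 2)\<bar> * \<bar>sin ((t - s) / 2)\<bar>)"
    by (simp add: cos_diff_cos abs_mult)
  also have "\<dots> \<le> 2 * (1 * \<bar>(t - s) / 2\<bar>)"
    by (intro mult_left_mono mult_mono abs_sin_x_le_abs_x abs_sin_le_one) auto
  finally have 1: "\<bar>cos s - cos t\<bar> \<le> \<bar>s - t\<bar>" by simp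
  have 2: "\<bar>cos s + cos t\<bar> \<le> 2" using abs_cos_le_one[of s] abs_cos_le_one[of t] by linarith
  have "\<bar>(cos s)\<^sup>2 - (cos t)\<^sup>2\<bar> = \<bar>cos s + cos t\<bar> * \<bar>cos s - cos t\<bar>"
    by (simp add: power2_eq_square square_diff_square_factored abs_mult)
  also have "\<dots> \<le> 2 * \<bar>s - t\<bar>" by (intro mult_mono 1 2) auto
  finally show ?thesis .
qed

text \<open>The eigenvalues with the angles as continuous variables:
  \<open>eigval m n a b z (x, y)\<close> is the value at \<open>s = pi * x / (m + 1)\<close> and
  \<open>t = pi * y / (n + 1)\<close>.\<close>

definition symbol :: "real \<Rightarrow> real \<Rightarrow> real \<Rightarrow> real \<Rightarrow> real \<Rightarrow> real" where
  "symbol a b z s t = z\<^sup>2 + (b * (2 * cos s))\<^sup>2 + (a * (2 * cos t))\<^sup>2"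

lemma symbol_ge: "z\<^sup>2 \<le> symbol a b z s t"
  by (simp add: symbol_def)

lemma symbol_le: "symbol a b z s t \<le> z\<^sup>2 + 4 * b\<^sup>2 + 4 * a\<^sup>2"
proof -
  have "(cos x)\<^sup>2 \<le> 1" for x :: real by (simp add: cos_squared_eq)
  from mult_left_mono[OF this, of "4 * b\<^sup>2" s] mult_left_mono[OF this, of "4 * a\<^sup>2" t]
  show ?thesis by (simp add: symbol_def power_mult_distrib)
qed

lemma abs_ln_diff_le:
  fixes x y c :: real
  assumes "c > 0" "c \<le> x" "c \<le> y"
  shows "\<bar>ln x - ln y\<bar> \<le> \<bar>x - y\<bar> / c"
proof -
  have *: "ln p - ln q \<le> \<bar>p - q\<bar> / c" if "c \<le> p" "c \<le> q" for p q
  proof -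
    have "ln p - ln q = ln (p / q)" using that assms(1) by (simp add: ln_div)
    also have "\<dots> \<le> p / q - 1" using that assms(1) by (intro ln_le_minus_one) simp
    also have "\<dots> = (p - q) / q" using that assms(1) by (simp add: diff_divide_distrib)
    also have "\<dots> \<le> \<bar>p - q\<bar> / q" using that assms(1) by (intro divide_right_mono) auto
    also have "\<dots> \<le> \<bar>p - q\<bar> / c" using that assms(1) by (intro divide_left_mono) auto
    finally show ?thesis .
  qed
  show ?thesis using *[OF assms(2,3)] *[OF assms(3,2)] by (simp add: abs_le_iff abs_minus_commute)
qed

text \<open>Division by \<open>pi^2\<close> takes the mean over the square of angles; the further
  factor \<open>2\<close> comes from the square in \<open>grid_Z_square\<close>.\<close>

definition energy_integral :: "real \<Rightarrow> real \<Rightarrow> real \<Rightarrow> real" where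
  "energy_integral a b z =
     integral {0..pi} (\<lambda>s. integral {0..pi} (\<lambda>t. ln (symbol a b z s t))) / (2 * pi\<^sup>2)"

text \<open>Limits along a nontrivial filter are unique, which \<open>Lim\<close> requires in order
  to return the limit.\<close>

lemma even_pairs_at_top_neq_bot: "even_pairs_at_top \<noteq> bot"
proof
  assume "even_pairs_at_top = bot"
  then have "eventually (\<lambda>_. False) even_pairs_at_top" by simp
  then have "\<forall>\<^sub>F p in sequentially \<times>\<^sub>F sequentially. \<not> (even (fst p) \<and> even (snd p))"
    unfolding even_pairs_at_top_def eventually_inf_principal by (rule eventually_mono) auto
  then obtain P where "eventually P sequentially"
    and P: "\<And>x y. P x \<Longrightarrow> P y \<Longrightarrow> \<not> (even x \<and> even y)"
    by (auto simp: eventually_prod_same)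
  then obtain k where "P (2 * k)"
    by (metis eventually_sequentially le_add1 mult_2)
  then show False using P[of "2 * k" "2 * k"] by simp
qed

text \<open>The bound tends to 0 along the product filter, that is jointly in both indices, and the
  filter of even pairs is finer than that.\<close>

lemma tendsto_even_pairs:
  fixes f :: "nat \<times> nat \<Rightarrow> real"
  assumes "\<And>m n. m > 0 \<Longrightarrow> n > 0 \<Longrightarrow> \<bar>f (m, n) - l\<bar> \<le> C / real (m + 1) + C / real (n + 1)"
  shows "(f \<longlongrightarrow> l) even_pairs_at_top"
proof -
  let ?F = "sequentially \<times>\<^sub>F sequentially"
  have 0: "(\<lambda>m. C / real (m + 1)) \<longlonglongrightarrow> 0"
    using LIMSEQ_Suc[OF lim_const_over_n[of C]] unfolding Suc_eq_plus1 .
  have "((\<lambda>p. C / real (fst p + 1) + C / real (snd p + 1)) \<longlongrightarrow> 0 + 0) ?F"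
    by (rule tendsto_add[OF filterlim_compose[OF 0 filterlim_fst] filterlim_compose[OF 0 filterlim_snd]])
  then have "((\<lambda>p. C / real (fst p + 1) + C / real (snd p + 1)) \<longlongrightarrow> 0) ?F"
    unfolding add_0 .
  moreover have "\<forall>\<^sub>F p in ?F. norm (f p - l) \<le> C / real (fst p + 1) + C / real (snd p + 1)"
  proof -
    have "\<forall>\<^sub>F p in ?F. fst p > 0 \<and> snd p > (0 :: nat)"
      by (rule eventually_conj[OF eventually_compose_filterlim[OF eventually_gt_at_top filterlim_fst]
            eventually_compose_filterlim[OF eventually_gt_at_top filterlim_snd]])
    then show ?thesis
    proof (rule eventually_mono)
      fix p :: "nat \<times> nat" assume "fst p > 0 \<and> snd p > 0"
      then show "norm (f p - l) \<le> C / real (fst p + 1) + C / real (snd p + 1)"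
        using assms[of "fst p" "snd p"] by simp
    qed
  qed
  ultimately have "((\<lambda>p. f p - l) \<longlongrightarrow> 0) ?F" by (rule Lim_null_comparison[rotated])
  then have "(f \<longlongrightarrow> l) ?F" by (rule LIM_zero_cancel)
  then show ?thesis unfolding even_pairs_at_top_def by (rule tendsto_mono[rotated]) simp
qed

text \<open>Since \<open>z\<close> is not 0, the symbol is bounded below by \<open>z^2 > 0\<close>,
  and so its logarithm is bounded and Lipschitz.\<close>

lemma finite_free_energy_error:
  assumes z: "z \<noteq> 0"
  shows "\<exists>C. \<forall>m n. m > 0 \<longrightarrow> n > 0 \<longrightarrow>
    \<bar>finite_free_energy a b z (m, n) - energy_integral a b z\<bar> \<le> C / real (m + 1) + C / real (n + 1)"
proof -
  define g where "g s t = ln (symbol a b z s t)" for s t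
  \<comment> \<open>The sum of the Lipschitz constants in the two variables: \<open>4 * b^2\<close>
    or \<open>4 * a^2\<close> from the symbol, \<open>2\<close> from the squared cosine,
    \<open>1 / z^2\<close> from the logarithm.\<close>
  define L where "L = (8 * a\<^sup>2 + 8 * b\<^sup>2) / z\<^sup>2"
  define M where "M = \<bar>ln (z\<^sup>2)\<bar> + \<bar>ln (z\<^sup>2 + 4 * b\<^sup>2 + 4 * a\<^sup>2)\<bar>"
  have z2: "z\<^sup>2 > 0" using z by simp
  have lip: "\<bar>g s t - g s' t'\<bar> \<le> (8 * c) / z\<^sup>2 * \<bar>r - r'\<bar>"
    if "\<bar>symbol a b z s t - symbol a b z s' t'\<bar> = 4 * c * \<bar>(cos r)\<^sup>2 - (cos r')\<^sup>2\<bar>" "c \<ge> 0" for s t s' t' r r' c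
  proof -
    have "\<bar>g s t - g s' t'\<bar> \<le> \<bar>symbol a b z s t - symbol a b z s' t'\<bar> / z\<^sup>2"
      unfolding g_def by (rule abs_ln_diff_le[OF z2 symbol_ge symbol_ge])
    also have "\<dots> \<le> (4 * c * (2 * \<bar>r - r'\<bar>)) / z\<^sup>2"
      unfolding that(1) using that(2) by (intro divide_right_mono mult_left_mono abs_cos_square_diff) auto
    finally show ?thesis by simp
  qed
  have le_L: "(8 * c) / z\<^sup>2 * \<bar>r\<bar> \<le> L * \<bar>r\<bar>" if "c \<le> a\<^sup>2 + b\<^sup>2" for c r
    unfolding L_def using that by (intro mult_right_mono divide_right_mono) auto
  have lip1: "\<bar>g s t - g s' t\<bar> \<le> L * \<bar>s - s'\<bar>" for s s' t
  proof -
    have "symbol a b z s t - symbol a b z s' t = 4 * b\<^sup>2 * ((cos s)\<^sup>2 - (cos s')\<^sup>2)"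
      by (simp add: symbol_def power_mult_distrib algebra_simps)
    then have "\<bar>symbol a b z s t - symbol a b z s' t\<bar> = 4 * b\<^sup>2 * \<bar>(cos s)\<^sup>2 - (cos s')\<^sup>2\<bar>"
      by (simp add: abs_mult)
    from order_trans[OF lip[OF this zero_le_power2] le_L] show ?thesis by simp
  qed
  have lip2: "\<bar>g s t - g s t'\<bar> \<le> L * \<bar>t - t'\<bar>" for s t t'
  proof -
    have "symbol a b z s t - symbol a b z s t' = 4 * a\<^sup>2 * ((cos t)\<^sup>2 - (cos t')\<^sup>2)"
      by (simp add: symbol_def power_mult_distrib algebra_simps)
    then have "\<bar>symbol a b z s t - symbol a b z s t'\<bar> = 4 * a\<^sup>2 * \<bar>(cos t)\<^sup>2 - (cos t')\<^sup>2\<bar>"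
      by (simp add: abs_mult)
    from order_trans[OF lip[OF this zero_le_power2] le_L] show ?thesis by simp
  qed
  have bd: "\<bar>g s t\<bar> \<le> M" for s t
  proof -
    have pos: "symbol a b z s t > 0" using symbol_ge z2 by (rule less_le_trans[rotated])
    have "ln (z\<^sup>2) \<le> g s t" "g s t \<le> ln (z\<^sup>2 + 4 * b\<^sup>2 + 4 * a\<^sup>2)"
      unfolding g_def using z2 pos symbol_ge[of z a b s t] symbol_le[of a b z s t]
      by (simp_all only: ln_mono)
    then show ?thesis unfolding M_def by linarith
  qed
  have "\<bar>finite_free_energy a b z (m, n) - energy_integral a b z\<bar>
      \<le> ((L * pi + 2 * M) / 2) / real (m + 1) + ((L * pi + 2 * M) / 2) / real (n + 1)"
    if "m > 0" "n > 0" for m n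
  proof -
    define R where "R = (\<Sum>x = 1..m. \<Sum>y = 1..n. g (pi * real x / real (m + 1)) (pi * real y / real (n + 1)))"
    have ln: "ln (grid_Z m n a b z) = R / 2"
      unfolding R_def ln_grid_Z[OF z] g_def symbol_def eigval_def freq_def fst_conv snd_conv ..
    have "1 / (p * q) * (r / 2) = r / (p * q) / 2" for p q r :: real by simp
    then have 1: "finite_free_energy a b z (m, n) = R / (real m * real n) / 2"
      unfolding finite_free_energy_def split_conv ln .
    have 2: "energy_integral a b z = integral {0..pi} (\<lambda>s. integral {0..pi} (g s)) / pi\<^sup>2 / 2"
      unfolding energy_integral_def g_def by simp
    have "\<bar>A / 2 - B / 2\<bar> \<le> c / 2 / p + c / 2 / q" if "\<bar>A - B\<bar> \<le> c / p + c / q" for A B c p q :: real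
    proof -
      have "c / 2 / p + c / 2 / q = (c / p + c / q) / 2" by (simp add: add_divide_distrib)
      then show ?thesis using that by linarith
    qed
    from this[OF double_riemann_sum_error[OF lip1 lip2 bd that]] show ?thesis
      unfolding 1 2 unfolding R_def .
  qed
  then show ?thesis by blast
qed

lemma finite_free_energy_tendsto:
  assumes "z \<noteq> 0"
  shows "(finite_free_energy a b z \<longlongrightarrow> energy_integral a b z) even_pairs_at_top"
  using finite_free_energy_error[OF assms, of a b] tendsto_even_pairs by blast

lemma free_energy_eq: "z \<noteq> 0 \<Longrightarrow> free_energy a b z = energy_integral a b z"
  unfolding free_energy_def
  by (rule tendsto_Lim[OF even_pairs_at_top_neq_bot finite_free_energy_tendsto])

section \<open>Elliptic integrals\<close>

text \<open>The smooth branch of \<open>arctan (\<kappa> * tan x)\<close> that fixes \<open>0\<close>, \<open>pi / 2\<close> and \<open>pi\<close>.\<close>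
definition twist :: "real \<Rightarrow> real \<Rightarrow> real" where
  "twist \<kappa> x = x + arctan ((\<kappa> - 1) * (sin x * cos x) / ((cos x)\<^sup>2 + \<kappa> * (sin x)\<^sup>2))"

lemma cos_sin_pos:
  assumes "\<kappa> > 0"
  shows "(cos x)\<^sup>2 + \<kappa> * (sin x)\<^sup>2 > (0 :: real)"
proof (cases "cos x = 0")
  case True
  then have "sin x \<noteq> 0" using sin_cos_squared_add[of x] by auto
  then show ?thesis using assms True by simp
next
  case False
  then show ?thesis using assms by (intro add_pos_nonneg) auto
qed

text \<open>With \<open>t = tan x\<close>, the tangent of \<open>arctan (\<kappa> * t) - x\<close>
  is \<open>(\<kappa> - 1) * t / (1 + \<kappa> * t^2)\<close>, the argument of \<open>arctan\<close>
  in \<open>twist\<close>. After clearing the cosines its denominator never vanishes, so the formula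
  crosses the pole of the tangent smoothly.\<close>

lemma twist_deriv:
  assumes "\<kappa> > 0"
  shows "(twist \<kappa> has_real_derivative \<kappa> / ((cos x)\<^sup>2 + \<kappa>\<^sup>2 * (sin x)\<^sup>2)) (at x within S)"
proof -
  define c s where "c = cos x" and "s = sin x"
  have cs: "c\<^sup>2 = 1 - s\<^sup>2" by (simp add: c_def s_def cos_squared_eq)
  define D where "D = c\<^sup>2 + \<kappa> * s\<^sup>2"
  define N where "N = (\<kappa> - 1) * (s * c)"
  have D: "D > 0" using cos_sin_pos[OF assms, of x] by (simp add: D_def c_def s_def)
  have D2: "c\<^sup>2 + \<kappa>\<^sup>2 * s\<^sup>2 > 0" using cos_sin_pos[of "\<kappa>\<^sup>2" x] assms by (simp add: c_def s_def)
  define N' where "N' = (\<kappa> - 1) * (c\<^sup>2 - s\<^sup>2)"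
  define D' where "D' = 2 * (\<kappa> - 1) * (s * c)"
  have sum: "D\<^sup>2 + N\<^sup>2 = c\<^sup>2 + \<kappa>\<^sup>2 * s\<^sup>2"
    unfolding D_def N_def power_mult_distrib cs by Groebner_Basis.algebra
  have num: "(N' * D - N * D') + (c\<^sup>2 + \<kappa>\<^sup>2 * s\<^sup>2) = \<kappa>"
    unfolding D_def N_def D'_def N'_def using cs by Groebner_Basis.algebra
  define q where "q x = (\<kappa> - 1) * (sin x * cos x) / ((cos x)\<^sup>2 + \<kappa> * (sin x)\<^sup>2)" for x
  have q: "q x = N / D" by (simp add: q_def N_def D_def c_def s_def)
  have dq: "(q has_real_derivative (N' * D - N * D') / D\<^sup>2) (at x within S)"
    using D unfolding q_def D_def N_def D'_def N'_def c_def s_def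
    by (auto intro!: derivative_eq_intros simp: power2_eq_square field_simps)
  have "((\<lambda>x. x + arctan (q x)) has_real_derivative
      1 + (N' * D - N * D') / D\<^sup>2 / (1 + (N / D)\<^sup>2)) (at x within S)"
    unfolding q[symmetric] by (rule derivative_eq_intros dq refl)+ (simp add: divide_inverse mult.commute)
  then have "(twist \<kappa> has_real_derivative 1 + (N' * D - N * D') / D\<^sup>2 / (1 + (N / D)\<^sup>2)) (at x within S)"
    by (simp only: twist_def[abs_def] q_def)
  moreover have "1 + (N' * D - N * D') / D\<^sup>2 / (1 + (N / D)\<^sup>2) = \<kappa> / (c\<^sup>2 + \<kappa>\<^sup>2 * s\<^sup>2)"
  proof -
    have "1 + (N / D)\<^sup>2 = (c\<^sup>2 + \<kappa>\<^sup>2 * s\<^sup>2) / D\<^sup>2"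
      using D by (simp add: power_divide add_divide_distrib flip: sum)
    then have "(N' * D - N * D') / D\<^sup>2 / (1 + (N / D)\<^sup>2) = (N' * D - N * D') / (c\<^sup>2 + \<kappa>\<^sup>2 * s\<^sup>2)"
      using D by simp
    then have "1 + (N' * D - N * D') / D\<^sup>2 / (1 + (N / D)\<^sup>2) =
        ((N' * D - N * D') + (c\<^sup>2 + \<kappa>\<^sup>2 * s\<^sup>2)) / (c\<^sup>2 + \<kappa>\<^sup>2 * s\<^sup>2)"
      using D2 by (simp add: add_divide_distrib)
    then show ?thesis unfolding num .
  qed
  ultimately show ?thesis by (simp add: c_def s_def)
qed

lemma twist_values [simp]: "twist \<kappa> 0 = 0" "twist \<kappa> (pi / 2) = pi / 2" "twist \<kappa> pi = pi"
  by (simp_all add: twist_def)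

lemma twist_tan:
  assumes "\<kappa> > 0" "0 \<le> x" "x < pi / 2"
  shows "tan (twist \<kappa> x) = \<kappa> * tan x" "cos (twist \<kappa> x) \<noteq> 0"
proof -
  define c s where "c = cos x" and "s = sin x"
  have cs: "c\<^sup>2 + s\<^sup>2 = 1" by (simp add: c_def s_def)
  have c: "c > 0" unfolding c_def using assms by (intro cos_gt_zero_pi) auto
  define D where "D = c\<^sup>2 + \<kappa> * s\<^sup>2"
  define N where "N = (\<kappa> - 1) * (s * c)"
  have D: "D > 0" using cos_sin_pos[OF assms(1), of x] by (simp add: D_def c_def s_def)
  define y where "y = arctan (N / D)"
  have tw: "twist \<kappa> x = x + y" by (simp add: twist_def y_def N_def D_def c_def s_def)
  have cy: "cos y > 0" unfolding y_def using arctan_bounded[of "N / D"] by (intro cos_gt_zero_pi) auto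
  have ty: "tan y = N / D" by (simp add: y_def tan_arctan)
  then have sy: "sin y = N / D * cos y" using cy by (simp add: tan_def field_simps)
  have e1: "cos (x + y) * D = c * cos y"
  proof -
    have "cos (x + y) * D = (c * D - s * N) * cos y"
      using D by (simp add: cos_add sy c_def[symmetric] s_def[symmetric] field_simps)
    also have "c * D - s * N = c" unfolding D_def N_def using cs by Groebner_Basis.algebra
    finally show ?thesis .
  qed
  have e2: "sin (x + y) * D = \<kappa> * s * cos y"
  proof -
    have "sin (x + y) * D = (s * D + c * N) * cos y"
      using D by (simp add: sin_add sy c_def[symmetric] s_def[symmetric] field_simps)
    also have "s * D + c * N = \<kappa> * s" unfolding D_def N_def using cs by Groebner_Basis.algebra
    finally show ?thesis .
  qed
  have "cos (x + y) * D > 0" unfolding e1 using c cy by simp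
  then have cp: "cos (x + y) \<noteq> 0" by auto
  then show "cos (twist \<kappa> x) \<noteq> 0" by (simp add: tw)
  have "tan (x + y) = (sin (x + y) * D) / (cos (x + y) * D)" using D by (simp add: tan_def)
  also have "\<dots> = \<kappa> * s / c" unfolding e1 e2 using cy by simp
  finally show "tan (twist \<kappa> x) = \<kappa> * tan x" by (simp add: tw tan_def c_def s_def)
qed

text \<open>For \<open>\<kappa>^2 = C / (C + r)\<close> one has
  \<open>C + r * cos^2 = (C + r) * (cos^2 + \<kappa>^2 * sin^2)\<close>, so the integrand is a
  multiple of the derivative of \<open>twist \<kappa>\<close>, which grows by \<open>pi\<close> over
  \<open>[0, pi]\<close>.\<close>

lemma has_integral_inverse_cos_square:
  assumes "C > 0" "r \<ge> 0"
  shows "((\<lambda>t. 1 / (C + r * (cos t)\<^sup>2)) has_integral pi / sqrt (C * (C + r))) {0..pi}"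
proof -
  define \<kappa> where "\<kappa> = sqrt (C / (C + r))"
  have \<kappa>: "\<kappa> > 0" "\<kappa>\<^sup>2 = C / (C + r)" using assms by (auto simp: \<kappa>_def)
  have "((\<lambda>t. \<kappa> / ((cos t)\<^sup>2 + \<kappa>\<^sup>2 * (sin t)\<^sup>2)) has_integral (twist \<kappa> pi - twist \<kappa> 0)) {0..pi}"
    using twist_deriv[OF \<kappa>(1)]
    by (intro fundamental_theorem_of_calculus) (auto simp: has_real_derivative_iff_has_vector_derivative[symmetric])
  then have "((\<lambda>t. (1 / (\<kappa> * (C + r))) * (\<kappa> / ((cos t)\<^sup>2 + \<kappa>\<^sup>2 * (sin t)\<^sup>2))) has_integral (1 / (\<kappa> * (C + r))) * pi) {0..pi}"
    by (intro has_integral_mult_right) simp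
  moreover have "(1 / (\<kappa> * (C + r))) * (\<kappa> / ((cos t)\<^sup>2 + \<kappa>\<^sup>2 * (sin t)\<^sup>2)) = 1 / (C + r * (cos t)\<^sup>2)" for t
  proof -
    have "(C + r) * ((cos t)\<^sup>2 + \<kappa>\<^sup>2 * (sin t)\<^sup>2) = C + r * (cos t)\<^sup>2"
      unfolding \<kappa>(2) sin_squared_eq using assms by (simp add: field_simps)
    then show ?thesis using \<kappa>(1) by (simp add: mult.assoc)
  qed
  moreover have "\<kappa> * (C + r) = sqrt (C * (C + r))"
  proof (rule real_sqrt_unique[symmetric])
    have "(\<kappa> * (C + r))\<^sup>2 = C / (C + r) * (C + r)\<^sup>2" unfolding power_mult_distrib \<kappa>(2) ..
    then show "(\<kappa> * (C + r))\<^sup>2 = C * (C + r)"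
      using assms by (simp add: power2_eq_square)
    show "0 \<le> \<kappa> * (C + r)" using \<kappa> assms by simp
  qed
  ultimately show ?thesis by simp
qed

section \<open>Legendre's Delta, and Heuman's function as a single integral\<close>

definition ell_delta :: "real \<Rightarrow> real \<Rightarrow> real" where
  "ell_delta k x = sqrt (1 - k\<^sup>2 * (sin x)\<^sup>2)"

lemma ell_delta_radicand_pos:
  fixes k x :: real
  assumes "k\<^sup>2 < 1"
  shows "1 - k\<^sup>2 * (sin x)\<^sup>2 > 0"
proof -
  have "k\<^sup>2 * (sin x)\<^sup>2 \<le> k\<^sup>2 * 1"
    by (intro mult_left_mono) (simp_all add: sin_squared_eq)
  then show ?thesis using assms by linarith
qed

lemma ell_delta_pos: "k\<^sup>2 < 1 \<Longrightarrow> ell_delta k x > 0"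
  using ell_delta_radicand_pos[of k x] by (simp add: ell_delta_def)

lemma ell_delta_square: "k\<^sup>2 < 1 \<Longrightarrow> (ell_delta k x)\<^sup>2 = 1 - k\<^sup>2 * (sin x)\<^sup>2"
  using ell_delta_radicand_pos[of k x] by (simp add: ell_delta_def)

lemma continuous_on_ell_delta [continuous_intros]:
  fixes f :: "'a::t2_space \<Rightarrow> real"
  shows "continuous_on S f \<Longrightarrow> continuous_on S (\<lambda>x. ell_delta k (f x))"
  unfolding ell_delta_def
  by (intro continuous_on_real_sqrt continuous_on_diff continuous_on_const continuous_on_mult
      continuous_on_power continuous_on_sin)

lemma ell_delta_deriv:
  assumes "k\<^sup>2 < 1"
  shows "(ell_delta k has_real_derivative - (k\<^sup>2 * sin x * cos x) / ell_delta k x) (at x within S)"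
proof -
  have "((\<lambda>x. 1 - k\<^sup>2 * (sin x)\<^sup>2) has_real_derivative - (k\<^sup>2 * (2 * (sin x * cos x)))) (at x within S)"
    by (rule derivative_eq_intros refl)+ (simp add: mult_ac)
  from DERIV_chain2[where g = "\<lambda>x. 1 - k\<^sup>2 * (sin x)\<^sup>2",
      OF DERIV_real_sqrt[OF ell_delta_radicand_pos[OF assms, of x]] this]
  have "(ell_delta k has_real_derivative inverse (ell_delta k x) / 2 * - (k\<^sup>2 * (2 * (sin x * cos x)))) (at x within S)"
    by (simp only: ell_delta_def[abs_def])
  moreover have "inverse d / 2 * - (c * (2 * (s * t))) = - (c * s * t) / d" for c d s t :: real
    by (cases "d = 0") (simp_all add: field_simps)
  ultimately show ?thesis by (rule DERIV_cong)
qed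

lemma elliptic_eq_integral:
  assumes "\<kappa>\<^sup>2 < 1" "0 \<le> \<theta>"
  shows "elliptic_F \<theta> \<kappa> = integral {0..\<theta>} (\<lambda>t. 1 / ell_delta \<kappa> t)"
    and "elliptic_E \<theta> \<kappa> = integral {0..\<theta>} (ell_delta \<kappa>)"
proof -
  have "continuous_on {0..\<theta>} (\<lambda>t. 1 / ell_delta \<kappa> t)" "continuous_on {0..\<theta>} (ell_delta \<kappa>)"
    using ell_delta_pos[OF assms(1)] by (auto intro!: continuous_intros simp: less_imp_neq[symmetric])
  then have int: "set_integrable lborel {0..\<theta>} (\<lambda>t. 1 / ell_delta \<kappa> t)" "set_integrable lborel {0..\<theta>} (ell_delta \<kappa>)"
    by (auto intro: borel_integrable_atLeastAtMost')
  show "elliptic_F \<theta> \<kappa> = integral {0..\<theta>} (\<lambda>t. 1 / ell_delta \<kappa> t)"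
    using interval_integral_eq_integral[OF assms(2) int(1)]
    by (simp add: elliptic_F_def ell_delta_def zero_ereal_def)
  show "elliptic_E \<theta> \<kappa> = integral {0..\<theta>} (ell_delta \<kappa>)"
    using interval_integral_eq_integral[OF assms(2) int(2)]
    by (simp add: elliptic_E_def ell_delta_def[abs_def] zero_ereal_def)
qed

text \<open>The three incomplete integrals merge because the square of \<open>ell_delta k'\<close>
  is \<open>1 - k'^2 * sin^2\<close>. The integrand obtained is the derivative of Heuman's function
  in the amplitude.\<close>

lemma heuman_Lambda_eq_integral:
  assumes "0 < k" "k < 1" "0 \<le> \<theta>"
  defines "k' \<equiv> sqrt (1 - k\<^sup>2)"
  shows "heuman_Lambda \<theta> k =
    2 / pi * integral {0..\<theta>} (\<lambda>t. (complete_E k - complete_K k * (k'\<^sup>2 * (sin t)\<^sup>2)) / ell_delta k' t)"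
proof -
  have k2: "k\<^sup>2 < 1" "0 < k\<^sup>2" using assms by (simp_all add: power_less_one_iff abs_square_less_1)
  have k'2: "k'\<^sup>2 < 1" using k2 by (simp add: k'_def)
  let ?D = "ell_delta k'" and ?E = "complete_E k" and ?K = "complete_K k"
  have cont: "continuous_on {0..\<theta>} (\<lambda>t. 1 / ?D t)" "continuous_on {0..\<theta>} ?D"
    using ell_delta_pos[OF k'2] by (auto intro!: continuous_intros simp: less_imp_neq[symmetric])
  have "((\<lambda>t. ?E * (1 / ?D t) + ?K * ?D t - ?K * (1 / ?D t)) has_integral
      ?E * integral {0..\<theta>} (\<lambda>t. 1 / ?D t) + ?K * integral {0..\<theta>} ?D - ?K * integral {0..\<theta>} (\<lambda>t. 1 / ?D t)) {0..\<theta>}"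
    by (intro has_integral_add has_integral_diff has_integral_mult_right integrable_integral
        integrable_continuous_real cont)
  moreover have "?E * (1 / ?D t) + ?K * ?D t - ?K * (1 / ?D t) = (?E - ?K * (k'\<^sup>2 * (sin t)\<^sup>2)) / ?D t" for t
  proof -
    have "?D t = (1 - k'\<^sup>2 * (sin t)\<^sup>2) / ?D t"
      using ell_delta_pos[OF k'2, of t] ell_delta_square[OF k'2, of t]
      by (simp add: field_simps power2_eq_square)
    then have "?K * ?D t = (?K - ?K * (k'\<^sup>2 * (sin t)\<^sup>2)) / ?D t"
      by (metis mult.right_neutral right_diff_distrib times_divide_eq_right)
    then show ?thesis by (simp add: diff_divide_distrib)
  qed
  ultimately have "integral {0..\<theta>} (\<lambda>t. (?E - ?K * (k'\<^sup>2 * (sin t)\<^sup>2)) / ?D t) =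
      ?E * elliptic_F \<theta> k' + ?K * elliptic_E \<theta> k' - ?K * elliptic_F \<theta> k'"
    unfolding elliptic_eq_integral[OF k'2 assms(3)] by (simp add: integral_unique)
  then show ?thesis by (simp add: heuman_Lambda_def Let_def k'_def)
qed

lemma reflect_half_pi_integral:
  fixes f :: "real \<Rightarrow> real"
  assumes cont: "continuous_on {0..pi} f" and sym: "\<And>s. f (pi - s) = f s"
  shows "integral {0..pi} f = 2 * integral {0..pi / 2} f"
proof -
  have cont': "continuous_on {pi - pi..pi} f" using cont by simp
  have "((\<lambda>x. - 1 *\<^sub>R f (pi - x)) has_integral
      (integral {pi - 0..pi - pi / 2} f - integral {pi - pi / 2..pi - 0} f)) {0..pi / 2}"
    by (rule has_integral_substitution_general[where s = "{}" and c = 0 and d = pi])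
      (use cont in \<open>auto intro!: continuous_intros derivative_eq_intros\<close>)
  then have "((\<lambda>x. - f x) has_integral - integral {pi / 2..pi} f) {0..pi / 2}"
    by (simp add: sym)
  then have "(f has_integral integral {pi / 2..pi} f) {0..pi / 2}"
    using has_integral_neg_iff[of f] by simp
  then have "integral {0..pi / 2} f = integral {pi / 2..pi} f" by (rule integral_unique)
  moreover have "integral {0..pi / 2} f + integral {pi / 2..pi} f = integral {0..pi} f"
    by (rule Henstock_Kurzweil_Integration.integral_combine) (use cont in \<open>auto intro: integrable_continuous_real\<close>)
  ultimately show ?thesis by simp
qed

text \<open>Substitute \<open>tan s = \<kappa> * tan x\<close>. With
  \<open>\<kappa>^2 = 1 + \<mu>\<close>, multiplying numerator and denominator of the radicand by
  \<open>W = 1 + \<mu> * sin^2 x\<close> makes the denominator constant and the numerator a multiple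
  of \<open>1 - k^2 * sin^2 x\<close>. Thus \<open>W\<close> survives only through the derivative of
  \<open>twist\<close>, which yields an integral of the third kind.\<close>

lemma third_kind_reduction:
  assumes p: "p > 0" and q: "q > 0" and r: "r > 0"
  defines "k \<equiv> sqrt (q * r / ((p + r) * (p + q)))" and "\<mu> \<equiv> q / (p + r)"
  shows "integral {0..pi / 2} (\<lambda>s. sqrt ((p + q * (cos s)\<^sup>2) / (p + q * (cos s)\<^sup>2 + r))) =
    sqrt ((p + q) / (p + r)) * integral {0..pi / 2} (\<lambda>x. ell_delta k x / (1 + \<mu> * (sin x)\<^sup>2))"
proof -
  define f where "f s = sqrt ((p + q * (cos s)\<^sup>2) / (p + q * (cos s)\<^sup>2 + r))" for s
  define \<kappa> where "\<kappa> = sqrt (1 + \<mu>)"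
  have \<mu>: "\<mu> > 0" using assms by (simp add: \<mu>_def)
  have \<kappa>: "\<kappa> > 0" "\<kappa>\<^sup>2 = 1 + \<mu>" using \<mu> by (auto simp: \<kappa>_def)
  have k2: "k\<^sup>2 = q * r / ((p + r) * (p + q))" unfolding k_def using assms by simp
  have Cpos: "p + q * (cos s)\<^sup>2 > 0" "p + q * (cos s)\<^sup>2 + r > 0" for s
    using assms by (auto intro!: add_pos_nonneg)
  have cont: "continuous_on A f" for A
    unfolding f_def by (intro continuous_intros) (use Cpos in \<open>auto simp: less_imp_neq[symmetric]\<close>)
  have "((\<lambda>x. (\<kappa> / ((cos x)\<^sup>2 + \<kappa>\<^sup>2 * (sin x)\<^sup>2)) *\<^sub>R f (twist \<kappa> x)) has_integral
      (integral {twist \<kappa> 0..twist \<kappa> (pi / 2)} f - integral {twist \<kappa> (pi / 2)..twist \<kappa> 0} f)) {0..pi / 2}"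
  proof (rule has_integral_substitution_general[where s = "{}" and c = "- pi / 2" and d = pi])
    \<comment> \<open>As \<open>f\<close> is continuous everywhere, a crude range is enough: the
      \<open>arctan\<close> term shifts \<open>x\<close> by less than \<open>pi / 2\<close>.\<close>
    show "twist \<kappa> ` {0..pi / 2} \<subseteq> {- pi / 2..pi}"
    proof
      fix y assume "y \<in> twist \<kappa> ` {0..pi / 2}"
      then obtain x where x: "x \<in> {0..pi / 2}" "y = twist \<kappa> x" by auto
      show "y \<in> {- pi / 2..pi}"
      proof -
        define A where "A = arctan ((\<kappa> - 1) * (sin x * cos x) / ((cos x)\<^sup>2 + \<kappa> * (sin x)\<^sup>2))"
        have "- (pi / 2) < A" "A < pi / 2" unfolding A_def by (rule arctan_lbound, rule arctan_ubound)
        moreover have "y = x + A" unfolding x(2) twist_def A_def ..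
        moreover have "0 \<le> x" "x \<le> pi / 2" using x(1) by simp_all
        ultimately have "- pi / 2 \<le> y" "y \<le> pi" by linarith+
        then show ?thesis by simp
      qed
    qed
    show "continuous_on {0..pi / 2} (twist \<kappa>)"
      by (rule DERIV_continuous_on[OF twist_deriv[OF \<kappa>(1)]])
    show "continuous_on {- pi / 2..pi} f" by (rule cont)
    show "(twist \<kappa> has_real_derivative \<kappa> / ((cos x)\<^sup>2 + \<kappa>\<^sup>2 * (sin x)\<^sup>2)) (at x within {0..pi / 2})" for x
      by (rule twist_deriv[OF \<kappa>(1)])
  qed simp_all
  \<comment> \<open>The substitution rule subtracts the integral over the reversed limits, here over
    an empty interval.\<close>
  moreover have "integral {pi / 2..0} f = 0" by simp
  ultimately have sub: "((\<lambda>x. \<kappa> / ((cos x)\<^sup>2 + \<kappa>\<^sup>2 * (sin x)\<^sup>2) * f (twist \<kappa> x)) has_integral integral {0..pi / 2} f) {0..pi / 2}"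
    unfolding twist_values by (simp only: diff_zero real_scaleR_def)
  have eq: "\<kappa> / ((cos x)\<^sup>2 + \<kappa>\<^sup>2 * (sin x)\<^sup>2) * f (twist \<kappa> x) =
      sqrt ((p + q) / (p + r)) * (ell_delta k x / (1 + \<mu> * (sin x)\<^sup>2))"
    if x: "x \<in> {0..pi / 2} - {pi / 2}" for x
  proof -
    define W where "W = 1 + \<mu> * (sin x)\<^sup>2"
    have W: "W > 0" using \<mu> by (simp add: W_def add_pos_nonneg)
    have W': "(cos x)\<^sup>2 + \<kappa>\<^sup>2 * (sin x)\<^sup>2 = W"
      unfolding W_def \<kappa>(2) cos_squared_eq by (simp add: algebra_simps)
    have x': "0 \<le> x" "x < pi / 2" using x by auto
    then have c: "cos x \<noteq> 0" using cos_gt_zero_pi[of x] by auto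
    note t = twist_tan[OF \<kappa>(1) x']
    have "(cos (twist \<kappa> x))\<^sup>2 = 1 / (1 + (tan (twist \<kappa> x))\<^sup>2)"
      unfolding tan_sec[OF t(2)] by (simp add: power_inverse divide_inverse)
    also have "1 + (tan (twist \<kappa> x))\<^sup>2 = W / (cos x)\<^sup>2"
      unfolding t(1) W'[symmetric] using c by (simp add: tan_def power_mult_distrib power_divide add_divide_distrib)
    finally have c2: "(cos (twist \<kappa> x))\<^sup>2 = (cos x)\<^sup>2 / W" by simp
    have \<mu>r: "\<mu> * (p + r) = q" using assms by (simp add: \<mu>_def)
    have num: "p * W + q * (cos x)\<^sup>2 = (p + q) * (1 - k\<^sup>2 * (sin x)\<^sup>2)"
    proof -
      have "(p + q) * k\<^sup>2 = \<mu> * r" unfolding k2 \<mu>_def using assms by simp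
      moreover have "\<mu> * r = q - \<mu> * p" using \<mu>r by (simp add: algebra_simps)
      ultimately have k2': "(p + q) * k\<^sup>2 = q - \<mu> * p" by simp
      have "(p + q) * (1 - k\<^sup>2 * (sin x)\<^sup>2) = (p + q) - ((p + q) * k\<^sup>2) * (sin x)\<^sup>2"
        by (simp add: algebra_simps)
      then show ?thesis unfolding k2' W_def cos_squared_eq by (simp add: algebra_simps)
    qed
    have den: "p * W + q * (cos x)\<^sup>2 + r * W = p + q + r"
    proof -
      have "p * W + q * (cos x)\<^sup>2 + r * W = (p + r) + (\<mu> * (p + r)) * (sin x)\<^sup>2 + q * (cos x)\<^sup>2"
        unfolding W_def by (simp add: algebra_simps)
      then show ?thesis unfolding \<mu>r cos_squared_eq by (simp add: algebra_simps)
    qed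
    have "f (twist \<kappa> x) = sqrt ((p * W + q * (cos x)\<^sup>2) / (p * W + q * (cos x)\<^sup>2 + r * W))"
    proof -
      have "(p + q * ((cos x)\<^sup>2 / W)) / (p + q * ((cos x)\<^sup>2 / W) + r)
         = ((p + q * ((cos x)\<^sup>2 / W)) * W) / ((p + q * ((cos x)\<^sup>2 / W) + r) * W)" using W by simp
      also have "(p + q * ((cos x)\<^sup>2 / W)) * W = p * W + q * (cos x)\<^sup>2" using W by (simp add: distrib_right)
      also have "(p + q * ((cos x)\<^sup>2 / W) + r) * W = p * W + q * (cos x)\<^sup>2 + r * W" using W by (simp add: distrib_right)
      finally show ?thesis unfolding f_def c2 by simp
    qed
    also have "\<dots> = sqrt ((p + q) / (p + q + r)) * ell_delta k x"
      unfolding den unfolding num ell_delta_def by (simp add: real_sqrt_mult real_sqrt_divide)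
    finally have "\<kappa> / W * f (twist \<kappa> x) = (\<kappa> * sqrt ((p + q) / (p + q + r))) * (ell_delta k x / W)" by simp
    also have "\<kappa> * sqrt ((p + q) / (p + q + r)) = sqrt ((p + q) / (p + r))"
    proof -
      have "1 + \<mu> = (p + q + r) / (p + r)" using assms by (simp add: \<mu>_def field_simps)
      then show ?thesis unfolding \<kappa>_def real_sqrt_mult[symmetric] using assms by simp
    qed
    finally show ?thesis unfolding W' W_def .
  qed
  have "((\<lambda>x. sqrt ((p + q) / (p + r)) * (ell_delta k x / (1 + \<mu> * (sin x)\<^sup>2))) has_integral integral {0..pi / 2} f) {0..pi / 2}"
  proof (rule has_integral_spike_finite[where S = "{pi / 2}"])
    show "((\<lambda>x. \<kappa> / ((cos x)\<^sup>2 + \<kappa>\<^sup>2 * (sin x)\<^sup>2) * f (twist \<kappa> x)) has_integral integral {0..pi / 2} f) {0..pi / 2}"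
      by (rule sub)
  qed (simp_all only: finite.emptyI finite_insert eq)
  then have "integral {0..pi / 2} f = integral {0..pi / 2} (\<lambda>x. sqrt ((p + q) / (p + r)) * (ell_delta k x / (1 + \<mu> * (sin x)\<^sup>2)))"
    by (rule integral_unique[symmetric])
  then show ?thesis unfolding f_def integral_mult_right .
qed

section \<open>A kernel whose derivative in the amplitude is Heuman's integrand up to an exact
  derivative\<close>

lemma heuman_kernel_identity:
  fixes S C s c P D \<kappa> :: real
  assumes C: "C\<^sup>2 = 1 - S\<^sup>2" and c: "c\<^sup>2 = 1 - s\<^sup>2"
    and P: "P\<^sup>2 = 1 - (1 - \<kappa>) * S\<^sup>2" "P > 0" and D: "D\<^sup>2 = 1 - \<kappa> * s\<^sup>2" "D > 0"
    and W: "W = C\<^sup>2 + \<kappa> * S\<^sup>2 * s\<^sup>2" "W > 0"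
  shows "D * ((C\<^sup>2 - S\<^sup>2) * P / W - (1 - \<kappa>) * S\<^sup>2 * C\<^sup>2 / (P * W) + 2 * S\<^sup>2 * C\<^sup>2 * P * D\<^sup>2 / W\<^sup>2)
    = (D - (1 - \<kappa>) * S\<^sup>2 / D) / P
      + \<kappa> * S\<^sup>2 / P * ((c\<^sup>2 - s\<^sup>2) * D / W - s\<^sup>2 * c\<^sup>2 * \<kappa> / (D * W) - 2 * \<kappa> * S\<^sup>2 * s\<^sup>2 * c\<^sup>2 * D / W\<^sup>2)"
    (is "?L = ?R")
proof -
  \<comment> \<open>\<open>S\<close>, \<open>C\<close> stand for sine and cosine of the amplitude,
    \<open>s\<close>, \<open>c\<close> for those of the variable of integration, \<open>P\<close>
    and \<open>D\<close> for the two Deltas, \<open>\<kappa>\<close> for \<open>k^2\<close>.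
    Multiplication by \<open>D * P * W^2\<close> leaves even powers only, so the claim becomes a
    polynomial identity in \<open>X\<close>, \<open>Y\<close> and \<open>\<kappa>\<close>.\<close>
  define X Y where "X = S\<^sup>2" and "Y = s\<^sup>2"
  have poly: "D\<^sup>2 * ((C\<^sup>2 - S\<^sup>2) * P\<^sup>2 * W - (1 - \<kappa>) * S\<^sup>2 * C\<^sup>2 * W + 2 * S\<^sup>2 * C\<^sup>2 * P\<^sup>2 * D\<^sup>2)
     = (D\<^sup>2 - (1 - \<kappa>) * S\<^sup>2) * W\<^sup>2 + \<kappa> * S\<^sup>2 * ((c\<^sup>2 - s\<^sup>2) * D\<^sup>2 * W - s\<^sup>2 * c\<^sup>2 * \<kappa> * W - 2 * \<kappa> * S\<^sup>2 * s\<^sup>2 * c\<^sup>2 * D\<^sup>2)"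
    unfolding W(1) C c P(1) D(1) X_def[symmetric] Y_def[symmetric] by Groebner_Basis.algebra
  have L: "?L * (D * P * W\<^sup>2) = D\<^sup>2 * ((C\<^sup>2 - S\<^sup>2) * P\<^sup>2 * W - (1 - \<kappa>) * S\<^sup>2 * C\<^sup>2 * W + 2 * S\<^sup>2 * C\<^sup>2 * P\<^sup>2 * D\<^sup>2)"
  proof -
    have "(C\<^sup>2 - S\<^sup>2) * P / W * (P * W\<^sup>2) = (C\<^sup>2 - S\<^sup>2) * P\<^sup>2 * W"
      "(1 - \<kappa>) * S\<^sup>2 * C\<^sup>2 / (P * W) * (P * W\<^sup>2) = (1 - \<kappa>) * S\<^sup>2 * C\<^sup>2 * W"
      "2 * S\<^sup>2 * C\<^sup>2 * P * D\<^sup>2 / W\<^sup>2 * (P * W\<^sup>2) = 2 * S\<^sup>2 * C\<^sup>2 * P\<^sup>2 * D\<^sup>2"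
      using W(2) P(2) by (simp_all add: power2_eq_square)
    note e = this
    have "?L * (D * P * W\<^sup>2) = D\<^sup>2 * ((C\<^sup>2 - S\<^sup>2) * P / W * (P * W\<^sup>2)
        - (1 - \<kappa>) * S\<^sup>2 * C\<^sup>2 / (P * W) * (P * W\<^sup>2) + 2 * S\<^sup>2 * C\<^sup>2 * P * D\<^sup>2 / W\<^sup>2 * (P * W\<^sup>2))"
      by Groebner_Basis.algebra
    then show ?thesis unfolding e .
  qed
  have R: "?R * (D * P * W\<^sup>2) = (D\<^sup>2 - (1 - \<kappa>) * S\<^sup>2) * W\<^sup>2 + \<kappa> * S\<^sup>2 * ((c\<^sup>2 - s\<^sup>2) * D\<^sup>2 * W - s\<^sup>2 * c\<^sup>2 * \<kappa> * W - 2 * \<kappa> * S\<^sup>2 * s\<^sup>2 * c\<^sup>2 * D\<^sup>2)"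
  proof -
    have "(D - (1 - \<kappa>) * S\<^sup>2 / D) / P * (D * P * W\<^sup>2) = (D\<^sup>2 - (1 - \<kappa>) * S\<^sup>2) * W\<^sup>2"
      "\<kappa> * S\<^sup>2 / P * P = \<kappa> * S\<^sup>2"
      "(c\<^sup>2 - s\<^sup>2) * D / W * (D * W\<^sup>2) = (c\<^sup>2 - s\<^sup>2) * D\<^sup>2 * W"
      "s\<^sup>2 * c\<^sup>2 * \<kappa> / (D * W) * (D * W\<^sup>2) = s\<^sup>2 * c\<^sup>2 * \<kappa> * W"
      "2 * \<kappa> * S\<^sup>2 * s\<^sup>2 * c\<^sup>2 * D / W\<^sup>2 * (D * W\<^sup>2) = 2 * \<kappa> * S\<^sup>2 * s\<^sup>2 * c\<^sup>2 * D\<^sup>2"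
      using W(2) P(2) D(2) by (simp_all add: power2_eq_square field_simps)
    note e = this
    have "?R * (D * P * W\<^sup>2) = (D - (1 - \<kappa>) * S\<^sup>2 / D) / P * (D * P * W\<^sup>2)
      + (\<kappa> * S\<^sup>2 / P * P) * ((c\<^sup>2 - s\<^sup>2) * D / W * (D * W\<^sup>2) - s\<^sup>2 * c\<^sup>2 * \<kappa> / (D * W) * (D * W\<^sup>2)
        - 2 * \<kappa> * S\<^sup>2 * s\<^sup>2 * c\<^sup>2 * D / W\<^sup>2 * (D * W\<^sup>2))"
      by Groebner_Basis.algebra
    then show ?thesis unfolding e .
  qed
  have "?L * (D * P * W\<^sup>2) = ?R * (D * P * W\<^sup>2)" by (rule trans[OF L trans[OF poly R[symmetric]]])
  moreover have "D * P * W\<^sup>2 \<noteq> 0" using D P W by simp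
  ultimately show ?thesis by (rule mult_right_cancel[THEN iffD1, rotated])
qed

text \<open>The left side is the raw outcome of the quotient rule for \<open>heuman_kernel\<close>,
  the right side has the three terms of \<open>heuman_kernel'\<close>.\<close>

lemma quotient_rule_identity1:
  fixes A p q s c d w e :: real
  assumes "p > 0" "w > 0"
  shows "((A * p + (- (q * s * c) / p) * (s * c)) * d * w - (s * c * p * d) * - (2 * s * c * e)) / (w * w)
    = d * (A * p / w - q * s\<^sup>2 * c\<^sup>2 / (p * w) + 2 * s\<^sup>2 * c\<^sup>2 * p * e / w\<^sup>2)"
proof -
  have "((A * p + (- (q * s * c) / p) * (s * c)) * d * w - (s * c * p * d) * - (2 * s * c * e)) / (w * w)
    = d * (A * p) * (w / (w * w)) - d * (q * s\<^sup>2 * c\<^sup>2 / p) * (w / (w * w)) + d * (2 * s\<^sup>2 * c\<^sup>2 * p * e) / (w * w)"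
    by (simp add: diff_divide_distrib add_divide_distrib algebra_simps power2_eq_square)
  also have "w / (w * w) = 1 / w" using assms by simp
  finally show ?thesis by (simp add: algebra_simps power2_eq_square)
qed

lemma quotient_rule_identity2:
  fixes A q s c d w t :: real
  assumes "d > 0" "w > 0"
  shows "((A * d + (- (q * s * c) / d) * (s * c)) * w - (s * c * d) * (2 * q * t * (s * c))) / (w * w)
    = A * d / w - s\<^sup>2 * c\<^sup>2 * q / (d * w) - 2 * q * t * s\<^sup>2 * c\<^sup>2 * d / w\<^sup>2"
proof -
  have "((A * d + (- (q * s * c) / d) * (s * c)) * w - (s * c * d) * (2 * q * t * (s * c))) / (w * w)
    = (A * d) * (w / (w * w)) - (s\<^sup>2 * c\<^sup>2 * q / d) * (w / (w * w)) - (2 * q * t * s\<^sup>2 * c\<^sup>2 * d) / (w * w)"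
    by (simp add: diff_divide_distrib add_divide_distrib algebra_simps power2_eq_square)
  also have "w / (w * w) = 1 / w" using assms by simp
  finally show ?thesis by (simp add: algebra_simps power2_eq_square)
qed

definition kernel_denom :: "real \<Rightarrow> real \<Rightarrow> real \<Rightarrow> real" where
  "kernel_denom k \<theta> x = (cos \<theta>)\<^sup>2 + k\<^sup>2 * (sin \<theta>)\<^sup>2 * (sin x)\<^sup>2"

text \<open>For fixed amplitude this is, up to a constant factor, the integrand of
  \<open>third_kind_reduction\<close>: dividing \<open>kernel_denom\<close> by
  \<open>cos^2 \<theta>\<close> gives \<open>1 + \<mu> * sin^2 x\<close> with
  \<open>\<mu> = k^2 * tan^2 \<theta>\<close>.\<close>

definition heuman_kernel :: "real \<Rightarrow> real \<Rightarrow> real \<Rightarrow> real" where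
  "heuman_kernel k \<theta> x = sin \<theta> * cos \<theta> * ell_delta (sqrt (1 - k\<^sup>2)) \<theta> * ell_delta k x / kernel_denom k \<theta> x"

definition heuman_kernel' :: "real \<Rightarrow> real \<Rightarrow> real \<Rightarrow> real" where
  "heuman_kernel' k \<theta> x = ell_delta k x *
     (((cos \<theta>)\<^sup>2 - (sin \<theta>)\<^sup>2) * ell_delta (sqrt (1 - k\<^sup>2)) \<theta> / kernel_denom k \<theta> x
      - (1 - k\<^sup>2) * (sin \<theta>)\<^sup>2 * (cos \<theta>)\<^sup>2 / (ell_delta (sqrt (1 - k\<^sup>2)) \<theta> * kernel_denom k \<theta> x)
      + 2 * (sin \<theta>)\<^sup>2 * (cos \<theta>)\<^sup>2 * ell_delta (sqrt (1 - k\<^sup>2)) \<theta> * (ell_delta k x)\<^sup>2 / (kernel_denom k \<theta> x)\<^sup>2)"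

text \<open>The antiderivative in \<open>x\<close> of the exact part of
  \<open>heuman_kernel'\<close>. Its factor \<open>sin x * cos x\<close> makes it vanish at
  \<open>0\<close> and at \<open>pi / 2\<close>.\<close>

definition heuman_potential :: "real \<Rightarrow> real \<Rightarrow> real \<Rightarrow> real" where
  "heuman_potential k \<theta> x = k\<^sup>2 * (sin \<theta>)\<^sup>2 / ell_delta (sqrt (1 - k\<^sup>2)) \<theta> *
     (sin x * cos x * ell_delta k x / kernel_denom k \<theta> x)"

definition heuman_potential' :: "real \<Rightarrow> real \<Rightarrow> real \<Rightarrow> real" where
  "heuman_potential' k \<theta> x = k\<^sup>2 * (sin \<theta>)\<^sup>2 / ell_delta (sqrt (1 - k\<^sup>2)) \<theta> *
     (((cos x)\<^sup>2 - (sin x)\<^sup>2) * ell_delta k x / kernel_denom k \<theta> x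
      - (sin x)\<^sup>2 * (cos x)\<^sup>2 * k\<^sup>2 / (ell_delta k x * kernel_denom k \<theta> x)
      - 2 * k\<^sup>2 * (sin \<theta>)\<^sup>2 * (sin x)\<^sup>2 * (cos x)\<^sup>2 * ell_delta k x / (kernel_denom k \<theta> x)\<^sup>2)"

lemma kernel_denom_pos:
  assumes "\<theta> \<in> {- (pi / 2)<..<pi / 2}"
  shows "kernel_denom k \<theta> x > 0"
proof -
  have "cos \<theta> > 0" using assms by (intro cos_gt_zero_pi) auto
  then show ?thesis unfolding kernel_denom_def by (intro add_pos_nonneg) simp_all
qed

lemma complementary_modulus:
  assumes "0 < k" "k < 1"
  shows "k\<^sup>2 < 1" "(sqrt (1 - k\<^sup>2))\<^sup>2 = 1 - k\<^sup>2" "(sqrt (1 - k\<^sup>2))\<^sup>2 < 1"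
proof -
  show k2: "k\<^sup>2 < 1" using assms by (simp add: abs_square_less_1)
  then show *: "(sqrt (1 - k\<^sup>2))\<^sup>2 = 1 - k\<^sup>2" by simp
  have "0 < k\<^sup>2" using assms by simp
  then show "(sqrt (1 - k\<^sup>2))\<^sup>2 < 1" unfolding * by simp
qed

lemma sin_cos_deriv:
  "((\<lambda>x. sin x * cos x) has_real_derivative (cos x)\<^sup>2 - (sin x)\<^sup>2) (at x within T)"
  by (auto intro!: derivative_eq_intros simp: power2_eq_square)

lemma heuman_kernel_deriv:
  assumes k: "0 < k" "k < 1" and \<theta>: "\<theta> \<in> {- (pi / 2)<..<pi / 2}"
  shows "((\<lambda>\<theta>. heuman_kernel k \<theta> x) has_real_derivative heuman_kernel' k \<theta> x) (at \<theta> within U)"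
proof -
  define k' where "k' = sqrt (1 - k\<^sup>2)"
  note km = complementary_modulus[OF k, folded k'_def]
  let ?P = "ell_delta k'" and ?D = "ell_delta k" and ?W = "kernel_denom k"
  have D: "(?D x)\<^sup>2 = 1 - k\<^sup>2 * (sin x)\<^sup>2" by (rule ell_delta_square[OF km(1)])
  have dW: "((\<lambda>\<theta>. ?W \<theta> x) has_real_derivative - (2 * sin \<theta> * cos \<theta> * (?D x)\<^sup>2)) (at \<theta> within U)"
    unfolding kernel_denom_def D by (auto intro!: derivative_eq_intros simp: algebra_simps)
  have dN: "((\<lambda>\<theta>. sin \<theta> * cos \<theta> * ?P \<theta> * ?D x) has_real_derivative
      (((cos \<theta>)\<^sup>2 - (sin \<theta>)\<^sup>2) * ?P \<theta> + (- (k'\<^sup>2 * sin \<theta> * cos \<theta>) / ?P \<theta>) * (sin \<theta> * cos \<theta>)) * ?D x) (at \<theta> within U)"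
    by (rule DERIV_cmult_right, rule DERIV_mult[OF sin_cos_deriv ell_delta_deriv[OF km(3)]])
  have W: "?W \<theta> x > 0" by (rule kernel_denom_pos[OF \<theta>])
  then have "((\<lambda>\<theta>. sin \<theta> * cos \<theta> * ?P \<theta> * ?D x / ?W \<theta> x) has_real_derivative
     ((((cos \<theta>)\<^sup>2 - (sin \<theta>)\<^sup>2) * ?P \<theta> + (- (k'\<^sup>2 * sin \<theta> * cos \<theta>) / ?P \<theta>) * (sin \<theta> * cos \<theta>)) * ?D x * ?W \<theta> x
       - (sin \<theta> * cos \<theta> * ?P \<theta> * ?D x) * - (2 * sin \<theta> * cos \<theta> * (?D x)\<^sup>2)) / (?W \<theta> x * ?W \<theta> x)) (at \<theta> within U)"
    by (intro DERIV_divide[OF dN dW]) simp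
  then show ?thesis
    unfolding quotient_rule_identity1[OF ell_delta_pos[OF km(3)] W] heuman_kernel_def heuman_kernel'_def
      k'_def[symmetric] km(2) .
qed

lemma heuman_potential_deriv:
  assumes k: "0 < k" "k < 1" and \<theta>: "\<theta> \<in> {- (pi / 2)<..<pi / 2}"
  shows "(heuman_potential k \<theta> has_real_derivative heuman_potential' k \<theta> x) (at x within T)"
proof -
  note km = complementary_modulus[OF k]
  let ?D = "ell_delta k" and ?W = "kernel_denom k \<theta>"
  have dW: "(?W has_real_derivative 2 * k\<^sup>2 * (sin \<theta>)\<^sup>2 * (sin x * cos x)) (at x within T)"
    unfolding kernel_denom_def[abs_def] by (auto intro!: derivative_eq_intros simp: algebra_simps)
  have dN: "((\<lambda>x. sin x * cos x * ?D x) has_real_derivative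
      ((cos x)\<^sup>2 - (sin x)\<^sup>2) * ?D x + (- (k\<^sup>2 * sin x * cos x) / ?D x) * (sin x * cos x)) (at x within T)"
    by (rule DERIV_mult[OF sin_cos_deriv ell_delta_deriv[OF km(1)]])
  have W: "?W x > 0" by (rule kernel_denom_pos[OF \<theta>])
  then have "((\<lambda>x. sin x * cos x * ?D x / ?W x) has_real_derivative
     ((((cos x)\<^sup>2 - (sin x)\<^sup>2) * ?D x + (- (k\<^sup>2 * sin x * cos x) / ?D x) * (sin x * cos x)) * ?W x
       - (sin x * cos x * ?D x) * (2 * k\<^sup>2 * (sin \<theta>)\<^sup>2 * (sin x * cos x))) / (?W x * ?W x)) (at x within T)"
    by (intro DERIV_divide[OF dN dW]) simp
  then show ?thesis
    unfolding quotient_rule_identity2[OF ell_delta_pos[OF km(1)] W] heuman_potential_def[abs_def] heuman_potential'_def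
    by (rule DERIV_cmult)
qed

text \<open>Here the integral of the third kind disappears: apart from the exact term, only the
  integrands of \<open>complete_E\<close> and \<open>complete_K\<close> remain.\<close>

lemma heuman_kernel'_eq:
  assumes k: "0 < k" "k < 1" and \<theta>: "\<theta> \<in> {- (pi / 2)<..<pi / 2}"
  shows "heuman_kernel' k \<theta> x = (ell_delta k x - (1 - k\<^sup>2) * (sin \<theta>)\<^sup>2 / ell_delta k x) / ell_delta (sqrt (1 - k\<^sup>2)) \<theta>
    + heuman_potential' k \<theta> x"
  unfolding heuman_kernel'_def heuman_potential'_def
proof (rule heuman_kernel_identity)
  note km = complementary_modulus[OF k]
  show "(ell_delta (sqrt (1 - k\<^sup>2)) \<theta>)\<^sup>2 = 1 - (1 - k\<^sup>2) * (sin \<theta>)\<^sup>2"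
    unfolding ell_delta_square[OF km(3)] km(2) ..
  show "(ell_delta k x)\<^sup>2 = 1 - k\<^sup>2 * (sin x)\<^sup>2" by (rule ell_delta_square[OF km(1)])
  show "0 < ell_delta (sqrt (1 - k\<^sup>2)) \<theta>" "0 < ell_delta k x"
    by (rule ell_delta_pos[OF km(3)], rule ell_delta_pos[OF km(1)])
  show "0 < kernel_denom k \<theta> x" by (rule kernel_denom_pos[OF \<theta>])
qed (rule cos_squared_eq, rule cos_squared_eq, rule kernel_denom_def)

lemma heuman_kernel'_integral:
  assumes k: "0 < k" "k < 1" and \<theta>: "\<theta> \<in> {- (pi / 2)<..<pi / 2}"
  shows "integral {0..pi / 2} (heuman_kernel' k \<theta>) =
    (complete_E k - complete_K k * ((1 - k\<^sup>2) * (sin \<theta>)\<^sup>2)) / ell_delta (sqrt (1 - k\<^sup>2)) \<theta>"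
proof -
  note km = complementary_modulus[OF k]
  let ?D = "ell_delta k"
  define p where "p = ell_delta (sqrt (1 - k\<^sup>2)) \<theta>"
  define c where "c = (1 - k\<^sup>2) * (sin \<theta>)\<^sup>2"
  have D: "?D t \<noteq> 0" for t using ell_delta_pos[OF km(1), of t] by simp
  have cont: "continuous_on {0..pi / 2} (\<lambda>t. 1 / ?D t)" "continuous_on {0..pi / 2} ?D"
    using D by (auto intro!: continuous_intros)
  have "(heuman_potential' k \<theta> has_integral heuman_potential k \<theta> (pi / 2) - heuman_potential k \<theta> 0) {0..pi / 2}"
    by (rule fundamental_theorem_of_calculus)
      (simp_all add: heuman_potential_deriv[OF assms] flip: has_real_derivative_iff_has_vector_derivative)
  then have "(heuman_potential' k \<theta> has_integral 0) {0..pi / 2}" by (simp add: heuman_potential_def)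
  then have "((\<lambda>x. (1 / p) * ?D x - c / p * (1 / ?D x) + heuman_potential' k \<theta> x) has_integral
     (1 / p) * integral {0..pi / 2} ?D - c / p * integral {0..pi / 2} (\<lambda>x. 1 / ?D x) + 0) {0..pi / 2}"
    by (intro has_integral_add has_integral_diff has_integral_mult_right integrable_integral
        integrable_continuous_real cont)
  moreover have "(1 / p) * ?D x - c / p * (1 / ?D x) + heuman_potential' k \<theta> x = heuman_kernel' k \<theta> x" for x
    unfolding heuman_kernel'_eq[OF assms] p_def[symmetric] c_def[symmetric]
    by (simp add: diff_divide_distrib mult.commute)
  ultimately have "integral {0..pi / 2} (heuman_kernel' k \<theta>) =
    (1 / p) * integral {0..pi / 2} ?D - c / p * integral {0..pi / 2} (\<lambda>x. 1 / ?D x)"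
    by (simp add: integral_unique)
  moreover have "complete_E k = integral {0..pi / 2} ?D" "complete_K k = integral {0..pi / 2} (\<lambda>x. 1 / ?D x)"
    unfolding complete_E_def complete_K_def by (rule elliptic_eq_integral[OF km(1)], simp)+
  ultimately show ?thesis
    unfolding p_def[symmetric] c_def[symmetric] by (simp add: diff_divide_distrib mult.commute)
qed

text \<open>Leibniz's rule is used on an open interval around \<open>0\<close>, so that amplitude
  \<open>0\<close> is covered. The interval ends where the cosine vanishes, since
  \<open>kernel_denom\<close> is then 0 at \<open>x = 0\<close>.\<close>

lemma heuman_kernel_integral_deriv:
  assumes k: "0 < k" "k < 1" and \<theta>: "\<theta> \<in> {- (pi / 2)<..<pi / 2}"
  shows "((\<lambda>\<theta>. integral {0..pi / 2} (heuman_kernel k \<theta>)) has_real_derivative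
    integral {0..pi / 2} (heuman_kernel' k \<theta>)) (at \<theta> within {- (pi / 2)<..<pi / 2})"
proof -
  let ?U = "{- (pi / 2)<..<pi / 2 :: real}"
  note km = complementary_modulus[OF k]
  have nz: "kernel_denom k \<theta> x \<noteq> 0" if "\<theta> \<in> ?U" for \<theta> x using kernel_denom_pos[OF that, of k x] by simp
  have P: "ell_delta (sqrt (1 - k\<^sup>2)) t \<noteq> 0" for t using ell_delta_pos[OF km(3), of t] by simp
  have cW: "continuous_on A (\<lambda>p. kernel_denom k (f p) (g p))"
    if "continuous_on A f" "continuous_on A g" for f g and A :: "'a::t2_space set"
    unfolding kernel_denom_def using that by (auto intro!: continuous_intros)
  have "((\<lambda>\<theta>. integral (cbox 0 (pi / 2)) (heuman_kernel k \<theta>)) has_field_derivative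
      integral (cbox 0 (pi / 2)) (heuman_kernel' k \<theta>)) (at \<theta> within ?U)"
  proof (rule leibniz_rule_field_derivative[where U = ?U])
    show "((\<lambda>\<theta>. heuman_kernel k \<theta> x) has_real_derivative heuman_kernel' k t x) (at t within ?U)" if "t \<in> ?U" for t x
      by (rule heuman_kernel_deriv[OF k that])
    show "heuman_kernel k t integrable_on cbox 0 (pi / 2)" if "t \<in> ?U" for t
      unfolding heuman_kernel_def[abs_def] using nz[OF that]
      by (intro integrable_continuous) (auto intro!: continuous_intros cW)
    show "continuous_on (?U \<times> cbox 0 (pi / 2)) (\<lambda>(t, x). heuman_kernel' k t x)"
      unfolding heuman_kernel'_def split_beta
      by (auto intro!: continuous_intros cW simp: nz P)
  qed (use \<theta> in auto)
  then show ?thesis unfolding interval_cbox .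
qed

theorem heuman_Lambda_eq_kernel_integral:
  assumes k: "0 < k" "k < 1" and \<theta>: "0 \<le> \<theta>" "\<theta> < pi / 2"
  shows "heuman_Lambda \<theta> k = 2 / pi * integral {0..pi / 2} (heuman_kernel k \<theta>)"
proof -
  let ?U = "{- (pi / 2)<..<pi / 2 :: real}"
  have sub: "{0..\<theta>} \<subseteq> ?U" using \<theta> by auto
  let ?I = "\<lambda>t. integral {0..pi / 2} (heuman_kernel k t)"
  let ?d = "\<lambda>t. (complete_E k - complete_K k * ((1 - k\<^sup>2) * (sin t)\<^sup>2)) / ell_delta (sqrt (1 - k\<^sup>2)) t"
  have "(?I has_real_derivative ?d t) (at t within {0..\<theta>})" if "t \<in> {0..\<theta>}" for t
  proof -
    have t: "t \<in> ?U" using that sub by blast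
    show ?thesis
      using heuman_kernel_integral_deriv[OF k t] unfolding heuman_kernel'_integral[OF k t]
      by (rule DERIV_subset) (rule sub)
  qed
  then have "(?d has_integral ?I \<theta> - ?I 0) {0..\<theta>}"
    by (intro fundamental_theorem_of_calculus[OF \<theta>(1)])
      (simp add: has_real_derivative_iff_has_vector_derivative)
  moreover have "?I 0 = 0" by (simp add: heuman_kernel_def[abs_def])
  ultimately have "integral {0..\<theta>} ?d = ?I \<theta>" by (simp add: integral_unique)
  then show ?thesis
    unfolding heuman_Lambda_eq_integral[OF k \<theta>(1)] complementary_modulus(2)[OF k] by simp
qed

section \<open>The density of dimers\<close>

text \<open>The derivative of the integrand is
  \<open>2 / x * (1 - C / (C + 4 * x^2 * cos^2 t))\<close>, a constant minus a multiple of the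
  integrand of \<open>has_integral_inverse_cos_square\<close>.\<close>

lemma inner_energy_deriv:
  assumes C: "C > 0" and x: "x > 0"
  shows "((\<lambda>x. integral {0..pi} (\<lambda>t. ln (C + (x * (2 * cos t))\<^sup>2))) has_real_derivative
    2 * pi / x * (1 - sqrt (C / (C + 4 * x\<^sup>2)))) (at x within {0<..})"
proof -
  let ?f = "\<lambda>x t. ln (C + (x * (2 * cos t))\<^sup>2)"
  let ?g = "\<lambda>x t. 8 * x * (cos t)\<^sup>2 / (C + (x * (2 * cos t))\<^sup>2)"
  have pos: "C + (x * (2 * cos t))\<^sup>2 > 0" for x t using C by (simp add: add_pos_nonneg)
  have "((\<lambda>x. integral (cbox 0 pi) (?f x)) has_field_derivative integral (cbox 0 pi) (?g x)) (at x within {0<..})"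
  proof (rule leibniz_rule_field_derivative)
    show "((\<lambda>x. ?f x t) has_real_derivative ?g x t) (at x within {0<..})" for x t
      by (rule derivative_eq_intros pos refl)+ (simp add: power2_eq_square divide_inverse mult_ac)
    show "?f x integrable_on cbox 0 pi" for x
      by (intro integrable_continuous continuous_intros ballI less_imp_neq[OF pos, symmetric])
    have "C + (fst p * (2 * cos (snd p)))\<^sup>2 \<noteq> 0" for p :: "real \<times> real"
      using pos[of "fst p" "snd p"] by simp
    then show "continuous_on ({0<..} \<times> cbox 0 pi) (\<lambda>(x, t). ?g x t)"
      unfolding split_beta by (intro continuous_intros ballI)
  qed (use x in auto)
  moreover have "integral (cbox 0 pi) (?g x) = 2 * pi / x * (1 - sqrt (C / (C + 4 * x\<^sup>2)))"
  proof -
    have H: "((\<lambda>t. 2 / x * (1 - C * (1 / (C + 4 * x\<^sup>2 * (cos t)\<^sup>2)))) has_integral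
        2 / x * (pi * 1 - C * (pi / sqrt (C * (C + 4 * x\<^sup>2))))) {0..pi}"
    proof (intro has_integral_mult_right has_integral_diff has_integral_inverse_cos_square)
      show "((\<lambda>t. 1) has_integral pi * 1) {0..pi}"
        using has_integral_const_real[of "1 :: real" 0 pi] by simp
    qed (use C in auto)
    have E: "2 / x * (1 - C * (1 / (C + 4 * x\<^sup>2 * (cos t)\<^sup>2))) = ?g x t" for t
    proof -
      have e: "C + (x * (2 * cos t))\<^sup>2 = C + 4 * x\<^sup>2 * (cos t)\<^sup>2" by (simp add: power_mult_distrib)
      have p: "C + 4 * x\<^sup>2 * (cos t)\<^sup>2 > 0" using pos[of x t] unfolding e .
      have "1 - C * (1 / (C + 4 * x\<^sup>2 * (cos t)\<^sup>2)) = 4 * x\<^sup>2 * (cos t)\<^sup>2 / (C + 4 * x\<^sup>2 * (cos t)\<^sup>2)"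
        using p by (simp add: field_simps)
      then show ?thesis unfolding e using x by (simp add: power2_eq_square)
    qed
    have S: "C * (pi / sqrt (C * (C + 4 * x\<^sup>2))) = pi * sqrt (C / (C + 4 * x\<^sup>2))"
    proof -
      have "C = sqrt C * sqrt C" using C by simp
      then have "C / sqrt (C * (C + 4 * x\<^sup>2)) = sqrt C / sqrt (C + 4 * x\<^sup>2)"
        using C by (metis mult_divide_mult_cancel_left_if real_sqrt_mult real_sqrt_eq_zero_cancel_iff less_irrefl)
      then have "pi * (C / sqrt (C * (C + 4 * x\<^sup>2))) = pi * sqrt (C / (C + 4 * x\<^sup>2))"
        unfolding real_sqrt_divide by simp
      then show ?thesis by (simp add: mult.commute)
    qed
    have "(?g x has_integral 2 / x * (pi - pi * sqrt (C / (C + 4 * x\<^sup>2)))) {0..pi}"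
      using H unfolding E S mult_1_right .
    then show ?thesis by (simp add: integral_unique right_diff_distrib)
  qed
  ultimately show ?thesis unfolding interval_cbox by (rule DERIV_cong)
qed

text \<open>Once the inner integral is differentiated in closed form, the outer integrand depends on
  \<open>s\<close> through \<open>(cos s)^2\<close> only, so \<open>[0, pi]\<close> folds onto
  \<open>[0, pi / 2]\<close>. This is the source of the factor \<open>2\<close> in
  \<open>2 / pi\<close>.\<close>

lemma energy_integral_deriv:
  assumes a: "a > 0" and z: "z \<noteq> 0"
  shows "((\<lambda>a. energy_integral a b z) has_real_derivative
    (1 - 2 / pi * integral {0..pi / 2} (\<lambda>s. sqrt ((z\<^sup>2 + 4 * b\<^sup>2 * (cos s)\<^sup>2) / (z\<^sup>2 + 4 * b\<^sup>2 * (cos s)\<^sup>2 + 4 * a\<^sup>2)))) / a)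
    (at a)"
proof -
  define C where "C s = z\<^sup>2 + 4 * b\<^sup>2 * (cos s)\<^sup>2" for s
  have C: "C s > 0" for s using z by (simp add: C_def add_pos_nonneg)
  have sym: "symbol x b z s t = C s + (x * (2 * cos t))\<^sup>2" for x s t
    by (simp add: symbol_def C_def power_mult_distrib)
  have spos: "symbol x b z s t \<noteq> 0" for x s t using symbol_ge[of z x b s t] z
    by (metis not_less zero_less_power2)
  let ?f = "\<lambda>x s. integral {0..pi} (\<lambda>t. ln (symbol x b z s t))"
  let ?g = "\<lambda>x s. 2 * pi / x * (1 - sqrt (C s / (C s + 4 * x\<^sup>2)))"
  define r where "r s = sqrt (C s / (C s + 4 * a\<^sup>2))" for s
  have den: "C s + 4 * x\<^sup>2 \<noteq> 0" for s x using C[of s] by (simp add: add_pos_nonneg less_imp_neq[symmetric])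
  have contC: "continuous_on A (\<lambda>p. C (f p))" if "continuous_on A f" for f and A :: "'a::t2_space set"
    unfolding C_def using that by (auto intro!: continuous_intros)
  have "((\<lambda>x. integral (cbox 0 pi) (?f x)) has_field_derivative integral (cbox 0 pi) (?g a)) (at a within {0<..})"
  proof (rule leibniz_rule_field_derivative)
    show "((\<lambda>x. ?f x s) has_real_derivative ?g x s) (at x within {0<..})" if "x \<in> {0<..}" for x s
      unfolding sym using inner_energy_deriv[OF C] that by simp
    show "?f x integrable_on cbox 0 pi" for x
    proof (rule integrable_continuous)
      have "continuous_on (cbox 0 pi \<times> cbox 0 pi) (\<lambda>(s, t). ln (symbol x b z s t))"
        unfolding split_beta using spos by (auto simp: symbol_def intro!: continuous_intros)
      then show "continuous_on (cbox 0 pi) (?f x)"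
        unfolding interval_cbox by (rule integral_continuous_on_param)
    qed
    show "continuous_on ({0<..} \<times> cbox 0 pi) (\<lambda>(x, s). ?g x s)"
      unfolding split_beta by (auto intro!: continuous_intros contC simp: den)
  qed (use a in auto)
  then have deriv: "((\<lambda>x. integral {0..pi} (?f x)) has_real_derivative integral {0..pi} (?g a)) (at a)"
    using at_within_open[of a "{0<..}"] a unfolding interval_cbox by simp
  have contr: "continuous_on A r" for A
    unfolding r_def by (auto intro!: continuous_intros contC simp: den)
  have "(?g a has_integral 2 * pi / a * (pi * 1 - integral {0..pi} r)) {0..pi}"
    unfolding r_def[symmetric]
  proof (intro has_integral_mult_right has_integral_diff)
    show "((\<lambda>t. 1) has_integral pi * 1) {0..pi}"
      using has_integral_const_real[of "1 :: real" 0 pi] by simp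
    show "(r has_integral integral {0..pi} r) {0..pi}"
      by (intro integrable_integral integrable_continuous_real contr)
  qed
  then have "integral {0..pi} (?g a) = 2 * pi / a * (pi - integral {0..pi} r)"
    unfolding mult_1_right by (rule integral_unique)
  moreover have "integral {0..pi} r = 2 * integral {0..pi / 2} r"
    by (rule reflect_half_pi_integral[OF contr]) (simp add: r_def C_def)
  ultimately have "integral {0..pi} (?g a) = 2 * pi / a * (pi - 2 * integral {0..pi / 2} r)" by simp
  then have "integral {0..pi} (?g a) / (2 * pi\<^sup>2) = (1 - 2 / pi * integral {0..pi / 2} r) / a"
    using a by (simp add: field_simps power2_eq_square)
  with DERIV_cdivide[OF deriv, of "2 * pi\<^sup>2"] show ?thesis
    unfolding energy_integral_def r_def C_def by simp
qed

text \<open>The amplitude has tangent \<open>T\<close>, chosen so that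
  \<open>k^2 * T^2 = \<mu>\<close>; hence \<open>heuman_kernel\<close> has the denominator of
  \<open>third_kind_reduction\<close>. The constants in front agree as well, because
  \<open>T * \<Delta> = sqrt ((p + q) / (p + r))\<close>.\<close>

lemma heuman_Lambda_third_kind:
  assumes p: "p > 0" and q: "q > 0" and r: "r > 0"
  shows "heuman_Lambda (arctan (sqrt ((p + q) / r))) (sqrt (q * r / ((p + r) * (p + q)))) =
    2 / pi * integral {0..pi / 2} (\<lambda>s. sqrt ((p + q * (cos s)\<^sup>2) / (p + q * (cos s)\<^sup>2 + r)))"
proof -
  define T where "T = sqrt ((p + q) / r)"
  define \<theta> where "\<theta> = arctan T"
  define k where "k = sqrt (q * r / ((p + r) * (p + q)))"
  define \<mu> where "\<mu> = q / (p + r)"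
  have T: "T > 0" "T\<^sup>2 = (p + q) / r" using assms by (simp_all add: T_def)
  have \<theta>: "0 \<le> \<theta>" "\<theta> < pi / 2" using T arctan_ubound[of T] by (simp_all add: \<theta>_def)
  have c: "cos \<theta> > 0" using \<theta> by (intro cos_gt_zero_pi) auto
  have s: "sin \<theta> = T * cos \<theta>" using c tan_arctan[of T] by (simp add: \<theta>_def[symmetric] tan_def field_simps)
  have c2: "(cos \<theta>)\<^sup>2 * (1 + T\<^sup>2) = 1"
    using sin_cos_squared_add[of \<theta>] unfolding s by (simp add: power_mult_distrib algebra_simps)
  have k2: "k\<^sup>2 = q * r / ((p + r) * (p + q))" unfolding k_def using assms by simp
  have k: "0 < k" "k < 1"
  proof -
    show "0 < k" unfolding k_def using assms by simp
    have "(p + r) * (p + q) = q * r + p * (p + q + r)" by (simp add: algebra_simps)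
    moreover have "p * (p + q + r) > 0" using assms by simp
    ultimately have "q * r < (p + r) * (p + q)" by linarith
    then show "k < 1" unfolding k_def using assms by simp
  qed
  note km = complementary_modulus[OF k]
  have kT: "k\<^sup>2 * T\<^sup>2 = \<mu>"
  proof -
    have "q * r / (A * B) * (B / r) = q / A" if "A > 0" "B > 0" for A B using that r by simp
    then show ?thesis unfolding k2 T(2) \<mu>_def using assms by simp
  qed
  have \<mu>: "\<mu> > 0" using assms by (simp add: \<mu>_def)
  define \<Delta> where "\<Delta> = ell_delta (sqrt (1 - k\<^sup>2)) \<theta>"
  have "\<Delta>\<^sup>2 = (cos \<theta>)\<^sup>2 * (1 + \<mu>)"
  proof -
    have "\<Delta>\<^sup>2 = 1 - (sin \<theta>)\<^sup>2 + k\<^sup>2 * (sin \<theta>)\<^sup>2"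
      unfolding \<Delta>_def ell_delta_square[OF km(3)] km(2) by (simp add: algebra_simps)
    also have "\<dots> = (cos \<theta>)\<^sup>2 + k\<^sup>2 * (sin \<theta>)\<^sup>2" by (simp add: cos_squared_eq)
    also have "\<dots> = (cos \<theta>)\<^sup>2 * (1 + k\<^sup>2 * T\<^sup>2)" unfolding s by (simp add: power_mult_distrib algebra_simps)
    finally show ?thesis unfolding kT .
  qed
  then have "(T * \<Delta>)\<^sup>2 = T\<^sup>2 * (1 + \<mu>) * (cos \<theta>)\<^sup>2" by (simp add: power_mult_distrib)
  also have "\<dots> = (p + q) / (p + r)"
  proof -
    have "(cos \<theta>)\<^sup>2 = 1 / (1 + T\<^sup>2)" using c2 T(1) by (simp add: field_simps add_pos_nonneg less_imp_neq[symmetric])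
    also have "1 + T\<^sup>2 = (p + q + r) / r" unfolding T(2) using r by (simp add: field_simps)
    finally have 1: "(cos \<theta>)\<^sup>2 = r / (p + q + r)" by simp
    have 2: "1 + \<mu> = (p + q + r) / (p + r)" using assms by (simp add: \<mu>_def field_simps)
    show ?thesis unfolding 1 2 T(2) using assms by simp
  qed
  finally have T\<Delta>: "sqrt ((p + q) / (p + r)) = T * \<Delta>"
    using T(1) ell_delta_pos[OF km(3), of \<theta>] by (intro real_sqrt_unique) (auto simp: \<Delta>_def)
  have "heuman_kernel k \<theta> x = T * \<Delta> * (ell_delta k x / (1 + \<mu> * (sin x)\<^sup>2))" for x
  proof -
    have "kernel_denom k \<theta> x = (cos \<theta>)\<^sup>2 * (1 + (k\<^sup>2 * T\<^sup>2) * (sin x)\<^sup>2)"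
      unfolding kernel_denom_def s by (simp add: power_mult_distrib algebra_simps)
    then have "heuman_kernel k \<theta> x = ((cos \<theta>)\<^sup>2 * (T * \<Delta> * ell_delta k x)) / ((cos \<theta>)\<^sup>2 * (1 + \<mu> * (sin x)\<^sup>2))"
      unfolding heuman_kernel_def \<Delta>_def[symmetric] kT s by (simp add: power2_eq_square mult_ac)
    then show ?thesis using c by simp
  qed
  then have kernel: "heuman_kernel k \<theta> = (\<lambda>x. T * \<Delta> * (ell_delta k x / (1 + \<mu> * (sin x)\<^sup>2)))"
    by (rule ext)
  have "heuman_Lambda \<theta> k = 2 / pi * (T * \<Delta> * integral {0..pi / 2} (\<lambda>x. ell_delta k x / (1 + \<mu> * (sin x)\<^sup>2)))"
    unfolding heuman_Lambda_eq_kernel_integral[OF k \<theta>] kernel integral_mult_right ..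
  then show ?thesis
    unfolding third_kind_reduction[OF assms] T\<Delta> \<theta>_def T_def k_def \<mu>_def .
qed

text \<open>\<open>Lim\<close> and \<open>deriv\<close> are total functions, so the formula for the
  density alone would not assert that the limit and the derivative exist; both are therefore part of
  the conclusion. \<open>heuman_Lambda_third_kind\<close> is applied with \<open>p = z^2\<close>,
  \<open>q = 4 * b^2\<close> and \<open>r = 4 * a^2\<close>.\<close>

theorem mainTheorem8:
  fixes a b z \<theta>\<^sub>a k :: real
  assumes "a > 0" and "b > 0" and "z > 0"
    and "\<theta>\<^sub>a = arctan (sqrt ((4 * b\<^sup>2 + z\<^sup>2) / (4 * a\<^sup>2)))"
    and "k = 4 * a * b / sqrt ((4 * a\<^sup>2 + z\<^sup>2) * (4 * b\<^sup>2 + z\<^sup>2))"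
  shows "(finite_free_energy a b z \<longlongrightarrow> free_energy a b z) even_pairs_at_top \<and>
         (\<lambda>x. free_energy x b z) differentiable (at a) \<and>
         density_a a b z = 1 - heuman_Lambda \<theta>\<^sub>a k"
proof -
  have z: "z \<noteq> 0" using assms(3) by simp
  have fe: "(\<lambda>x. free_energy x b z) = (\<lambda>x. energy_integral x b z)"
    by (rule ext) (rule free_energy_eq[OF z])
  define J where "J = integral {0..pi / 2} (\<lambda>s. sqrt ((z\<^sup>2 + 4 * b\<^sup>2 * (cos s)\<^sup>2) / (z\<^sup>2 + 4 * b\<^sup>2 * (cos s)\<^sup>2 + 4 * a\<^sup>2)))"
  have deriv: "((\<lambda>x. free_energy x b z) has_real_derivative (1 - 2 / pi * J) / a) (at a)"
    unfolding fe J_def by (rule energy_integral_deriv[OF assms(1) z])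
  have "sqrt (4 * b\<^sup>2 * (4 * a\<^sup>2) / ((z\<^sup>2 + 4 * a\<^sup>2) * (z\<^sup>2 + 4 * b\<^sup>2))) = k"
  proof -
    have "4 * b\<^sup>2 * (4 * a\<^sup>2) = (4 * a * b)\<^sup>2" by (simp add: power2_eq_square)
    then show ?thesis using assms(1,2) unfolding assms(5) real_sqrt_divide by (simp add: add.commute)
  qed
  then have "heuman_Lambda \<theta>\<^sub>a k = 2 / pi * J"
    using heuman_Lambda_third_kind[of "z\<^sup>2" "4 * b\<^sup>2" "4 * a\<^sup>2"] assms(1-3)
    unfolding J_def assms(4) by (simp add: add.commute)
  moreover have "density_a a b z = 1 - 2 / pi * J"
    unfolding density_a_def DERIV_imp_deriv[OF deriv] using assms(1) by simp
  moreover have "(\<lambda>x. free_energy x b z) differentiable (at a)"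
    using deriv real_differentiable_def by blast
  moreover have "(finite_free_energy a b z \<longlongrightarrow> free_energy a b z) even_pairs_at_top"
    unfolding free_energy_eq[OF z] by (rule finite_free_energy_tendsto[OF z])
  ultimately show ?thesis by simp
qed

end
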